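(* Let $\mathcal{G}$ be a graph class having a computable polynomial $(\mathrm{tw},\omega)$-binding function $f(k)=\mathcal{O}(k^c)$ for some constant $c$. Then, for all $\varepsilon>0$, the clique number can be approximated for graphs in $\mathcal{G}$ in polynomial time to within a factor of $\mathsf{opt}^{1-1/(c+\varepsilon)}$.
   Context: All graphs are finite, simple, undirected and nonempty. $\mathrm{tw}(G)$ is the treewidth and $\omega(G)$ the clique number of $G$. A function $f:\mathbb{N}\to\mathbb{N}$ is a $(\mathrm{tw},\omega)$-binding function for a graph class $\mathcal{G}$ if for every $G\in\mathcal{G}$ and every induced subgraph $G'$ of $G$, $\mathrm{tw}(G')\le f(\omega(G'))$. For an input graph $G$, $\mathsf{opt}=\omega(G)$. Approximating the clique number to within a factor $\rho$ means that, given $G\in\mathcal{G}$, the algorithm outputs a number $s$ (not necessarily a clique) with $\omega(G)/\rho\le s\le\omega(G)$; by convention approximation factors are at least $1$, a factor below $1$ being read as $1$. The constants $c$, $\varepsilon$ and the class are fixed, and polynomial time is in the size of $G$. *)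

theory Defs
  imports
    "Graph_Theory.Graph_Theory"
    "HOL-Computational_Algebra.Polynomial"
    "HOL-Library.Landau_Symbols"
begin

section \<open>Graphs\<close>

text \<open>
  An undirected graph is a symmetric loop-free digraph without parallel arcs; the edge between
  \<open>u\<close> and \<open>v\<close> is the pair of arcs \<open>(u, v)\<close>, \<open>(v, u)\<close>.
\<close>

definition simple_graph :: "'a pair_pre_digraph \<Rightarrow> bool" where
  "simple_graph G \<longleftrightarrow> pair_graph G \<and> pverts G \<noteq> {}"

definition clique :: "'a pair_pre_digraph \<Rightarrow> 'a set \<Rightarrow> bool" where
  "clique G C \<longleftrightarrow> C \<subseteq> pverts G \<and> (\<forall>u\<in>C. \<forall>v\<in>C. u \<noteq> v \<longrightarrow> (u, v) \<in> parcs G)"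

definition clique_number :: "'a pair_pre_digraph \<Rightarrow> nat" where
  "clique_number G = Max (card ` {C. clique G C})"

text \<open>
  The predicate \<open>tree\<close> of the graph library forbids all directed cycles, including
  \<open>u, v, u\<close>, so it is unsuitable for symmetric digraphs. A cycle of an undirected graph has at
  least three edges.
\<close>

definition undirected_tree :: "'a pair_pre_digraph \<Rightarrow> bool" where
  "undirected_tree T \<longleftrightarrow> simple_graph T \<and> Digraph_Component.connected (with_proj T) \<and>
     \<not> (\<exists>p. pre_digraph.cycle (with_proj T) p \<and> length p \<ge> 3)"

definition tree_decomposition ::
    "'a pair_pre_digraph \<Rightarrow> 'b pair_pre_digraph \<Rightarrow> ('b \<Rightarrow> 'a set) \<Rightarrow> bool" where
  "tree_decomposition G T X \<longleftrightarrow>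
     undirected_tree T \<and>
     (\<Union>t\<in>pverts T. X t) = pverts G \<and>
     (\<forall>(u, v)\<in>parcs G. \<exists>t\<in>pverts T. u \<in> X t \<and> v \<in> X t) \<and>
     (\<forall>v\<in>pverts G. Digraph_Component.connected (with_proj T \<restriction> {t \<in> pverts T. v \<in> X t}))"

definition decomposition_width :: "'b pair_pre_digraph \<Rightarrow> ('b \<Rightarrow> 'a set) \<Rightarrow> nat" where
  "decomposition_width T X = Max ((\<lambda>t. card (X t)) ` pverts T) - 1"

text \<open>Decomposition trees are finite, so their nodes may be taken to be natural numbers.\<close>

definition treewidth :: "'a pair_pre_digraph \<Rightarrow> nat" where
  "treewidth G = (LEAST w. \<exists>(T :: nat pair_pre_digraph) X.
     tree_decomposition G T X \<and> decomposition_width T X = w)"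

definition tw_omega_binding :: "(nat \<Rightarrow> nat) \<Rightarrow> 'a pair_pre_digraph set \<Rightarrow> bool" where
  "tw_omega_binding f \<G> \<longleftrightarrow>
     (\<forall>G\<in>\<G>. \<forall>H. induced_subgraph (with_proj H) (with_proj G) \<and> pverts H \<noteq> {} \<longrightarrow>
        treewidth H \<le> f (clique_number H))"


section \<open>Multi-tape Turing machines\<close>

text \<open>
  Deterministic machines with finitely many two-way infinite tapes. The non-halting states are
  \<open>0, \<dots>, states M - 1\<close>, with start state \<open>0\<close>; the halting state is \<open>states M\<close>. The
  symbols are \<open>0, \<dots>, symbols M - 1\<close>: \<open>0\<close> is the blank, \<open>1\<close> and \<open>2\<close> are the bits, and the
  rest are auxiliary. Tape \<open>0\<close> initially holds the input, tape \<open>1\<close> finally holds the output.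
\<close>

datatype move = MoveLeft | Stay | MoveRight

record turing_machine =
  tapes :: nat
  symbols :: nat
  states :: nat
  trans :: "nat \<Rightarrow> nat list \<Rightarrow> nat \<times> (nat \<times> move) list"

definition valid_machine :: "turing_machine \<Rightarrow> bool" where
  "valid_machine M \<longleftrightarrow> 2 \<le> tapes M \<and> 3 \<le> symbols M \<and>
     (\<forall>q < states M. \<forall>as. length as = tapes M \<and> (\<forall>a\<in>set as. a < symbols M) \<longrightarrow>
        fst (trans M q as) \<le> states M \<and>
        length (snd (trans M q as)) = tapes M \<and>
        (\<forall>(a, m)\<in>set (snd (trans M q as)). a < symbols M))"

text \<open>A tape is its contents together with the position of the head.\<close>

type_synonym tape = "(int \<Rightarrow> nat) \<times> int"

fun shift :: "move \<Rightarrow> int" where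
  "shift MoveLeft = -1"
| "shift Stay = 0"
| "shift MoveRight = 1"

fun act :: "nat \<times> move \<Rightarrow> tape \<Rightarrow> tape" where
  "act (a, m) (c, h) = (c(h := a), h + shift m)"

fun step :: "turing_machine \<Rightarrow> nat \<times> tape list \<Rightarrow> nat \<times> tape list" where
  "step M (q, ts) =
     (if q < states M
      then (let (q', acts) = trans M q (map (\<lambda>(c, h). c h) ts) in (q', map2 act acts ts))
      else (q, ts))"

definition word_contents :: "bool list \<Rightarrow> int \<Rightarrow> nat" where
  "word_contents x i =
     (if 0 \<le> i \<and> i < int (length x) then (if x ! nat i then 2 else 1) else 0)"

definition initial_config :: "turing_machine \<Rightarrow> bool list \<Rightarrow> nat \<times> tape list" where
  "initial_config M x =
     (0, (word_contents x, 0) # replicate (tapes M - 1) (word_contents [], 0))"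

text \<open>The output is the word starting in cell \<open>0\<close> and ending before the first blank.\<close>

definition computes_within :: "turing_machine \<Rightarrow> bool list \<Rightarrow> nat \<Rightarrow> bool list \<Rightarrow> bool" where
  "computes_within M x t y \<longleftrightarrow>
     (\<exists>ts. (step M ^^ t) (initial_config M x) = (states M, ts) \<and>
        (\<forall>i \<le> length y. fst (ts ! 1) (int i) = word_contents y (int i)))"


section \<open>Computability and polynomial-time approximation\<close>

text \<open>Binary numerals, least significant bit first.\<close>

fun binary :: "nat \<Rightarrow> bool list" where
  "binary n = (if n = 0 then [] else odd n # binary (n div 2))"

declare binary.simps [simp del]

definition computable :: "(nat \<Rightarrow> nat) \<Rightarrow> bool" where
  "computable f \<longleftrightarrow>
     (\<exists>M. valid_machine M \<and> (\<forall>k. \<exists>t. computes_within M (binary k) t (binary (f k))))"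

text \<open>
  A graph is presented by the number of its vertices in unary and its adjacency matrix, row by
  row, with respect to an enumeration \<open>vs\<close> of the vertices.
\<close>

definition graph_code :: "'a pair_pre_digraph \<Rightarrow> 'a list \<Rightarrow> bool list" where
  "graph_code G vs =
     replicate (length vs) True @ False # concat (map (\<lambda>u. map (\<lambda>v. (u, v) \<in> parcs G) vs) vs)"

text \<open>
  The approximation factor \<open>\<rho>\<close> is a function of the optimum. It is read as \<open>1\<close> where it is
  below \<open>1\<close>. The machine must succeed for every enumeration of the vertices.
\<close>

definition clique_number_poly_time_approximable ::
    "'a pair_pre_digraph set \<Rightarrow> (nat \<Rightarrow> real) \<Rightarrow> bool" where
  "clique_number_poly_time_approximable \<G> \<rho> \<longleftrightarrow>
     (\<exists>M (p :: nat poly). valid_machine M \<and>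
        (\<forall>G\<in>\<G>. \<forall>vs. distinct vs \<and> set vs = pverts G \<longrightarrow>
           (\<exists>s. computes_within M (graph_code G vs) (poly p (length (graph_code G vs))) (binary s) \<and>
              real (clique_number G) / max 1 (\<rho> (clique_number G)) \<le> real s \<and>
              s \<le> clique_number G)))"

end

theory Submission
  imports Defs "HOL-Real_Asymp.Real_Asymp"
begin

text \<open>
  The clique number \<open>\<omega>\<close> is at most the degeneracy plus one, the degeneracy is at most the treewidth of
  some induced subgraph, and peeling determines it up to a constant factor. First let \<open>c \<ge> 1\<close>, and let
  \<open>f(k) \<le> K k\<^sup>c\<close> for all \<open>k \<ge> 1\<close>. Fix a threshold \<open>m\<close> and delete vertices with fewer than \<open>m\<close> remaining
  neighbours until nothing changes. A clique with more than \<open>m\<close> vertices survives, so if everything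
  disappears then \<open>\<omega> \<le> m\<close>. What survives otherwise is an induced subgraph \<open>H\<close> of minimum degree at
  least \<open>m\<close>, and then \<open>m \<le> tw(H) \<le> f(\<omega>(H)) \<le> K \<omega>\<^sup>c\<close>: a tree decomposition has a bag that contains some
  vertex together with all its neighbours (\<open>minimum_degree_le_treewidth\<close>). Letting the threshold run
  through \<open>1, \<beta>, \<beta>\<^sup>2, \<dots>\<close> until everything disappears, the last threshold \<open>m = \<beta>\<^sup>i\<close> satisfies
  \<open>\<omega> \<le> m\<close> and, if \<open>i > 0\<close>, also \<open>m \<le> \<beta> K \<omega>\<^sup>c\<close> (\<open>peeling_invariant_peel\<close>).

  Choose a rational \<open>a/b\<close> strictly between \<open>1/(c + \<epsilon>)\<close> and \<open>1/c\<close>, take \<open>\<beta> = 2\<^sup>b\<close> and output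
  \<open>s = 2\<^bsup>a i\<^esup>\<close>, which is \<open>m\<close> to the power \<open>a/b\<close>. The lower bound on \<open>m\<close> gives \<open>s \<ge> \<omega>\<close> to the power
  \<open>1/(c + \<epsilon>)\<close>, as required; the upper bound gives \<open>s \<le> \<omega>\<close> once \<open>\<omega>\<close> exceeds a constant \<open>k0\<close>, because the
  exponent \<open>c a/b\<close> is below \<open>1\<close> (\<open>approximation_guarantee\<close>). Smaller clique numbers are found exactly, by
  searching for cliques of each size up to \<open>k0\<close>. For \<open>c < 1\<close> the clique number is bounded, since
  \<open>\<omega> - 1 \<le> f(\<omega>)\<close> (\<open>clique_number_le_binding\<close>), so with \<open>k0\<close> above the bound the search always answers.

  The algorithm is written in a small while language whose variables are tapes; a compiler into
  Turing machines preserves the number of steps exactly (\<open>compile_correct\<close>), and a weakest precondition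
  calculus bounds it. Thresholds are kept in unary, so that a degree is compared with a threshold by
  moving one head. As \<open>s\<close> is a power of two, its numeral consists of \<open>a i\<close> zeros and a one: each time the
  threshold is raised \<open>a\<close> zeros are appended to the output, and no arithmetic has to be programmed.
\<close>

section \<open>A while language for Turing machines\<close>

text \<open>
  Variables \<open>'v\<close> name tapes. A test only looks at the symbol under the head, so every construct costs a
  bounded number of machine steps and can be compiled on its own.
\<close>
datatype 'v com =
    Skip
  | Act 'v "nat \<Rightarrow> nat" move
  | Seq "'v com" "'v com" (infixr \<open>;;\<close> 60)
  | Cond 'v "nat set" "'v com" "'v com"
  | While 'v "nat set" "'v com"

definition scanned :: "tape \<Rightarrow> nat" where
  "scanned t = fst t (snd t)"

text \<open>
  The step counts are those of the compiled code: a conditional spends one step on its test and,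
  after the first branch, one on the jump over the second; a loop spends one step on each test and one
  on each jump back.
\<close>
inductive exec :: "'v com \<Rightarrow> ('v \<Rightarrow> tape) \<Rightarrow> nat \<Rightarrow> ('v \<Rightarrow> tape) \<Rightarrow> bool" where
  Skip: "exec Skip \<sigma> 0 \<sigma>"
| Act: "exec (Act v h m) \<sigma> 1 (\<sigma>(v := act (h (scanned (\<sigma> v)), m) (\<sigma> v)))"
| Seq: "exec c \<sigma> n \<sigma>' \<Longrightarrow> exec d \<sigma>' k \<sigma>'' \<Longrightarrow> exec (c ;; d) \<sigma> (n + k) \<sigma>''"
| CondT: "scanned (\<sigma> v) \<in> S \<Longrightarrow> exec c \<sigma> n \<sigma>' \<Longrightarrow> exec (Cond v S c d) \<sigma> (Suc (n + 1)) \<sigma>'"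
| CondF: "scanned (\<sigma> v) \<notin> S \<Longrightarrow> exec d \<sigma> n \<sigma>' \<Longrightarrow> exec (Cond v S c d) \<sigma> (Suc n) \<sigma>'"
| WhileT: "scanned (\<sigma> v) \<in> S \<Longrightarrow> exec c \<sigma> n \<sigma>' \<Longrightarrow> exec (While v S c) \<sigma>' k \<sigma>'' \<Longrightarrow>
    exec (While v S c) \<sigma> (Suc (n + Suc k)) \<sigma>''"
| WhileF: "scanned (\<sigma> v) \<notin> S \<Longrightarrow> exec (While v S c) \<sigma> 1 \<sigma>"

inductive_cases SkipE: "exec Skip \<sigma> n \<sigma>'"
inductive_cases ActE: "exec (Act v h m) \<sigma> n \<sigma>'"
inductive_cases SeqE: "exec (c ;; d) \<sigma> n \<sigma>'"
inductive_cases CondE: "exec (Cond v S c d) \<sigma> n \<sigma>'"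

section \<open>Compilation\<close>

type_synonym instruction = "nat list \<Rightarrow> nat \<times> (nat \<times> move) list"

fun code_size :: "'v com \<Rightarrow> nat" where
  "code_size Skip = 0"
| "code_size (Act v h m) = 1"
| "code_size (c ;; d) = code_size c + code_size d"
| "code_size (Cond v S c d) = code_size c + code_size d + 2"
| "code_size (While v S c) = code_size c + 2"

definition keep :: "nat list \<Rightarrow> (nat \<times> move) list" where
  "keep as = map (\<lambda>a. (a, Stay)) as"

definition symbol_of :: "'v list \<Rightarrow> 'v \<Rightarrow> nat list \<Rightarrow> nat" where
  "symbol_of vs v as = the (map_of (zip vs as) v)"

text \<open>
  The argument \<open>p\<close> is the address of the first instruction, since jump targets are absolute; execution
  leaves the code at the address right behind it.
\<close>
fun compile :: "'v list \<Rightarrow> 'v com \<Rightarrow> nat \<Rightarrow> instruction list" where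
  "compile vs Skip p = []"
| "compile vs (Act v h m) p =
     [\<lambda>as. (Suc p, map2 (\<lambda>w a. if w = v then (h a, m) else (a, Stay)) vs as)]"
| "compile vs (c ;; d) p = compile vs c p @ compile vs d (p + code_size c)"
| "compile vs (Cond v S c d) p =
     (\<lambda>as. (if symbol_of vs v as \<in> S then p + 1 else p + 2 + code_size c, keep as)) #
     compile vs c (p + 1) @
     (\<lambda>as. (p + 2 + code_size c + code_size d, keep as)) #
     compile vs d (p + 2 + code_size c)"
| "compile vs (While v S c) p =
     (\<lambda>as. (if symbol_of vs v as \<in> S then p + 1 else p + 2 + code_size c, keep as)) #
     compile vs c (p + 1) @ [\<lambda>as. (p, keep as)]"

fun uses :: "'v com \<Rightarrow> 'v set" where
  "uses Skip = {}"
| "uses (Act v h m) = {v}"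
| "uses (c ;; d) = uses c \<union> uses d"
| "uses (Cond v S c d) = insert v (uses c \<union> uses d)"
| "uses (While v S c) = insert v (uses c)"

fun three_symbols :: "'v com \<Rightarrow> bool" where
  "three_symbols Skip = True"
| "three_symbols (Act v h m) = (\<forall>a<3. h a < 3)"
| "three_symbols (c ;; d) = (three_symbols c \<and> three_symbols d)"
| "three_symbols (Cond v S c d) = (three_symbols c \<and> three_symbols d)"
| "three_symbols (While v S c) = three_symbols c"

definition machine :: "'v list \<Rightarrow> 'v com \<Rightarrow> turing_machine" where
  "machine vs c = \<lparr> tapes = length vs, symbols = 3, states = code_size c,
     trans = (\<lambda>q. compile vs c 0 ! q) \<rparr>"

lemma length_compile [simp]: "length (compile vs c p) = code_size c"
  by (induction c arbitrary: p) auto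

lemma instruction_valid:
  assumes "three_symbols c" "I \<in> set (compile vs c p)" "length as = length vs" "\<forall>a\<in>set as. a < 3"
  shows "fst (I as) \<le> p + code_size c \<and> length (snd (I as)) = length vs \<and>
    (\<forall>(a, m)\<in>set (snd (I as)). a < 3)"
  using assms
proof (induction c arbitrary: p)
  case (Act v h m)
  then show ?case by (auto dest!: set_zip_rightD split: if_splits)
next
  case (Seq c d)
  then show ?case by fastforce
next
  case (Cond v S c d)
  from Cond.prems consider
      "I = (\<lambda>as. (if symbol_of vs v as \<in> S then p + 1 else p + 2 + code_size c, keep as))"
    | "I \<in> set (compile vs c (p + 1))"
    | "I = (\<lambda>as. (p + 2 + code_size c + code_size d, keep as))"
    | "I \<in> set (compile vs d (p + 2 + code_size c))"
    by auto
  then show ?case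
  proof cases
    case 2
    with Cond.IH(1)[of "p + 1"] Cond.prems show ?thesis by auto
  next
    case 4
    with Cond.IH(2)[of "p + 2 + code_size c"] Cond.prems show ?thesis by auto
  qed (use Cond.prems in \<open>auto simp: keep_def\<close>)
next
  case (While v S c)
  from While.prems consider
      "I = (\<lambda>as. (if symbol_of vs v as \<in> S then p + 1 else p + 2 + code_size c, keep as))"
    | "I \<in> set (compile vs c (p + 1))"
    | "I = (\<lambda>as. (p, keep as))"
    by auto
  then show ?case
  proof cases
    case 2
    with While.IH(1)[of "p + 1"] While.prems show ?thesis by auto
  qed (use While.prems in \<open>auto simp: keep_def\<close>)
qed auto

lemma valid_machine_compile:
  assumes "three_symbols c" "2 \<le> length vs"
  shows "valid_machine (machine vs c)"
  unfolding valid_machine_def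
proof (intro conjI allI impI; (elim conjE)?)
  fix q as
  assume q: "q < states (machine vs c)" and as: "length as = tapes (machine vs c)"
    "\<forall>a\<in>set as. a < symbols (machine vs c)"
  have I: "trans (machine vs c) q \<in> set (compile vs c 0)"
    using q by (auto simp: machine_def intro!: nth_mem)
  note V = instruction_valid[OF assms(1) I, of as]
  show "fst (trans (machine vs c) q as) \<le> states (machine vs c)"
    "length (snd (trans (machine vs c) q as)) = tapes (machine vs c)"
    "\<forall>(a, m)\<in>set (snd (trans (machine vs c) q as)). a < symbols (machine vs c)"
    using V as by (auto simp: machine_def)
qed (use assms in \<open>auto simp: machine_def\<close>)

section \<open>Correctness of compilation\<close>

definition reads :: "'v list \<Rightarrow> ('v \<Rightarrow> tape) \<Rightarrow> nat list" where
  "reads vs \<sigma> = map (\<lambda>v. scanned (\<sigma> v)) vs"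

lemma symbol_of_reads [simp]:
  "v \<in> set vs \<Longrightarrow> symbol_of vs v (reads vs \<sigma>) = scanned (\<sigma> v)"
  by (simp add: symbol_of_def reads_def map_of_zip_map)

lemma act_keep: "map2 act (keep (reads vs \<sigma>)) (map \<sigma> vs) = map \<sigma> vs"
proof (rule nth_equalityI)
  fix i assume "i < length (map2 act (keep (reads vs \<sigma>)) (map \<sigma> vs))"
  then show "map2 act (keep (reads vs \<sigma>)) (map \<sigma> vs) ! i = map \<sigma> vs ! i"
    by (cases "\<sigma> (vs ! i)") (auto simp: keep_def reads_def scanned_def)
qed (auto simp: keep_def reads_def)

lemma step_machine:
  assumes "q < code_size c"
  shows "step (machine vs c) (q, map \<sigma> vs) =
    (let (q', as) = (compile vs c 0 ! q) (reads vs \<sigma>) in (q', map2 act as (map \<sigma> vs)))"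
proof -
  have "map (\<lambda>(c, h). c h) (map \<sigma> vs) = reads vs \<sigma>"
    by (auto simp: reads_def scanned_def split: prod.splits)
  then show ?thesis using assms by (simp add: machine_def)
qed

declare step.simps [simp del]

definition code_at :: "instruction list \<Rightarrow> nat \<Rightarrow> instruction list \<Rightarrow> bool" where
  "code_at P p C \<longleftrightarrow> (\<exists>xs ys. P = xs @ C @ ys \<and> length xs = p)"

lemma code_at_append:
  "code_at P p (C @ D) \<longleftrightarrow> code_at P p C \<and> code_at P (p + length C) D" (is "?L \<longleftrightarrow> ?R")
proof
  assume ?L
  then obtain xs ys where P: "P = xs @ C @ D @ ys" "length xs = p" by (auto simp: code_at_def)
  then show ?R unfolding code_at_def
    by (intro conjI exI[of _ xs] exI[of _ "D @ ys"] exI[of _ "xs @ C"] exI[of _ ys]) auto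
next
  assume ?R
  then have "code_at P p C" "code_at P (p + length C) D" by auto
  then obtain xs ys xs' ys' where P: "P = xs @ C @ ys" "length xs = p"
    "P = xs' @ D @ ys'" "length xs' = p + length C" unfolding code_at_def by metis
  then have "ys = D @ ys'"
    by (metis append.assoc append_eq_append_conv length_append)
  with P show ?L by (auto simp: code_at_def)
qed

lemma code_at_Cons:
  "code_at P p (I # C) \<longleftrightarrow> p < length P \<and> P ! p = I \<and> code_at P (Suc p) C"
proof -
  have "code_at P p [I] \<longleftrightarrow> p < length P \<and> P ! p = I"
  proof
    assume "p < length P \<and> P ! p = I"
    then show "code_at P p [I]" unfolding code_at_def
      by (intro exI[of _ "take p P"] exI[of _ "drop (Suc p) P"]) (auto simp: id_take_nth_drop[symmetric])
  qed (auto simp: code_at_def)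
  then show ?thesis using code_at_append[of P p "[I]" C] by auto
qed

lemma steps_add:
  "(step M ^^ n) x = y \<Longrightarrow> (step M ^^ k) y = z \<Longrightarrow> (step M ^^ (n + k)) x = z"
  by (metis add.commute comp_apply funpow_add)

lemma steps_Suc: "step M x = y \<Longrightarrow> (step M ^^ k) y = z \<Longrightarrow> (step M ^^ Suc k) x = z"
  by (simp add: funpow_swap1)

text \<open>
  Every execution rule corresponds to a run through the compiled block, wherever the block is located in
  a larger program. Taking the whole program at address \<open>0\<close>, the exit address is the halting state.
\<close>

lemma compile_correct:
  assumes "exec c \<sigma> n \<sigma>'" "code_at (compile vs c0 0) p (compile vs c p)"
    "uses c \<subseteq> set vs" "distinct vs"
  shows "(step (machine vs c0) ^^ n) (p, map \<sigma> vs) = (p + code_size c, map \<sigma>' vs)"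
  using assms
proof (induction arbitrary: p rule: exec.induct)
  case (Act v h m \<sigma>)
  have "map2 act (map2 (\<lambda>w a. if w = v then (h a, m) else (a, Stay)) vs (reads vs \<sigma>)) (map \<sigma> vs)
      = map (\<sigma>(v := act (h (scanned (\<sigma> v)), m) (\<sigma> v))) vs" (is "?l = ?r")
  proof (rule nth_equalityI)
    fix i assume "i < length ?l"
    then show "?l ! i = ?r ! i"
      by (cases "\<sigma> (vs ! i)") (auto simp: reads_def scanned_def)
  qed (simp add: reads_def)
  with Act show ?case by (auto simp: code_at_Cons step_machine)
next
  case (Seq c \<sigma> n \<sigma>' d k \<sigma>'')
  then show ?case
    by (auto simp: code_at_append add.assoc[symmetric] intro!: steps_add)
next
  case (CondT \<sigma> v S c n \<sigma>' d)
  let ?M = "machine vs c0"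
  have "step ?M (p, map \<sigma> vs) = (Suc p, map \<sigma> vs)"
    using CondT by (auto simp: code_at_Cons step_machine act_keep)
  moreover have "(step ?M ^^ n) (Suc p, map \<sigma> vs) = (Suc p + code_size c, map \<sigma>' vs)"
    using CondT by (auto simp: code_at_Cons code_at_append)
  moreover have "step ?M (Suc p + code_size c, map \<sigma>' vs) =
      (p + code_size (Cond v S c d), map \<sigma>' vs)"
    using CondT by (auto simp: code_at_Cons code_at_append step_machine act_keep)
  then have "(step ?M ^^ 1) (Suc p + code_size c, map \<sigma>' vs) =
      (p + code_size (Cond v S c d), map \<sigma>' vs)" by simp
  ultimately show ?case by (blast intro: steps_Suc steps_add)
next
  case (CondF \<sigma> v S d n \<sigma>' c)
  let ?M = "machine vs c0"
  have "step ?M (p, map \<sigma> vs) = (p + 2 + code_size c, map \<sigma> vs)"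
    using CondF by (auto simp: code_at_Cons step_machine act_keep)
  moreover have "(step ?M ^^ n) (p + 2 + code_size c, map \<sigma> vs) =
      (p + 2 + code_size c + code_size d, map \<sigma>' vs)"
    using CondF by (intro CondF.IH) (auto simp: code_at_Cons code_at_append)
  then have "(step ?M ^^ n) (p + 2 + code_size c, map \<sigma> vs) =
      (p + code_size (Cond v S c d), map \<sigma>' vs)" by (simp add: ac_simps)
  ultimately show ?case by (blast intro: steps_Suc)
next
  case (WhileT \<sigma> v S c n \<sigma>' k \<sigma>'')
  let ?M = "machine vs c0"
  have "step ?M (p, map \<sigma> vs) = (Suc p, map \<sigma> vs)"
    using WhileT by (auto simp: code_at_Cons step_machine act_keep)
  moreover have "(step ?M ^^ n) (Suc p, map \<sigma> vs) = (Suc p + code_size c, map \<sigma>' vs)"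
    using WhileT by (intro WhileT.IH) (auto simp: code_at_Cons code_at_append)
  moreover have "step ?M (Suc p + code_size c, map \<sigma>' vs) = (p, map \<sigma>' vs)"
    using WhileT by (auto simp: code_at_Cons code_at_append step_machine act_keep)
  moreover have "(step ?M ^^ k) (p, map \<sigma>' vs) = (p + code_size (While v S c), map \<sigma>'' vs)"
    using WhileT by blast
  ultimately show ?case by (blast intro: steps_Suc steps_add)
next
  case (WhileF \<sigma> v S c)
  then show ?case by (auto simp: code_at_Cons step_machine act_keep)
qed auto

lemma steps_halted: "(step M ^^ n) (states M, ts) = (states M, ts)"
  by (induction n) (auto simp: step.simps)

text \<open>
  The halting state is absorbing, so the exact running time may be replaced by any larger number. This
  is what allows a polynomial bound in place of the running time.
\<close>

lemma computes_within_compile: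
  assumes "exec c \<sigma> n \<sigma>'" "n \<le> t" "uses c \<subseteq> set vs" "distinct vs"
    and vs: "vs = i # out # ws"
    and \<sigma>: "\<sigma> i = (word_contents x, 0)" "\<And>v. v \<noteq> i \<Longrightarrow> \<sigma> v = (word_contents [], 0)"
    and out: "fst (\<sigma>' out) = word_contents y"
  shows "computes_within (machine vs c) x t y"
proof -
  let ?M = "machine vs c"
  have "code_at (compile vs c 0) 0 (compile vs c 0)"
    by (auto simp: code_at_def intro: exI[of _ "[]"])
  with compile_correct[OF assms(1)] assms
  have "(step ?M ^^ n) (0, map \<sigma> vs) = (code_size c, map \<sigma>' vs)" by fastforce
  then have "(step ?M ^^ n) (0, map \<sigma> vs) = (states ?M, map \<sigma>' vs)" by (simp add: machine_def)
  with steps_halted[of "t - n" ?M] have "(step ?M ^^ (n + (t - n))) (0, map \<sigma> vs) = (states ?M, map \<sigma>' vs)"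
    by (blast intro: steps_add)
  moreover have "map \<sigma> ws = replicate (length ws) (word_contents [], 0)"
    using \<open>distinct vs\<close> vs \<sigma>(2) by (subst map_replicate_const[symmetric]) (intro map_cong, auto, metis)
  then have "initial_config ?M x = (0, map \<sigma> vs)"
    using \<open>distinct vs\<close> by (auto simp: initial_config_def machine_def vs \<sigma>)
  ultimately show ?thesis
    using \<open>n \<le> t\<close> out by (auto simp: computes_within_def vs)
qed

section \<open>Weakest preconditions with running times\<close>

definition wp :: "'v com \<Rightarrow> ('v \<Rightarrow> tape) \<Rightarrow> (nat \<Rightarrow> ('v \<Rightarrow> tape) \<Rightarrow> bool) \<Rightarrow> bool" where
  "wp c \<sigma> Q \<longleftrightarrow> (\<exists>n \<sigma>'. exec c \<sigma> n \<sigma>' \<and> Q n \<sigma>')"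

text \<open>
  Total correctness with a time bound. The predicate \<open>wp\<close>, whose postcondition also sees the time, is
  computed by rewriting on straight-line code; \<open>achieves\<close> is the form in which loops are composed.
\<close>

definition achieves :: "'v com \<Rightarrow> ('v \<Rightarrow> tape) \<Rightarrow> nat \<Rightarrow> (('v \<Rightarrow> tape) \<Rightarrow> bool) \<Rightarrow> bool" where
  "achieves c \<sigma> t Q \<longleftrightarrow> wp c \<sigma> (\<lambda>n \<sigma>'. n \<le> t \<and> Q \<sigma>')"

lemma wp_Skip [simp]: "wp Skip \<sigma> Q \<longleftrightarrow> Q 0 \<sigma>"
  by (auto simp: wp_def intro: exec.intros elim: SkipE)

lemma wp_Act [simp]:
  "wp (Act v h m) \<sigma> Q \<longleftrightarrow> Q 1 (\<sigma>(v := act (h (scanned (\<sigma> v)), m) (\<sigma> v)))"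
  (is "_ \<longleftrightarrow> ?R")
proof
  show "wp (Act v h m) \<sigma> Q \<Longrightarrow> ?R" by (auto simp: wp_def elim!: ActE)
  show "?R \<Longrightarrow> wp (Act v h m) \<sigma> Q" unfolding wp_def by (intro exI conjI, rule exec.Act)
qed

lemma wp_Seq [simp]: "wp (c ;; d) \<sigma> Q \<longleftrightarrow> wp c \<sigma> (\<lambda>n \<sigma>'. wp d \<sigma>' (\<lambda>k. Q (n + k)))"
  by (auto simp: wp_def intro: exec.intros elim!: SeqE)

lemma wp_Cond [simp]:
  "wp (Cond v S c d) \<sigma> Q \<longleftrightarrow>
     (if scanned (\<sigma> v) \<in> S then wp c \<sigma> (\<lambda>n. Q (n + 2)) else wp d \<sigma> (\<lambda>n. Q (n + 1)))"
  by (auto simp: wp_def elim!: CondE) (metis exec.CondT add_2_eq_Suc' add_Suc_right Suc_eq_plus1, metis exec.CondF)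

lemma wp_mono: "wp c \<sigma> Q \<Longrightarrow> (\<And>n \<sigma>'. Q n \<sigma>' \<Longrightarrow> Q' n \<sigma>') \<Longrightarrow> wp c \<sigma> Q'"
  by (auto simp: wp_def)

lemma achieves_mono:
  "achieves c \<sigma> t Q \<Longrightarrow> t \<le> t' \<Longrightarrow> (\<And>\<sigma>'. Q \<sigma>' \<Longrightarrow> Q' \<sigma>') \<Longrightarrow> achieves c \<sigma> t' Q'"
  by (force simp: achieves_def wp_def)

lemma achieves_Skip: "Q \<sigma> \<Longrightarrow> achieves Skip \<sigma> t Q"
  by (simp add: achieves_def)

lemma achieves_Seq:
  assumes "achieves c \<sigma> t R" "\<And>\<sigma>'. R \<sigma>' \<Longrightarrow> achieves d \<sigma>' t' Q"
  shows "achieves (c ;; d) \<sigma> (t + t') Q"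
  using assms unfolding achieves_def wp_def by (meson exec.Seq add_mono)

lemma achieves_Cond:
  assumes "scanned (\<sigma> v) \<in> S \<Longrightarrow> achieves c \<sigma> t Q" "scanned (\<sigma> v) \<notin> S \<Longrightarrow> achieves d \<sigma> t Q"
  shows "achieves (Cond v S c d) \<sigma> (t + 2) Q"
proof (cases "scanned (\<sigma> v) \<in> S")
  case True
  with assms(1) obtain n \<sigma>' where "exec c \<sigma> n \<sigma>'" "n \<le> t" "Q \<sigma>'" by (auto simp: achieves_def wp_def)
  with exec.CondT[of \<sigma> v S c n \<sigma>' d] True show ?thesis
    unfolding achieves_def wp_def by (intro exI[of _ "Suc (n + 1)"] exI[of _ \<sigma>']) auto
next
  case False
  with assms(2) obtain n \<sigma>' where "exec d \<sigma> n \<sigma>'" "n \<le> t" "Q \<sigma>'" by (auto simp: achieves_def wp_def)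
  with exec.CondF[of \<sigma> v S d n \<sigma>' c] False show ?thesis
    unfolding achieves_def wp_def by (intro exI[of _ "Suc n"] exI[of _ \<sigma>']) auto
qed

text \<open>
  The index of \<open>I\<close> bounds the number of remaining iterations. It is an index and not a function of the
  state because it refers to data that is only represented on the tapes.
\<close>

lemma achieves_While_measure:
  assumes "I k \<sigma>"
    and "\<And>k \<sigma>. I k \<sigma> \<Longrightarrow> scanned (\<sigma> v) \<in> S \<Longrightarrow> achieves c \<sigma> t (\<lambda>\<sigma>'. \<exists>k'<k. I k' \<sigma>')"
  shows "achieves (While v S c) \<sigma> (k * (t + 2) + 1) (\<lambda>\<sigma>'. (\<exists>k. I k \<sigma>') \<and> scanned (\<sigma>' v) \<notin> S)"
  using assms(1)
proof (induction k arbitrary: \<sigma> rule: less_induct)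
  case (less k)
  show ?case
  proof (cases "scanned (\<sigma> v) \<in> S")
    case True
    obtain n \<sigma>' k' where n: "exec c \<sigma> n \<sigma>'" "n \<le> t" "I k' \<sigma>'" "k' < k"
      using assms(2)[OF less.prems True] by (auto simp: achieves_def wp_def)
    obtain i \<sigma>'' where i: "exec (While v S c) \<sigma>' i \<sigma>''" "i \<le> k' * (t + 2) + 1"
      "\<exists>k. I k \<sigma>''" "scanned (\<sigma>'' v) \<notin> S"
      using less.IH[OF n(4,3)] unfolding achieves_def wp_def by blast
    have "Suc k' * (t + 2) \<le> k * (t + 2)"
      using n(4) by (intro mult_right_mono) auto
    then have "Suc (n + Suc i) \<le> k * (t + 2) + 1" using n i by simp
    with exec.WhileT[OF True n(1) i(1)] i show ?thesis
      unfolding achieves_def wp_def by blast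
  next
    case False
    with less.prems show ?thesis
      unfolding achieves_def wp_def
      by (intro exI[of _ 1] exI[of _ \<sigma>]) (auto simp del: One_nat_def intro: exec.WhileF)
  qed
qed

text \<open>
  A loop whose number of iterations is known in advance: \<open>I k\<close> describes the state after \<open>k\<close> of them.
  All sweeps over a tape are of this form.
\<close>

lemma achieves_While_count:
  assumes "I 0 \<sigma>"
    and "\<And>k \<sigma>. k < n \<Longrightarrow> I k \<sigma> \<Longrightarrow> scanned (\<sigma> v) \<in> S"
    and "\<And>k \<sigma>. k < n \<Longrightarrow> I k \<sigma> \<Longrightarrow> achieves c \<sigma> t (I (Suc k))"
    and "\<And>\<sigma>. I n \<sigma> \<Longrightarrow> scanned (\<sigma> v) \<notin> S"
  shows "achieves (While v S c) \<sigma> (n * (t + 2) + 1) (I n)"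
proof -
  have "achieves (While v S c) \<sigma> ((n - k) * (t + 2) + 1) (I n)" if "I k \<sigma>" "k \<le> n" for k \<sigma>
    using that
  proof (induction "n - k" arbitrary: k \<sigma>)
    case 0
    with assms(4) show ?case
      unfolding achieves_def wp_def
      by (intro exI[of _ 1] exI[of _ \<sigma>]) (auto simp del: One_nat_def intro: exec.WhileF)
  next
    case (Suc m)
    then have k: "k < n" by simp
    obtain i \<sigma>' where i: "exec c \<sigma> i \<sigma>'" "i \<le> t" "I (Suc k) \<sigma>'"
      using assms(3)[OF k Suc.prems(1)] by (auto simp: achieves_def wp_def)
    obtain j \<sigma>'' where j: "exec (While v S c) \<sigma>' j \<sigma>''" "j \<le> (n - Suc k) * (t + 2) + 1" "I n \<sigma>''"
      using Suc.hyps(1)[of "Suc k" \<sigma>'] i(3) Suc.hyps(2) k unfolding achieves_def wp_def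
      by (metis Suc_leI Suc_diff_Suc Suc_inject)
    have "n - k = Suc (n - Suc k)" using k by simp
    then have "Suc (i + Suc j) \<le> (n - k) * (t + 2) + 1" using i j by simp
    with exec.WhileT[OF assms(2)[OF k Suc.prems(1)] i(1) j(1)] j show ?case
      unfolding achieves_def wp_def by blast
  qed
  from this[of 0 \<sigma>] assms(1) show ?thesis by simp
qed

section \<open>Tapes that hold a word\<close>

definition bit :: "bool \<Rightarrow> nat" where
  "bit b = (if b then 2 else 1)"

text \<open>
  All tapes of the algorithm hold a word that starts in cell \<open>0\<close>, surrounded by blanks. A head at
  position \<open>length xs\<close> sees the blank behind the word, which ends a sweep; appending happens there.
\<close>

definition tape_at :: "bool list \<Rightarrow> nat \<Rightarrow> tape" where
  "tape_at xs k = (word_contents xs, int k)"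

definition flag :: "bool \<Rightarrow> tape" where
  "flag b = tape_at (if b then [True] else []) 0"

definition nonblank :: "nat set" where "nonblank = {1, 2}"
definition one :: "nat set" where "one = {2}"

abbreviation Put :: "'v \<Rightarrow> bool \<Rightarrow> 'v com" where "Put v b \<equiv> Act v (\<lambda>_. bit b) Stay"
abbreviation Append :: "'v \<Rightarrow> bool \<Rightarrow> 'v com" where "Append v b \<equiv> Act v (\<lambda>_. bit b) MoveRight"
abbreviation Erase :: "'v \<Rightarrow> 'v com" where "Erase v \<equiv> Act v (\<lambda>_. 0) Stay"
abbreviation Go :: "'v \<Rightarrow> move \<Rightarrow> 'v com" where "Go v m \<equiv> Act v (\<lambda>a. a) m"

lemma scanned_tape_at: "scanned (tape_at xs k) = (if k < length xs then bit (xs ! k) else 0)"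
  by (auto simp: scanned_def tape_at_def word_contents_def bit_def)

lemma scanned_tests [simp]:
  "scanned (tape_at xs k) \<in> nonblank \<longleftrightarrow> k < length xs"
  "scanned (tape_at xs k) \<in> one \<longleftrightarrow> k < length xs \<and> xs ! k"
  "scanned (flag b) \<in> nonblank \<longleftrightarrow> b"
  by (auto simp: flag_def scanned_tape_at nonblank_def one_def bit_def)

lemma act_scanned: "act (scanned t, m) t = (fst t, snd t + shift m)"
  by (cases t) (simp add: scanned_def)

declare act.simps [simp del]

lemma act_go [simp]: "act (scanned (tape_at xs k), MoveRight) (tape_at xs k) = tape_at xs (Suc k)"
  by (simp add: act_scanned tape_at_def)

lemma act_overwrite [simp]:
  assumes "k < length xs"
  shows "act (bit b, Stay) (tape_at xs k) = tape_at (xs[k := b]) k"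
    and "act (bit b, MoveRight) (tape_at xs k) = tape_at (xs[k := b]) (Suc k)"
proof -
  have "(word_contents xs)(int k := bit b) = word_contents (xs[k := b])"
    using assms by (intro ext) (auto simp: word_contents_def bit_def nth_list_update)
  then show "act (bit b, Stay) (tape_at xs k) = tape_at (xs[k := b]) k"
    and "act (bit b, MoveRight) (tape_at xs k) = tape_at (xs[k := b]) (Suc k)"
    by (auto simp: tape_at_def act.simps)
qed

lemma act_append [simp]:
  assumes "k = length xs"
  shows "act (bit b, MoveRight) (tape_at xs k) = tape_at (xs @ [b]) (Suc k)"
proof -
  have "(word_contents xs)(int k := bit b) = word_contents (xs @ [b])"
    using assms by (intro ext) (auto simp: word_contents_def bit_def nth_append)
  then show ?thesis by (auto simp: tape_at_def act.simps)
qed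

lemma act_flag [simp]:
  "act (bit True, Stay) (flag b) = flag True"
  "act (0, Stay) (flag b) = flag False"
  by (auto simp: flag_def tape_at_def act.simps word_contents_def bit_def fun_eq_iff)

section \<open>Derived programs\<close>

text \<open>
  The head runs to the blank in cell \<open>-1\<close> and steps back. The first move is made unconditionally because
  the head may start on the blank behind the word.
\<close>

definition Rewind :: "'v \<Rightarrow> 'v com" where
  "Rewind v = Go v MoveLeft ;; While v nonblank (Go v MoveLeft) ;; Go v MoveRight"

lemma achieves_Rewind:
  assumes "\<sigma> v = tape_at xs k" "k \<le> length xs" "k \<le> n"
  shows "achieves (Rewind v) \<sigma> (3 * n + 3) (\<lambda>\<sigma>'. \<sigma>' = \<sigma>(v := tape_at xs 0))"
proof -
  let ?w = "word_contents xs"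
  let ?I = "\<lambda>i \<sigma>'. \<sigma>' = \<sigma>(v := (?w, int k - 1 - int i))"
  have "achieves (While v nonblank (Go v MoveLeft)) (\<sigma>(v := (?w, int k - 1)))
     (k * (1 + 2) + 1) (?I k)"
  proof (rule achieves_While_count[where I = ?I])
    fix i \<sigma>' assume i: "i < k" and I: "?I i \<sigma>'"
    then have "\<sigma>' v = tape_at xs (k - Suc i)" by (simp add: tape_at_def)
    then show "scanned (\<sigma>' v) \<in> nonblank" using i assms(2) by simp
  next
    show "\<And>\<sigma>'. ?I k \<sigma>' \<Longrightarrow> scanned (\<sigma>' v) \<notin> nonblank"
      by (simp add: scanned_def word_contents_def nonblank_def)
  qed (simp_all add: achieves_def act_scanned)
  then have "wp (Rewind v) \<sigma> (\<lambda>n' \<sigma>'. n' \<le> 3 * k + 3 \<and> \<sigma>' = \<sigma>(v := tape_at xs 0))"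
    using assms(1) unfolding Rewind_def achieves_def
    by (auto simp: tape_at_def act_scanned elim!: wp_mono)
  then show ?thesis using assms(3) by (force simp: achieves_def wp_def)
qed

fun sequence :: "'v com list \<Rightarrow> 'v com" where
  "sequence [] = Skip"
| "sequence (c # cs) = c ;; sequence cs"

definition appends :: "'v list \<Rightarrow> bool \<Rightarrow> 'v com" where
  "appends vs b = sequence (map (\<lambda>v. Append v b) vs)"

definition rewinds :: "'v list \<Rightarrow> 'v com" where
  "rewinds vs = sequence (map Rewind vs)"

lemma wp_appends [simp]:
  assumes "distinct vs"
  shows "wp (appends vs b) \<sigma> Q \<longleftrightarrow>
    Q (length vs) (\<lambda>w. if w \<in> set vs then act (bit b, MoveRight) (\<sigma> w) else \<sigma> w)"
  using assms
proof (induction vs arbitrary: \<sigma> Q)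
  case (Cons v vs)
  have "(\<lambda>w. if w \<in> set vs then act (bit b, MoveRight) ((\<sigma>(v := act (bit b, MoveRight) (\<sigma> v))) w)
          else (\<sigma>(v := act (bit b, MoveRight) (\<sigma> v))) w)
      = (\<lambda>w. if w \<in> set (v # vs) then act (bit b, MoveRight) (\<sigma> w) else \<sigma> w)"
    using Cons.prems by (auto simp: fun_eq_iff)
  then show ?case using Cons by (simp add: appends_def)
qed (simp add: appends_def)

lemma achieves_rewinds:
  assumes "distinct vs"
    and "\<And>v. v \<in> set vs \<Longrightarrow> \<sigma> v = tape_at (w v) (k v) \<and> k v \<le> length (w v) \<and> k v \<le> n"
  shows "achieves (rewinds vs) \<sigma> (length vs * (3 * n + 3))
    (\<lambda>\<sigma>'. \<sigma>' = (\<lambda>v. if v \<in> set vs then tape_at (w v) 0 else \<sigma> v))"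
  using assms
proof (induction vs arbitrary: \<sigma>)
  case Nil
  then show ?case by (simp add: rewinds_def achieves_Skip)
next
  case (Cons v vs)
  let ?\<sigma> = "\<sigma>(v := tape_at (w v) 0)"
  have "achieves (Rewind v ;; rewinds vs) \<sigma> ((3 * n + 3) + length vs * (3 * n + 3))
      (\<lambda>\<sigma>'. \<sigma>' = (\<lambda>u. if u \<in> set vs then tape_at (w u) 0 else ?\<sigma> u))"
  proof (rule achieves_Seq[where R = "\<lambda>\<sigma>'. \<sigma>' = ?\<sigma>"])
    show "achieves (Rewind v) \<sigma> (3 * n + 3) (\<lambda>\<sigma>'. \<sigma>' = ?\<sigma>)"
      using Cons.prems(2)[of v] by (intro achieves_Rewind) auto
    show "achieves (rewinds vs) \<sigma>' (length vs * (3 * n + 3))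
        (\<lambda>\<sigma>'. \<sigma>' = (\<lambda>u. if u \<in> set vs then tape_at (w u) 0 else ?\<sigma> u))" if "\<sigma>' = ?\<sigma>" for \<sigma>'
      unfolding that using Cons.prems by (intro Cons.IH) auto
  qed
  moreover have "(\<lambda>u. if u \<in> set vs then tape_at (w u) 0 else ?\<sigma> u) =
      (\<lambda>u. if u \<in> set (v # vs) then tape_at (w u) 0 else \<sigma> u)"
    by auto
  ultimately show ?case by (simp add: rewinds_def)
qed

section \<open>The tapes and their initialisation\<close>

text \<open>
  \<open>Mat l\<close>, \<open>Cur l\<close> and \<open>Iter l\<close> belong to recursion level \<open>l\<close> of the clique search: a private copy of the
  adjacency matrix, the set of candidate vertices as a bit vector, and a second copy of that set over
  which the level iterates. As every level has its own matrix, its head only ever moves on sequentially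
  through the rows, and no addressing is needed. \<open>Thr\<close> holds the peeling threshold in unary.
\<close>
datatype name = In | Out | Flag | Changed | Alive | Thr | Tmp | Mat nat | Cur nat | Iter nat

definition candidate_tapes :: "nat \<Rightarrow> name list" where
  "candidate_tapes L = map Cur [0..<L] @ map Iter [0..<L]"

definition matrix_tapes :: "nat \<Rightarrow> name list" where
  "matrix_tapes L = map Mat [0..<L]"

lemma distinct_tapes [simp]:
  "distinct (candidate_tapes L)" "distinct (matrix_tapes L)"
  "distinct (candidate_tapes L @ matrix_tapes L)"
  by (auto simp: candidate_tapes_def matrix_tapes_def distinct_map inj_on_def)

lemma in_tapes [simp]:
  "Cur l \<in> set (candidate_tapes L) \<longleftrightarrow> l < L" "Iter l \<in> set (candidate_tapes L) \<longleftrightarrow> l < L"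
  "Mat l \<in> set (matrix_tapes L) \<longleftrightarrow> l < L"
  "Cur l \<notin> set (matrix_tapes L)" "Iter l \<notin> set (matrix_tapes L)" "Mat l \<notin> set (candidate_tapes L)"
  "v \<in> {In, Out, Flag, Changed, Alive, Thr, Tmp} \<Longrightarrow> v \<notin> set (candidate_tapes L)"
  "v \<in> {In, Out, Flag, Changed, Alive, Thr, Tmp} \<Longrightarrow> v \<notin> set (matrix_tapes L)"
  by (auto simp: candidate_tapes_def matrix_tapes_def)

lemma length_tapes [simp]: "length (candidate_tapes L) = 2 * L" "length (matrix_tapes L) = L"
  by (auto simp: candidate_tapes_def matrix_tapes_def)

lemma candidate_matrix_disjoint: "v \<in> set (candidate_tapes L) \<Longrightarrow> v \<notin> set (matrix_tapes L)"
  by (auto simp: candidate_tapes_def matrix_tapes_def)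

definition load :: "nat \<Rightarrow> name com" where
  "load L =
     While In one (appends (candidate_tapes L) True ;; Go In MoveRight) ;;
     Go In MoveRight ;;
     While In nonblank
       (Cond In one (appends (matrix_tapes L) True) (appends (matrix_tapes L) False) ;;
        Go In MoveRight) ;;
     rewinds (candidate_tapes L @ matrix_tapes L)"

text \<open>
  The time functions repeat the structure of the programs, so that the composition rules produce them
  literally; \<open>N\<close> bounds the length of every word involved.
\<close>

definition time_load :: "nat \<Rightarrow> nat \<Rightarrow> nat" where
  "time_load L N = (N * (2 * L + 1 + 2) + 1) + (1 + ((N * (L + 3 + 2) + 1) + 3 * L * (3 * N + 3)))"

lemma achieves_load:
  assumes \<sigma>: "\<sigma> In = tape_at (replicate n True @ False # mat) 0" "\<And>v. v \<noteq> In \<Longrightarrow> \<sigma> v = tape_at [] 0"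
    and N: "n \<le> N" "length mat \<le> N"
  shows "achieves (load L) \<sigma> (time_load L N) (\<lambda>\<sigma>'. \<forall>v. v \<noteq> In \<longrightarrow> \<sigma>' v =
    (if v \<in> set (candidate_tapes L) then tape_at (replicate n True) 0
     else if v \<in> set (matrix_tapes L) then tape_at mat 0 else tape_at [] 0))"
proof -
  let ?code = "replicate n True @ False # mat"
  let ?C = "set (candidate_tapes L)" and ?M = "set (matrix_tapes L)"
  let ?I = "\<lambda>k \<sigma>'. \<sigma>' = (\<lambda>v. if v = In then tape_at ?code k
     else if v \<in> ?C then tape_at (replicate k True) k else tape_at [] 0)"
  let ?J = "\<lambda>k \<sigma>'. \<sigma>' = (\<lambda>v. if v = In then tape_at ?code (Suc n + k)
     else if v \<in> ?C then tape_at (replicate n True) n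
     else if v \<in> ?M then tape_at (take k mat) k else tape_at [] 0)"
  have 1: "achieves (While In one (appends (candidate_tapes L) True ;; Go In MoveRight)) \<sigma>
      (n * (2 * L + 1 + 2) + 1) (?I n)"
  proof (rule achieves_While_count[where I = ?I])
    show "?I 0 \<sigma>" using \<sigma> by (auto simp: fun_eq_iff)
    fix k \<sigma>' assume k: "k < n" and I: "?I k \<sigma>'"
    show "scanned (\<sigma>' In) \<in> one" using k I by (simp add: nth_append)
    show "achieves (appends (candidate_tapes L) True ;; Go In MoveRight) \<sigma>' (2 * L + 1) (?I (Suc k))"
      using k I by (auto simp: achieves_def fun_eq_iff replicate_append_same)
  next
    show "\<And>\<sigma>'. ?I n \<sigma>' \<Longrightarrow> scanned (\<sigma>' In) \<notin> one" by (simp add: nth_append)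
  qed
  have 2: "achieves (Go In MoveRight) \<sigma>' 1 (?J 0)" if "?I n \<sigma>'" for \<sigma>'
    using that by (auto simp: achieves_def fun_eq_iff)
  have 3: "achieves (While In nonblank
       (Cond In one (appends (matrix_tapes L) True) (appends (matrix_tapes L) False) ;;
        Go In MoveRight)) \<sigma>' (length mat * (L + 3 + 2) + 1) (?J (length mat))" if "?J 0 \<sigma>'" for \<sigma>'
  proof (rule achieves_While_count[where I = ?J])
    show "?J 0 \<sigma>'" by (fact that)
    fix k \<sigma>' assume k: "k < length mat" and I: "?J k \<sigma>'"
    show "scanned (\<sigma>' In) \<in> nonblank" using k I by simp
    show "achieves (Cond In one (appends (matrix_tapes L) True) (appends (matrix_tapes L) False) ;;
        Go In MoveRight) \<sigma>' (L + 3) (?J (Suc k))"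
      using k I by (auto simp: achieves_def fun_eq_iff nth_append take_Suc_conv_app_nth
          dest: candidate_matrix_disjoint)
  next
    show "\<And>\<sigma>'. ?J (length mat) \<sigma>' \<Longrightarrow> scanned (\<sigma>' In) \<notin> nonblank" by simp
  qed
  have 4: "achieves (rewinds (candidate_tapes L @ matrix_tapes L)) \<sigma>'
      (length (candidate_tapes L @ matrix_tapes L) * (3 * N + 3))
      (\<lambda>\<sigma>''. \<sigma>'' = (\<lambda>v. if v \<in> set (candidate_tapes L @ matrix_tapes L)
         then tape_at (if v \<in> ?C then replicate n True else mat) 0 else \<sigma>' v))"
    if "?J (length mat) \<sigma>'" for \<sigma>'
    by (rule achieves_rewinds[where k = "\<lambda>v. if v \<in> ?C then n else length mat"])
      (use N that in \<open>auto dest: candidate_matrix_disjoint\<close>)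
  have "achieves (load L) \<sigma> ((n * (2 * L + 1 + 2) + 1) + (1 + ((length mat * (L + 3 + 2) + 1) +
      length (candidate_tapes L @ matrix_tapes L) * (3 * N + 3)))) (\<lambda>\<sigma>'. \<forall>v. v \<noteq> In \<longrightarrow> \<sigma>' v =
    (if v \<in> set (candidate_tapes L) then tape_at (replicate n True) 0
     else if v \<in> set (matrix_tapes L) then tape_at mat 0 else tape_at [] 0))"
    unfolding load_def
    by (rule achieves_Seq[OF 1], erule achieves_Seq[OF 2], erule achieves_Seq[OF 3],
        rule achieves_mono[OF 4]) auto
  then show ?thesis
    by (rule achieves_mono) (use N in \<open>auto simp: time_load_def intro!: add_mono mult_mono\<close>)
qed

section \<open>Searching for a clique of fixed size\<close>

text \<open>
  A clique with \<open>l + 1\<close> vertices in the candidate set \<open>as\<close> consists of a candidate \<open>v\<close> and a clique with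
  \<open>l\<close> vertices among the candidates adjacent to \<open>v\<close>. Entry \<open>(v, u)\<close> of the matrix has index \<open>v * n + u\<close>.
\<close>

fun has_clique :: "bool list \<Rightarrow> nat \<Rightarrow> nat \<Rightarrow> bool list \<Rightarrow> bool" where
  "has_clique mat n 0 as = True"
| "has_clique mat n (Suc l) as =
     (\<exists>v<n. as ! v \<and> has_clique mat n l (map (\<lambda>u. as ! u \<and> mat ! (v * n + u)) [0..<n]))"

definition restrict_to_row :: "nat \<Rightarrow> name com" where
  "restrict_to_row l =
     While (Cur (Suc l)) nonblank
       (Cond (Cur (Suc l)) one
          (Cond (Mat (Suc l)) one (appends [Cur l, Iter l] True) (appends [Cur l, Iter l] False))
          (appends [Cur l, Iter l] False) ;;
        Go (Cur (Suc l)) MoveRight ;;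
        Go (Mat (Suc l)) MoveRight)"

fun clique_search :: "nat \<Rightarrow> name com" where
  "clique_search 0 = Put Flag True"
| "clique_search (Suc l) =
     While (Iter (Suc l)) nonblank
       (restrict_to_row l ;;
        rewinds [Cur (Suc l), Cur l, Iter l] ;;
        Cond (Iter (Suc l)) one (clique_search l) Skip ;;
        Go (Iter (Suc l)) MoveRight) ;;
     rewinds [Iter (Suc l), Mat (Suc l)]"

lemma overwrite_step:
  assumes "k < length new" "length xs = length new" "b = new ! k"
  shows "(take k new @ drop k xs)[k := b] = take (Suc k) new @ drop (Suc k) xs"
  using assms by (auto simp: list_update_append take_Suc_conv_app_nth Cons_nth_drop_Suc[symmetric])

lemma achieves_restrict_to_row:
  assumes \<sigma>: "\<sigma> (Cur (Suc l)) = tape_at as 0" "\<sigma> (Mat (Suc l)) = tape_at mat p"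
      "\<sigma> (Cur l) = tape_at xs 0" "\<sigma> (Iter l) = tape_at ys 0"
    and n: "length as = n" "length xs = n" "length ys = n" "p + n \<le> length mat"
    and new: "new = map (\<lambda>u. as ! u \<and> mat ! (p + u)) [0..<n]"
  shows "achieves (restrict_to_row l) \<sigma> (n * (8 + 2) + 1) (\<lambda>\<sigma>'. \<sigma>' =
    \<sigma>(Cur (Suc l) := tape_at as n, Mat (Suc l) := tape_at mat (p + n),
      Cur l := tape_at new n, Iter l := tape_at new n))"
proof -
  let ?I = "\<lambda>k \<sigma>'. \<sigma>' = \<sigma>(Cur (Suc l) := tape_at as k, Mat (Suc l) := tape_at mat (p + k),
      Cur l := tape_at (take k new @ drop k xs) k, Iter l := tape_at (take k new @ drop k ys) k)"
  have len: "length new = n" using new by simp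
  have "achieves (restrict_to_row l) \<sigma> (n * (8 + 2) + 1) (?I n)"
    unfolding restrict_to_row_def
  proof (rule achieves_While_count[where I = ?I])
    show "?I 0 \<sigma>" using \<sigma> by (auto simp: fun_eq_iff)
    fix k \<sigma>' assume k: "k < n" and I: "?I k \<sigma>'"
    have new_k: "new ! k \<longleftrightarrow> as ! k \<and> mat ! (p + k)" using k new by simp
    show "scanned (\<sigma>' (Cur (Suc l))) \<in> nonblank" using k I n by simp
    show "achieves
       (Cond (Cur (Suc l)) one
          (Cond (Mat (Suc l)) one (appends [Cur l, Iter l] True) (appends [Cur l, Iter l] False))
          (appends [Cur l, Iter l] False) ;;
        Go (Cur (Suc l)) MoveRight ;;
        Go (Mat (Suc l)) MoveRight) \<sigma>' 8 (?I (Suc k))"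
      using k I n len new_k overwrite_step[of k new xs "new ! k"] overwrite_step[of k new ys "new ! k"]
      by (auto simp: achieves_def fun_eq_iff)
  next
    show "\<And>\<sigma>'. ?I n \<sigma>' \<Longrightarrow> scanned (\<sigma>' (Cur (Suc l))) \<notin> nonblank" using n by simp
  qed
  then show ?thesis using n len by simp
qed

text \<open>
  Levels below the current one may hold arbitrary candidate sets left over from earlier branches; only
  their lengths matter, since the sets are overwritten cell by cell.
\<close>

definition scratch :: "nat \<Rightarrow> nat \<Rightarrow> (name \<Rightarrow> tape) \<Rightarrow> bool" where
  "scratch n l \<sigma> \<longleftrightarrow> (\<forall>j<l. \<exists>xs ys. length xs = n \<and> length ys = n \<and>
     \<sigma> (Cur j) = tape_at xs 0 \<and> \<sigma> (Iter j) = tape_at ys 0)"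

lemma scratch_Suc: "scratch n (Suc l) \<sigma> \<longleftrightarrow> scratch n l \<sigma> \<and> (\<exists>xs ys. length xs = n \<and>
    length ys = n \<and> \<sigma> (Cur l) = tape_at xs 0 \<and> \<sigma> (Iter l) = tape_at ys 0)"
  by (auto simp: scratch_def less_Suc_eq)

fun time_search :: "nat \<Rightarrow> nat \<Rightarrow> nat" where
  "time_search N 0 = 1"
| "time_search N (Suc l) =
     (N * ((N * (8 + 2) + 1) + (3 * (3 * N + 3) + ((time_search N l + 2) + 1)) + 2) + 1) + 2 * (3 * N + 3)"

text \<open>
  The flag is only ever raised, never lowered, by the search, so over all branches it accumulates their
  disjunction. Level \<open>l\<close> itself is restored, and the levels below are again fit for use by the next branch.
\<close>

lemma achieves_clique_search:
  assumes "scratch n l \<sigma>" "\<sigma> (Cur l) = tape_at as 0" "\<sigma> (Iter l) = tape_at as 0" "length as = n"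
    and "\<And>j. j \<le> l \<Longrightarrow> \<sigma> (Mat j) = tape_at mat 0" "length mat = n * n"
    and "\<sigma> Flag = flag f" "n \<le> N" "n * n \<le> N"
  shows "achieves (clique_search l) \<sigma> (time_search N l) (\<lambda>\<sigma>'.
    scratch n l \<sigma>' \<and> \<sigma>' Flag = flag (f \<or> has_clique mat n l as) \<and>
    (\<forall>v. v \<noteq> Flag \<and> (\<forall>j<l. v \<noteq> Cur j \<and> v \<noteq> Iter j) \<longrightarrow> \<sigma>' v = \<sigma> v))"
  using assms
proof (induction l arbitrary: \<sigma> as f)
  case 0
  then show ?case by (simp add: achieves_def scratch_def)
next
  case (Suc l)
  note prems = Suc.prems
  let ?new = "\<lambda>v. map (\<lambda>u. as ! u \<and> mat ! (v * n + u)) [0..<n]"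
  let ?others = "\<lambda>v. v \<noteq> Flag \<and> v \<noteq> Cur (Suc l) \<and> v \<noteq> Iter (Suc l) \<and> v \<noteq> Mat (Suc l) \<and>
    (\<forall>j<Suc l. v \<noteq> Cur j \<and> v \<noteq> Iter j)"
  define I where "I = (\<lambda>k \<sigma>'. scratch n (Suc l) \<sigma>' \<and> \<sigma>' (Cur (Suc l)) = tape_at as 0 \<and>
    \<sigma>' (Iter (Suc l)) = tape_at as k \<and> \<sigma>' (Mat (Suc l)) = tape_at mat (k * n) \<and>
    \<sigma>' Flag = flag (f \<or> (\<exists>v<k. as ! v \<and> has_clique mat n l (?new v))) \<and>
    (\<forall>v. ?others v \<longrightarrow> \<sigma>' v = \<sigma> v))"
  let ?body = "restrict_to_row l ;; rewinds [Cur (Suc l), Cur l, Iter l] ;;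
        Cond (Iter (Suc l)) one (clique_search l) Skip ;; Go (Iter (Suc l)) MoveRight"
  let ?t = "(N * (8 + 2) + 1) + (3 * (3 * N + 3) + ((time_search N l + 2) + 1))"
  have body: "achieves ?body \<sigma>' ?t (I (Suc k))" if k: "k < n" and I: "I k \<sigma>'" for k \<sigma>'
  proof -
    from I obtain xs ys where xy: "length xs = n" "length ys = n"
        "\<sigma>' (Cur l) = tape_at xs 0" "\<sigma>' (Iter l) = tape_at ys 0"
      unfolding I_def scratch_def by blast
    have le: "k * n + n \<le> n * n"
      using k mult_le_mono1[of "Suc k" n n] by simp
    let ?\<sigma>1 = "\<sigma>'(Cur (Suc l) := tape_at as n, Mat (Suc l) := tape_at mat (k * n + n),
      Cur l := tape_at (?new k) n, Iter l := tape_at (?new k) n)"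
    let ?\<sigma>2 = "\<sigma>'(Mat (Suc l) := tape_at mat (k * n + n),
      Cur l := tape_at (?new k) 0, Iter l := tape_at (?new k) 0)"
    let ?Q = "\<lambda>\<sigma>3. scratch n (Suc l) \<sigma>3 \<and>
      \<sigma>3 Flag = flag (f \<or> (\<exists>v<Suc k. as ! v \<and> has_clique mat n l (?new v))) \<and>
      (\<forall>v. v \<noteq> Flag \<and> (\<forall>j<Suc l. v \<noteq> Cur j \<and> v \<noteq> Iter j) \<longrightarrow> \<sigma>3 v = ?\<sigma>2 v)"
    have 1: "achieves (restrict_to_row l) \<sigma>' (N * (8 + 2) + 1) (\<lambda>\<sigma>''. \<sigma>'' = ?\<sigma>1)"
      by (rule achieves_mono[OF achieves_restrict_to_row[where xs = xs and ys = ys and p = "k * n"]])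
        (use I xy le prems in \<open>auto simp: I_def\<close>)
    have 2: "achieves (rewinds [Cur (Suc l), Cur l, Iter l]) ?\<sigma>1
        (length [Cur (Suc l), Cur l, Iter l] * (3 * N + 3)) (\<lambda>\<sigma>''. \<sigma>'' = ?\<sigma>2)"
      by (rule achieves_mono[OF achieves_rewinds[where k = "\<lambda>_. n"
              and w = "\<lambda>v. if v = Cur (Suc l) then as else ?new k"]])
        (use I prems in \<open>auto simp: I_def fun_eq_iff\<close>)
    have scr: "scratch n l ?\<sigma>2" using I by (auto simp: I_def scratch_def)
    have scr': "scratch n (Suc l) ?\<sigma>2" using scr unfolding scratch_Suc
      by (intro conjI exI[of _ "?new k"]) simp_all
    have 3: "achieves (Cond (Iter (Suc l)) one (clique_search l) Skip) ?\<sigma>2 (time_search N l + 2) ?Q"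
    proof (rule achieves_Cond)
        assume "scanned (?\<sigma>2 (Iter (Suc l))) \<in> one"
        then have ak: "as ! k" using I by (simp add: I_def)
        have "achieves (clique_search l) ?\<sigma>2 (time_search N l) (\<lambda>\<sigma>3. scratch n l \<sigma>3 \<and>
          \<sigma>3 Flag = flag ((f \<or> (\<exists>v<k. as ! v \<and> has_clique mat n l (?new v))) \<or> has_clique mat n l (?new k)) \<and>
          (\<forall>v. v \<noteq> Flag \<and> (\<forall>j<l. v \<noteq> Cur j \<and> v \<noteq> Iter j) \<longrightarrow> \<sigma>3 v = ?\<sigma>2 v))"
          by (rule Suc.IH[OF scr]) (use I prems scr in \<open>auto simp: I_def\<close>)
        then show "achieves (clique_search l) ?\<sigma>2 (time_search N l) ?Q"
        proof (rule achieves_mono[OF _ order.refl], elim conjE, intro conjI)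
          fix \<sigma>3 assume \<sigma>3: "scratch n l \<sigma>3"
            "\<sigma>3 Flag = flag ((f \<or> (\<exists>v<k. as ! v \<and> has_clique mat n l (?new v))) \<or> has_clique mat n l (?new k))"
            "\<forall>v. v \<noteq> Flag \<and> (\<forall>j<l. v \<noteq> Cur j \<and> v \<noteq> Iter j) \<longrightarrow> \<sigma>3 v = ?\<sigma>2 v"
          have "\<sigma>3 (Cur l) = tape_at (?new k) 0" "\<sigma>3 (Iter l) = tape_at (?new k) 0"
            using \<sigma>3(3) by auto
          then show "scratch n (Suc l) \<sigma>3" using \<sigma>3(1) unfolding scratch_Suc
            by (intro conjI exI[of _ "?new k"]) simp_all
          show "\<sigma>3 Flag = flag (f \<or> (\<exists>v<Suc k. as ! v \<and> has_clique mat n l (?new v)))"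
            using \<sigma>3(2) ak by (simp add: Ex_less_Suc disj_ac)
          show "\<forall>v. v \<noteq> Flag \<and> (\<forall>j<Suc l. v \<noteq> Cur j \<and> v \<noteq> Iter j) \<longrightarrow> \<sigma>3 v = ?\<sigma>2 v"
            using \<sigma>3(3) by (auto simp: less_Suc_eq)
        qed
      next
        assume "scanned (?\<sigma>2 (Iter (Suc l))) \<notin> one"
        then have "\<not> as ! k" using I k prems by (simp add: I_def)
        then show "achieves Skip ?\<sigma>2 (time_search N l) ?Q"
          using I scr' by (intro achieves_Skip) (simp add: I_def Ex_less_Suc)
    qed
    have 4: "achieves (Go (Iter (Suc l)) MoveRight) \<sigma>3 1 (I (Suc k))" if Q: "?Q \<sigma>3" for \<sigma>3
    proof -
      have "\<sigma>3 (Iter (Suc l)) = tape_at as k" "\<sigma>3 (Cur (Suc l)) = tape_at as 0"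
        "\<sigma>3 (Mat (Suc l)) = tape_at mat (k * n + n)"
        using Q I by (auto simp: I_def)
      moreover have "\<sigma>3 v = \<sigma> v" if "?others v" for v
      proof -
        have "\<sigma>3 v = ?\<sigma>2 v" using Q that by blast
        also have "\<dots> = \<sigma> v" using I that by (auto simp: I_def)
        finally show ?thesis .
      qed
      moreover have "scratch n (Suc l) (\<sigma>3(Iter (Suc l) := tape_at as (Suc k)))"
        using Q by (auto simp: scratch_def)
      ultimately show ?thesis using Q by (simp add: achieves_def I_def add.commute)
    qed
    have rew: "achieves (rewinds [Cur (Suc l), Cur l, Iter l]) \<sigma>'' (3 * (3 * N + 3)) (\<lambda>\<sigma>''. \<sigma>'' = ?\<sigma>2)"
      if "\<sigma>'' = ?\<sigma>1" for \<sigma>'' using 2 by (simp add: that numeral_3_eq_3)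
    have search: "achieves (Cond (Iter (Suc l)) one (clique_search l) Skip) \<sigma>'' (time_search N l + 2) ?Q"
      if "\<sigma>'' = ?\<sigma>2" for \<sigma>'' using 3 by (simp only: that)
    show ?thesis
      by (rule achieves_Seq[OF 1], erule achieves_Seq[OF rew], erule achieves_Seq[OF search], erule 4)
  qed
  have loop: "achieves (While (Iter (Suc l)) nonblank ?body) \<sigma> (n * (?t + 2) + 1) (I n)"
  proof (rule achieves_While_count[where I = I])
    show "I 0 \<sigma>" using prems by (auto simp: I_def)
  qed (use body prems in \<open>auto simp: I_def\<close>)
  have rew_row: "achieves (rewinds [Iter (Suc l), Mat (Suc l)]) \<sigma>'
      (length [Iter (Suc l), Mat (Suc l)] * (3 * N + 3))
    (\<lambda>\<sigma>''. \<sigma>'' = (\<lambda>v. if v \<in> set [Iter (Suc l), Mat (Suc l)]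
      then tape_at (if v = Mat (Suc l) then mat else as) 0 else \<sigma>' v))" if "I n \<sigma>'" for \<sigma>'
    by (rule achieves_rewinds[where k = "\<lambda>v. if v = Mat (Suc l) then n * n else n"])
      (use that prems in \<open>auto simp: I_def\<close>)
  have "achieves (clique_search (Suc l)) \<sigma> ((n * (?t + 2) + 1) + length [Iter (Suc l), Mat (Suc l)] * (3 * N + 3))
     (\<lambda>\<sigma>'. scratch n (Suc l) \<sigma>' \<and> \<sigma>' Flag = flag (f \<or> has_clique mat n (Suc l) as) \<and>
    (\<forall>v. v \<noteq> Flag \<and> (\<forall>j<Suc l. v \<noteq> Cur j \<and> v \<noteq> Iter j) \<longrightarrow> \<sigma>' v = \<sigma> v))"
    unfolding clique_search.simps
  proof (rule achieves_Seq[OF loop], rule achieves_mono[OF rew_row order.refl])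
    fix \<sigma>' \<sigma>'' assume I: "I n \<sigma>'" and \<sigma>'': "\<sigma>'' = (\<lambda>v. if v \<in> set [Iter (Suc l), Mat (Suc l)]
      then tape_at (if v = Mat (Suc l) then mat else as) 0 else \<sigma>' v)"
    have "\<sigma>'' v = \<sigma> v" if "v \<noteq> Flag \<and> (\<forall>j<Suc l. v \<noteq> Cur j \<and> v \<noteq> Iter j)" for v
      using that I prems by (auto simp: \<sigma>'' I_def)
    moreover have "scratch n (Suc l) \<sigma>''" using I by (auto simp: \<sigma>'' I_def scratch_def)
    ultimately show "scratch n (Suc l) \<sigma>'' \<and> \<sigma>'' Flag = flag (f \<or> has_clique mat n (Suc l) as) \<and>
      (\<forall>v. v \<noteq> Flag \<and> (\<forall>j<Suc l. v \<noteq> Cur j \<and> v \<noteq> Iter j) \<longrightarrow> \<sigma>'' v = \<sigma> v)"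
      using I by (auto simp: \<sigma>'' I_def)
  qed
  then show ?case
    by (rule achieves_mono) (use prems in \<open>auto intro!: add_mono mult_mono simp: numeral_2_eq_2\<close>)
qed

section \<open>Peeling off vertices of small degree\<close>

definition alive_degree :: "bool list \<Rightarrow> nat \<Rightarrow> bool list \<Rightarrow> nat \<Rightarrow> nat" where
  "alive_degree mat n as v = card {u. u < n \<and> as ! u \<and> mat ! (v * n + u)}"

text \<open>
  One synchronous round: all degrees are taken in the old graph, so that the order in which vertices are
  visited does not matter.
\<close>

definition peel :: "bool list \<Rightarrow> nat \<Rightarrow> nat \<Rightarrow> bool list \<Rightarrow> bool list" where
  "peel mat n m as = map (\<lambda>v. as ! v \<and> m \<le> alive_degree mat n as v) [0..<n]"

text \<open>
  The head on \<open>Thr\<close> advances once for every neighbour still present but stops at the end of the \<open>m\<close> marks.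
  It has reached the blank precisely if the degree is at least \<open>m\<close>.
\<close>

definition count_neighbours :: "nat \<Rightarrow> name com" where
  "count_neighbours l =
     While (Cur l) nonblank
       (Cond (Cur l) one
          (Cond (Mat l) one (Cond Thr nonblank (Go Thr MoveRight) Skip) Skip) Skip ;;
        Go (Cur l) MoveRight ;;
        Go (Mat l) MoveRight)"

text \<open>
  The vertices that are kept are marked on \<open>Iter l\<close>, while the degrees are counted in the old set on
  \<open>Cur l\<close>; at the end of the round the new set is copied there. \<open>Changed\<close> and \<open>Alive\<close> report whether a
  vertex was deleted and whether one is left.
\<close>

definition peel_round :: "nat \<Rightarrow> name com" where
  "peel_round l =
     Erase Changed ;;
     Erase Alive ;;
     While (Iter l) nonblank
       (count_neighbours l ;;
        Cond (Iter l) one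
          (Cond Thr nonblank (Put (Iter l) False ;; Put Changed True) (Put Alive True)) Skip ;;
        rewinds [Cur l, Thr] ;;
        Go (Iter l) MoveRight) ;;
     rewinds [Iter l, Mat l] ;;
     While (Iter l) nonblank
       (Cond (Iter l) one (Append (Cur l) True) (Append (Cur l) False) ;;
        Go (Iter l) MoveRight) ;;
     rewinds [Iter l, Cur l]"

lemma card_less_Suc:
  "card {u. u < Suc k \<and> P u} = card {u. u < k \<and> P u} + (if P k then 1 else 0)"
proof -
  have "{u. u < Suc k \<and> P u} = (if P k then insert k {u. u < k \<and> P u} else {u. u < k \<and> P u})"
    by (auto simp: less_Suc_eq)
  then show ?thesis by simp
qed

lemma achieves_count_neighbours:
  assumes \<sigma>: "\<sigma> (Cur l) = tape_at as 0" "\<sigma> (Mat l) = tape_at mat p"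
      "\<sigma> Thr = tape_at (replicate m True) 0"
    and n: "length as = n" "p + n \<le> length mat"
  shows "achieves (count_neighbours l) \<sigma> (n * (9 + 2) + 1) (\<lambda>\<sigma>'. \<sigma>' =
    \<sigma>(Cur l := tape_at as n, Mat l := tape_at mat (p + n),
      Thr := tape_at (replicate m True) (min m (card {u. u < n \<and> as ! u \<and> mat ! (p + u)}))))"
  unfolding count_neighbours_def
proof (rule achieves_While_count[where I = "\<lambda>k \<sigma>'. \<sigma>' = \<sigma>(Cur l := tape_at as k,
      Mat l := tape_at mat (p + k),
      Thr := tape_at (replicate m True) (min m (card {u. u < k \<and> as ! u \<and> mat ! (p + u)})))"])
  show "\<sigma> = \<sigma>(Cur l := tape_at as 0, Mat l := tape_at mat (p + 0),
      Thr := tape_at (replicate m True) (min m (card {u. u < 0 \<and> as ! u \<and> mat ! (p + u)})))"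
    using \<sigma> by (auto simp: fun_eq_iff)
qed (use n in \<open>auto simp: achieves_def fun_eq_iff card_less_Suc min_def le_Suc_eq\<close>)

definition time_round :: "nat \<Rightarrow> nat \<Rightarrow> nat" where
  "time_round N B = 1 + (1 + ((N * (((N * (9 + 2) + 1) + (6 + (2 * (3 * (N + B) + 3) + 1))) + 2) + 1) +
     (2 * (3 * N + 3) + ((N * (4 + 2) + 1) + 2 * (3 * N + 3)))))"

definition core_state :: "nat \<Rightarrow> bool list \<Rightarrow> bool list \<Rightarrow> nat \<Rightarrow> (name \<Rightarrow> tape) \<Rightarrow> bool" where
  "core_state l mat as m \<sigma> \<longleftrightarrow> \<sigma> (Cur l) = tape_at as 0 \<and> \<sigma> (Iter l) = tape_at as 0 \<and>
     \<sigma> (Mat l) = tape_at mat 0 \<and> \<sigma> Thr = tape_at (replicate m True) 0"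

lemma length_peel [simp]: "length (peel mat n m as) = n"
  by (simp add: peel_def)

lemma achieves_peel_round:
  assumes \<sigma>: "core_state l mat as m \<sigma>" "\<sigma> Changed = flag x" "\<sigma> Alive = flag y"
    and n: "length as = n" "length mat = n * n" "n \<le> N" "n * n \<le> N" "m \<le> B"
  shows "achieves (peel_round l) \<sigma> (time_round N B) (\<lambda>\<sigma>'.
    core_state l mat (peel mat n m as) m \<sigma>' \<and> \<sigma>' Changed = flag (peel mat n m as \<noteq> as) \<and>
    \<sigma>' Alive = flag (\<exists>v<n. peel mat n m as ! v) \<and>
    \<sigma>' Tmp = \<sigma> Tmp \<and> \<sigma>' Out = \<sigma> Out)"
proof -
  let ?new = "peel mat n m as" and ?m = "replicate m True"
  let ?iter = "\<lambda>k. take k ?new @ drop k as"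
  let ?I = "\<lambda>k \<sigma>'. \<sigma>' = \<sigma>(Iter l := tape_at (?iter k) k, Mat l := tape_at mat (k * n),
     Changed := flag (\<exists>v<k. ?new ! v \<noteq> as ! v), Alive := flag (\<exists>v<k. ?new ! v))"
  let ?J = "\<lambda>k \<sigma>'. \<sigma>' = \<sigma>(Iter l := tape_at ?new k, Cur l := tape_at (?iter k) k,
     Changed := flag (?new \<noteq> as), Alive := flag (\<exists>v<n. ?new ! v))"
  let ?body = "count_neighbours l ;;
        Cond (Iter l) one
          (Cond Thr nonblank (Put (Iter l) False ;; Put Changed True) (Put Alive True)) Skip ;;
        rewinds [Cur l, Thr] ;; Go (Iter l) MoveRight"
  have state: "\<sigma> (Cur l) = tape_at as 0" "\<sigma> (Iter l) = tape_at as 0"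
      "\<sigma> (Mat l) = tape_at mat 0" "\<sigma> Thr = tape_at ?m 0"
    using \<sigma> by (auto simp: core_state_def)
  have body: "achieves ?body \<sigma>' ((N * (9 + 2) + 1) + (6 + (2 * (3 * (N + B) + 3) + 1))) (?I (Suc k))"
    if k: "k < n" and I: "?I k \<sigma>'" for k \<sigma>'
  proof -
    let ?d = "alive_degree mat n as k"
    let ?\<sigma>1 = "\<sigma>'(Cur l := tape_at as n, Mat l := tape_at mat (k * n + n), Thr := tape_at ?m (min m ?d))"
    let ?\<sigma>2 = "?\<sigma>1(Iter l := tape_at (?iter (Suc k)) k,
      Changed := flag (\<exists>v<Suc k. ?new ! v \<noteq> as ! v), Alive := flag (\<exists>v<Suc k. ?new ! v))"
    have le: "k * n + n \<le> n * n"
      using k mult_le_mono1[of "Suc k" n n] by simp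
    have new_k: "?new ! k \<longleftrightarrow> as ! k \<and> m \<le> ?d" using k by (simp add: peel_def)
    have iter_k: "?iter k ! k = as ! k" "length (?iter k) = n" using k n by (auto simp: nth_append)
    have upd: "?iter (Suc k) = (?iter k)[k := ?new ! k]"
      using k n by (intro overwrite_step[symmetric]) auto
    have iter_Suc: "?iter (Suc k) = (if ?new ! k = as ! k then ?iter k else (?iter k)[k := ?new ! k])"
    proof (cases "?new ! k = as ! k")
      case True
      then have "?iter (Suc k) = (?iter k)[k := ?iter k ! k]" unfolding upd iter_k(1) by (rule arg_cong)
      then show ?thesis unfolding list_update_id if_P[OF True] .
    qed (use upd in simp)
    have 1: "achieves (count_neighbours l) \<sigma>' (N * (9 + 2) + 1) (\<lambda>\<sigma>''. \<sigma>'' = ?\<sigma>1)"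
      by (rule achieves_mono[OF achieves_count_neighbours[where p = "k * n"]])
        (use I state n le in \<open>auto simp: alive_degree_def\<close>)
    have 2: "achieves (Cond (Iter l) one
          (Cond Thr nonblank (Put (Iter l) False ;; Put Changed True) (Put Alive True)) Skip)
        \<sigma>'' 6 (\<lambda>\<sigma>''. \<sigma>'' = ?\<sigma>2)" if "\<sigma>'' = ?\<sigma>1" for \<sigma>''
      unfolding that using k I n iter_k new_k iter_Suc
      by (auto simp: achieves_def fun_eq_iff Ex_less_Suc)
    let ?w = "\<lambda>v. if v = Cur l then as else ?m"
    have 3: "achieves (rewinds [Cur l, Thr]) \<sigma>'' (2 * (3 * (N + B) + 3))
        (\<lambda>\<sigma>''. \<sigma>'' = (\<lambda>v. if v \<in> set [Cur l, Thr] then tape_at (?w v) 0 else ?\<sigma>2 v))"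
      if "\<sigma>'' = ?\<sigma>2" for \<sigma>''
    proof -
      have "achieves (rewinds [Cur l, Thr]) ?\<sigma>2 (length [Cur l, Thr] * (3 * (N + B) + 3))
        (\<lambda>\<sigma>''. \<sigma>'' = (\<lambda>v. if v \<in> set [Cur l, Thr] then tape_at (?w v) 0 else ?\<sigma>2 v))"
        by (rule achieves_rewinds[where k = "\<lambda>v. if v = Cur l then n else min m ?d"])
          (use n in auto)
      then show ?thesis unfolding that by (rule achieves_mono) simp_all
    qed
    have 4: "achieves (Go (Iter l) MoveRight) \<sigma>'' 1 (?I (Suc k))"
      if "\<sigma>'' = (\<lambda>v. if v \<in> set [Cur l, Thr] then tape_at (?w v) 0 else ?\<sigma>2 v)" for \<sigma>''
      unfolding that using I state by (auto simp: achieves_def fun_eq_iff add.commute)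
    show ?thesis
      by (rule achieves_Seq[OF 1], erule achieves_Seq[OF 2], erule achieves_Seq[OF 3], erule 4)
  qed
  have neq: "(\<exists>v<n. ?new ! v \<noteq> as ! v) \<longleftrightarrow> ?new \<noteq> as"
    using n by (auto simp: list_eq_iff_nth_eq)
  let ?\<sigma>0 = "\<sigma>(Changed := flag False, Alive := flag False)"
  have loop: "achieves (While (Iter l) nonblank ?body) \<sigma>'
      (n * (((N * (9 + 2) + 1) + (6 + (2 * (3 * (N + B) + 3) + 1))) + 2) + 1) (?I n)"
    if "\<sigma>' = ?\<sigma>0" for \<sigma>'
  proof (rule achieves_While_count[where I = ?I])
    show "?I 0 \<sigma>'" unfolding that using state by (auto simp: fun_eq_iff)
  qed (use body n in auto)
  have rew1: "achieves (rewinds [Iter l, Mat l]) \<sigma>' (2 * (3 * N + 3)) (?J 0)" if "?I n \<sigma>'" for \<sigma>'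
  proof -
    have "achieves (rewinds [Iter l, Mat l]) \<sigma>' (length [Iter l, Mat l] * (3 * N + 3))
      (\<lambda>\<sigma>''. \<sigma>'' = (\<lambda>v. if v \<in> set [Iter l, Mat l]
         then tape_at (if v = Iter l then ?new else mat) 0 else \<sigma>' v))"
      by (rule achieves_rewinds[where k = "\<lambda>v. if v = Iter l then n else n * n"])
        (use that n in auto)
    moreover have "(\<lambda>v. if v \<in> set [Iter l, Mat l] then tape_at (if v = Iter l then ?new else mat) 0 else \<sigma>' v)
      = \<sigma>(Iter l := tape_at ?new 0, Cur l := tape_at (?iter 0) 0,
     Changed := flag (?new \<noteq> as), Alive := flag (\<exists>v<n. ?new ! v))"
      using that state neq by (auto simp: fun_eq_iff)
    ultimately show ?thesis by - (erule achieves_mono, auto)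
  qed
  have copy: "achieves (While (Iter l) nonblank
       (Cond (Iter l) one (Append (Cur l) True) (Append (Cur l) False) ;; Go (Iter l) MoveRight)) \<sigma>'
       (n * (4 + 2) + 1) (?J n)" if "?J 0 \<sigma>'" for \<sigma>'
  proof (rule achieves_While_count[where I = ?J])
    show "?J 0 \<sigma>'" by (fact that)
    fix k \<sigma>' assume k: "k < n" and J: "?J k \<sigma>'"
    show "scanned (\<sigma>' (Iter l)) \<in> nonblank" using J k by simp
    show "achieves (Cond (Iter l) one (Append (Cur l) True) (Append (Cur l) False) ;;
        Go (Iter l) MoveRight) \<sigma>' 4 (?J (Suc k))"
      using J k n overwrite_step[of k ?new as "?new ! k"]
      by (auto simp: achieves_def fun_eq_iff)
  qed auto
  have rew2: "achieves (rewinds [Iter l, Cur l]) \<sigma>' (2 * (3 * N + 3))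
      (\<lambda>\<sigma>''. \<sigma>'' = (\<lambda>v. if v \<in> set [Iter l, Cur l] then tape_at ?new 0 else \<sigma>' v))"
    if "?J n \<sigma>'" for \<sigma>'
  proof -
    have "achieves (rewinds [Iter l, Cur l]) \<sigma>' (length [Iter l, Cur l] * (3 * N + 3))
      (\<lambda>\<sigma>''. \<sigma>'' = (\<lambda>v. if v \<in> set [Iter l, Cur l] then tape_at ?new 0 else \<sigma>' v))"
      by (rule achieves_rewinds[where k = "\<lambda>v. n"]) (use that n in auto)
    then show ?thesis by (rule achieves_mono) simp_all
  qed
  have init: "achieves (Erase Changed) \<sigma> 1 (\<lambda>\<sigma>'. \<sigma>' = \<sigma>(Changed := flag False))"
    "\<And>\<sigma>'. \<sigma>' = \<sigma>(Changed := flag False) \<Longrightarrow> achieves (Erase Alive) \<sigma>' 1 (\<lambda>\<sigma>'. \<sigma>' = ?\<sigma>0)"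
    using assms by (auto simp: achieves_def)
  let ?final = "\<lambda>\<sigma>'. core_state l mat (peel mat n m as) m \<sigma>' \<and>
    \<sigma>' Changed = flag (peel mat n m as \<noteq> as) \<and>
    \<sigma>' Alive = flag (\<exists>v<n. peel mat n m as ! v) \<and> \<sigma>' Tmp = \<sigma> Tmp \<and> \<sigma>' Out = \<sigma> Out"
  have final: "achieves (rewinds [Iter l, Cur l]) \<sigma>' (2 * (3 * N + 3)) ?final" if "?J n \<sigma>'" for \<sigma>'
    by (rule achieves_mono[OF rew2[OF that] order.refl])
      (use state that in \<open>auto simp: core_state_def\<close>)
  have "achieves (peel_round l) \<sigma>
     (1 + (1 + ((n * (((N * (9 + 2) + 1) + (6 + (2 * (3 * (N + B) + 3) + 1))) + 2) + 1) +
     (2 * (3 * N + 3) + ((n * (4 + 2) + 1) + 2 * (3 * N + 3)))))) ?final"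
    unfolding peel_round_def
    by (rule achieves_Seq[OF init(1)], erule achieves_Seq[OF init(2)], erule achieves_Seq[OF loop],
        erule achieves_Seq[OF rew1], erule achieves_Seq[OF copy], erule final)
  then show ?thesis
    by (rule achieves_mono, unfold time_round_def, intro add_mono mult_mono) (use n in simp_all)
qed

section \<open>Raising the threshold\<close>

definition repeated :: "nat \<Rightarrow> 'v com \<Rightarrow> 'v com" where
  "repeated j c = sequence (replicate j c)"

lemma wp_repeated_Append:
  assumes "\<sigma> v = tape_at xs (length xs)"
  shows "wp (repeated j (Append v b)) \<sigma> Q \<longleftrightarrow>
    Q j (\<sigma>(v := tape_at (xs @ replicate j b) (length xs + j)))"
  using assms
proof (induction j arbitrary: \<sigma> xs Q)
  case 0
  then have "\<sigma>(v := tape_at xs (length xs)) = \<sigma>" by auto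
  then show ?case by (simp add: repeated_def)
next
  case (Suc j)
  let ?\<sigma> = "\<sigma>(v := tape_at (xs @ [b]) (Suc (length xs)))"
  have "wp (repeated (Suc j) (Append v b)) \<sigma> Q \<longleftrightarrow> wp (repeated j (Append v b)) ?\<sigma> (\<lambda>k. Q (1 + k))"
    using Suc.prems by (simp add: repeated_def)
  also have "\<dots> \<longleftrightarrow> Q (Suc j) (?\<sigma>(v := tape_at ((xs @ [b]) @ replicate j b) (length (xs @ [b]) + j)))"
    by (subst Suc.IH[of _ "xs @ [b]"]) auto
  also have "?\<sigma>(v := tape_at ((xs @ [b]) @ replicate j b) (length (xs @ [b]) + j)) =
      \<sigma>(v := tape_at (xs @ replicate (Suc j) b) (length xs + Suc j))"
    by (simp add: fun_eq_iff)
  finally show ?case .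
qed

text \<open>
  Writing marks over a tape that already holds marks; the longer of the two words remains. So the
  auxiliary tape need not be erased between two uses.
\<close>

lemma wp_repeated_mark:
  assumes "\<sigma> v = tape_at (replicate r True) k" "k \<le> r"
  shows "wp (repeated j (Append v True)) \<sigma> Q \<longleftrightarrow>
    Q j (\<sigma>(v := tape_at (replicate (max r (k + j)) True) (k + j)))"
  using assms
proof (induction j arbitrary: \<sigma> r k Q)
  case 0
  then have "\<sigma>(v := tape_at (replicate r True) k) = \<sigma>" by auto
  with 0 show ?case by (simp add: repeated_def max_absorb1)
next
  case (Suc j)
  have "(replicate r True)[k := True] = replicate r True"
    by (metis list_update_id nth_replicate list_update_beyond length_replicate not_less)
  then have "act (bit True, MoveRight) (tape_at (replicate r True) k) =
      tape_at (replicate (max r (Suc k)) True) (Suc k)"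
    using Suc.prems(2) by (cases "k = r") (auto simp: replicate_append_same max_absorb1)
  let ?\<sigma> = "\<sigma>(v := tape_at (replicate (max r (Suc k)) True) (Suc k))"
  have "wp (repeated (Suc j) (Append v True)) \<sigma> Q \<longleftrightarrow>
      wp (repeated j (Append v True)) ?\<sigma> (\<lambda>k. Q (1 + k))"
    using Suc.prems(1) \<open>act _ _ = _\<close> by (simp add: repeated_def)
  also have "\<dots> \<longleftrightarrow> Q (Suc j)
     (?\<sigma>(v := tape_at (replicate (max (max r (Suc k)) (Suc k + j)) True) (Suc k + j)))"
    by (subst Suc.IH[of _ "max r (Suc k)" "Suc k"]) auto
  also have "?\<sigma>(v := tape_at (replicate (max (max r (Suc k)) (Suc k + j)) True) (Suc k + j)) =
      \<sigma>(v := tape_at (replicate (max r (k + Suc j)) True) (k + Suc j))"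
    by (simp add: fun_eq_iff max.assoc)
  finally show ?case .
qed

text \<open>
  Multiplication of a unary number by \<open>\<beta>\<close>: the first sweep writes \<open>\<beta> - 1\<close> marks on \<open>Tmp\<close> for each mark
  of the threshold, the second appends them. The old contents of \<open>Tmp\<close> do no harm because they are
  not longer than the new ones. The output grows by \<open>a\<close> zeros, in step with the threshold.
\<close>

definition raise_threshold :: "nat \<Rightarrow> nat \<Rightarrow> name com" where
  "raise_threshold \<beta> a =
     While Thr nonblank (repeated (\<beta> - 1) (Append Tmp True) ;; Go Thr MoveRight) ;;
     rewinds [Tmp] ;;
     While Tmp nonblank (Append Thr True ;; Go Tmp MoveRight) ;;
     rewinds [Thr, Tmp] ;;
     repeated a (Append Out False)"

definition time_raise :: "nat \<Rightarrow> nat \<Rightarrow> nat \<Rightarrow> nat" where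
  "time_raise \<beta> a B = (B * (\<beta> + 2) + 1) + ((3 * B + 3) + ((B * (2 + 2) + 1) + (2 * (3 * B + 3) + a)))"

lemma achieves_raise_threshold:
  assumes \<sigma>: "\<sigma> Thr = tape_at (replicate m True) 0" "\<sigma> Tmp = tape_at (replicate r True) 0"
      "\<sigma> Out = tape_at xs (length xs)"
    and m: "r \<le> (\<beta> - 1) * m" "1 \<le> \<beta>" "\<beta> * m \<le> B"
  shows "achieves (raise_threshold \<beta> a) \<sigma> (time_raise \<beta> a B) (\<lambda>\<sigma>'. \<sigma>' =
    \<sigma>(Thr := tape_at (replicate (\<beta> * m) True) 0, Tmp := tape_at (replicate ((\<beta> - 1) * m) True) 0,
      Out := tape_at (xs @ replicate a False) (length xs + a)))"
proof -
  let ?q = "(\<beta> - 1) * m"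
  have q: "m + ?q = \<beta> * m" using m(2) by (cases \<beta>) auto
  have B: "m \<le> B" "?q \<le> B" using m(3) q by linarith+
  let ?I = "\<lambda>k \<sigma>'. \<sigma>' = \<sigma>(Thr := tape_at (replicate m True) k,
      Tmp := tape_at (replicate (max r (k * (\<beta> - 1))) True) (k * (\<beta> - 1)))"
  let ?J = "\<lambda>k \<sigma>'. \<sigma>' = \<sigma>(Thr := tape_at (replicate (m + k) True) (m + k),
      Tmp := tape_at (replicate ?q True) k)"
  let ?R = "\<lambda>\<sigma>'. \<sigma>' = \<sigma>(Thr := tape_at (replicate (\<beta> * m) True) 0,
      Tmp := tape_at (replicate ?q True) 0)"
  have 1: "achieves (While Thr nonblank (repeated (\<beta> - 1) (Append Tmp True) ;; Go Thr MoveRight)) \<sigma>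
      (m * (\<beta> + 2) + 1) (?I m)"
  proof (rule achieves_While_count[where I = ?I])
    show "?I 0 \<sigma>" using \<sigma> by (auto simp: fun_eq_iff)
    fix k \<sigma>' assume k: "k < m" and I: "?I k \<sigma>'"
    show "scanned (\<sigma>' Thr) \<in> nonblank" using k I by simp
    have tmp: "\<sigma>' Tmp = tape_at (replicate (max r (k * (\<beta> - 1))) True) (k * (\<beta> - 1))"
      using I by simp
    show "achieves (repeated (\<beta> - 1) (Append Tmp True) ;; Go Thr MoveRight) \<sigma>' \<beta> (?I (Suc k))"
      unfolding achieves_def wp_Seq
      by (subst wp_repeated_mark[where r = "max r (k * (\<beta> - 1))" and k = "k * (\<beta> - 1)"])
        (use I m(2) in \<open>auto simp: fun_eq_iff max.assoc add.commute\<close>)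
  qed auto
  have 2: "achieves (rewinds [Tmp]) \<sigma>' (3 * B + 3) (?J 0)" if "?I m \<sigma>'" for \<sigma>'
  proof -
    have "achieves (rewinds [Tmp]) \<sigma>' (length [Tmp] * (3 * B + 3))
        (\<lambda>\<sigma>''. \<sigma>'' = (\<lambda>v. if v \<in> set [Tmp] then tape_at (replicate ?q True) 0 else \<sigma>' v))"
      by (rule achieves_rewinds[where k = "\<lambda>_. ?q"])
        (use that B m(1) in \<open>auto simp: max_absorb2 mult.commute\<close>)
    then show ?thesis by (rule achieves_mono) (use that in \<open>auto simp: fun_eq_iff\<close>)
  qed
  have 3: "achieves (While Tmp nonblank (Append Thr True ;; Go Tmp MoveRight)) \<sigma>'
      (?q * (2 + 2) + 1) (?J ?q)" if "?J 0 \<sigma>'" for \<sigma>'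
  proof (rule achieves_While_count[where I = ?J])
    show "?J 0 \<sigma>'" by (fact that)
  qed (auto simp: achieves_def fun_eq_iff replicate_append_same)
  have 4: "achieves (rewinds [Thr, Tmp]) \<sigma>' (2 * (3 * B + 3)) ?R" if "?J ?q \<sigma>'" for \<sigma>'
  proof -
    have "achieves (rewinds [Thr, Tmp]) \<sigma>' (length [Thr, Tmp] * (3 * B + 3))
        (\<lambda>\<sigma>''. \<sigma>'' = (\<lambda>v. if v \<in> set [Thr, Tmp]
          then tape_at (if v = Thr then replicate (\<beta> * m) True else replicate ?q True) 0 else \<sigma>' v))"
      by (rule achieves_rewinds[where k = "\<lambda>v. if v = Thr then \<beta> * m else ?q"])
        (use that B m(3) q in auto)
    then show ?thesis by (rule achieves_mono) (use that in \<open>auto simp: fun_eq_iff\<close>)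
  qed
  have 5: "achieves (repeated a (Append Out False)) \<sigma>' a (\<lambda>\<sigma>'. \<sigma>' =
    \<sigma>(Thr := tape_at (replicate (\<beta> * m) True) 0, Tmp := tape_at (replicate ?q True) 0,
      Out := tape_at (xs @ replicate a False) (length xs + a)))" if "?R \<sigma>'" for \<sigma>'
  proof -
    have "\<sigma>' Out = tape_at xs (length xs)" using that \<sigma> by simp
    then show ?thesis unfolding achieves_def by (subst wp_repeated_Append) (use that in auto)
  qed
  have "achieves (raise_threshold \<beta> a) \<sigma>
      ((m * (\<beta> + 2) + 1) + ((3 * B + 3) + ((?q * (2 + 2) + 1) + (2 * (3 * B + 3) + a)))) (\<lambda>\<sigma>'. \<sigma>' =
    \<sigma>(Thr := tape_at (replicate (\<beta> * m) True) 0, Tmp := tape_at (replicate ?q True) 0,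
      Out := tape_at (xs @ replicate a False) (length xs + a)))"
    unfolding raise_threshold_def
    by (rule achieves_Seq[OF 1], erule achieves_Seq[OF 2], erule achieves_Seq[OF 3],
        erule achieves_Seq[OF 4], erule 5)
  then show ?thesis
    by (rule achieves_mono, unfold time_raise_def, intro add_mono mult_mono) (use B in simp_all)
qed

section \<open>The complete peeling phase\<close>

definition peeling :: "nat \<Rightarrow> nat \<Rightarrow> nat \<Rightarrow> name com" where
  "peeling \<beta> a l =
     (Append Thr True ;; rewinds [Thr] ;; Put Alive True) ;;
     While Alive nonblank (peel_round l ;; Cond Changed nonblank Skip (raise_threshold \<beta> a)) ;;
     Append Out True"

definition time_peeling :: "nat \<Rightarrow> nat \<Rightarrow> nat \<Rightarrow> nat" where
  "time_peeling \<beta> a N = (3 * N + 8) + (((N + \<beta> * N) *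
     ((time_round N (\<beta> * N) + (time_raise \<beta> a (\<beta> * N) + 2)) + 2) + 1) + 1)"

text \<open>
  Each iteration either removes a vertex or raises the threshold. The threshold is only raised while some
  vertex has at least that many neighbours, hence stays below \<open>\<beta> * n\<close>; so the number of
  remaining vertices plus the distance of the threshold from \<open>\<beta> * n\<close> bounds the iterations. The
  property \<open>J\<close> of the remaining vertices and the exponent of the threshold is arbitrary, so that nothing
  about graphs enters here.
\<close>

lemma achieves_peeling:
  assumes \<sigma>: "\<sigma> (Cur l) = tape_at as 0" "\<sigma> (Iter l) = tape_at as 0" "\<sigma> (Mat l) = tape_at mat 0"
      "\<sigma> Thr = tape_at [] 0" "\<sigma> Tmp = tape_at [] 0" "\<sigma> Out = tape_at [] 0"
      "\<sigma> Changed = flag False" "\<sigma> Alive = flag False"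
    and n: "length as = n" "length mat = n * n" "n \<le> N" "n * n \<le> N" "\<exists>v<n. as ! v"
    and \<beta>: "2 \<le> \<beta>"
    and J: "J as 0"
    and J_peel: "\<And>as i. J as i \<Longrightarrow> length as = n \<Longrightarrow> \<exists>v<n. as ! v \<Longrightarrow>
      J (peel mat n (\<beta> ^ i) as) (if peel mat n (\<beta> ^ i) as = as then Suc i else i)"
  shows "achieves (peeling \<beta> a l) \<sigma> (time_peeling \<beta> a N) (\<lambda>\<sigma>'. \<exists>as i. J as i \<and> length as = n \<and>
    \<not> (\<exists>v<n. as ! v) \<and> fst (\<sigma>' Out) = word_contents (replicate (a * i) False @ [True]))"
proof -
  let ?alive = "\<lambda>as. {v. v < n \<and> as ! v}"
  define S where "S = (\<lambda>as i \<sigma>'. J as i \<and> length as = n \<and> core_state l mat as (\<beta> ^ i) \<sigma>' \<and>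
    \<sigma>' Out = tape_at (replicate (a * i) False) (a * i) \<and> (\<exists>x. \<sigma>' Changed = flag x) \<and>
    (\<exists>r. \<sigma>' Tmp = tape_at (replicate r True) 0 \<and> r \<le> (\<beta> - 1) * \<beta> ^ i) \<and> \<beta> ^ i \<le> \<beta> * n)"
  define I where "I = (\<lambda>k \<sigma>'. \<exists>as i. S as i \<sigma>' \<and> \<sigma>' Alive = flag (\<exists>v<n. as ! v) \<and>
    k = card (?alive as) + (\<beta> * n - \<beta> ^ i))"
  let ?k = "card (?alive as) + (\<beta> * n - 1)"
  have n0: "0 < n" using n by auto
  have init: "achieves (Append Thr True ;; rewinds [Thr] ;; Put Alive True) \<sigma> (1 + ((3 * N + 3) + 1)) (I ?k)"
  proof (rule achieves_Seq[where R = "\<lambda>\<sigma>'. \<sigma>' = \<sigma>(Thr := tape_at [True] 1)"])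
    show "achieves (Append Thr True) \<sigma> 1 (\<lambda>\<sigma>'. \<sigma>' = \<sigma>(Thr := tape_at [True] 1))"
      using \<sigma> by (simp add: achieves_def)
    fix \<sigma>' assume \<sigma>': "\<sigma>' = \<sigma>(Thr := tape_at [True] 1)"
    have rew: "achieves (rewinds [Thr]) \<sigma>' (length [Thr] * (3 * N + 3))
        (\<lambda>\<sigma>''. \<sigma>'' = (\<lambda>v. if v \<in> set [Thr] then tape_at [True] 0 else \<sigma>' v))"
      by (rule achieves_rewinds[where k = "\<lambda>_. 1"]) (use \<sigma>' n n0 in auto)
    have "achieves (rewinds [Thr] ;; Put Alive True) \<sigma>' (length [Thr] * (3 * N + 3) + 1) (I ?k)"
    proof (rule achieves_Seq[OF rew])
      fix \<sigma>'' assume \<sigma>'': "\<sigma>'' = (\<lambda>v. if v \<in> set [Thr] then tape_at [True] 0 else \<sigma>' v)"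
      have "\<sigma>''(Alive := act (bit True, Stay) (\<sigma>'' Alive)) = \<sigma>(Thr := tape_at [True] 0, Alive := flag True)"
        using \<sigma> by (auto simp: \<sigma>'' \<sigma>' fun_eq_iff)
      moreover have "\<beta> * n \<ge> 1" using \<beta> n0 by (simp add: Suc_leI)
      then have "I ?k (\<sigma>(Thr := tape_at [True] 0, Alive := flag True))"
        unfolding I_def S_def using \<sigma> n J
        by (intro exI[of _ as] exI[of _ 0]) (auto simp: core_state_def intro: exI[of _ 0])
      ultimately show "achieves (Put Alive True) \<sigma>'' 1 (I ?k)" by (simp add: achieves_def)
    qed
    then show "achieves (rewinds [Thr] ;; Put Alive True) \<sigma>' ((3 * N + 3) + 1) (I ?k)" by simp
  qed
  have step: "achieves (peel_round l ;; Cond Changed nonblank Skip (raise_threshold \<beta> a)) \<sigma>'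
      (time_round N (\<beta> * N) + (time_raise \<beta> a (\<beta> * N) + 2)) (\<lambda>\<sigma>'. \<exists>k'<k. I k' \<sigma>')"
    if I: "I k \<sigma>'" and nonblank: "scanned (\<sigma>' Alive) \<in> nonblank" for k \<sigma>'
  proof -
    obtain as i where S: "S as i \<sigma>'" and alive: "\<sigma>' Alive = flag (\<exists>v<n. as ! v)"
      and k: "k = card (?alive as) + (\<beta> * n - \<beta> ^ i)" using I unfolding I_def by blast
    have ex: "\<exists>v<n. as ! v" using nonblank alive by simp
    let ?new = "peel mat n (\<beta> ^ i) as"
    have le: "\<beta> * n \<le> \<beta> * N" using n by simp
    obtain x r where x: "\<sigma>' Changed = flag x"
      and r: "\<sigma>' Tmp = tape_at (replicate r True) 0" "r \<le> (\<beta> - 1) * \<beta> ^ i"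
      using S unfolding S_def by blast
    have len: "length as = n" and cs: "core_state l mat as (\<beta> ^ i) \<sigma>'" and J_as: "J as i"
      and out: "\<sigma>' Out = tape_at (replicate (a * i) False) (a * i)" and bound: "\<beta> ^ i \<le> \<beta> * n"
      using S by (auto simp: S_def)
    note J_new = J_peel[OF J_as len ex]
    let ?Q = "\<lambda>\<sigma>''. core_state l mat ?new (\<beta> ^ i) \<sigma>'' \<and> \<sigma>'' Changed = flag (?new \<noteq> as) \<and>
      \<sigma>'' Alive = flag (\<exists>v<n. ?new ! v) \<and> \<sigma>'' Tmp = \<sigma>' Tmp \<and> \<sigma>'' Out = \<sigma>' Out"
    show ?thesis
    proof (rule achieves_Seq[where R = ?Q])
      show "achieves (peel_round l) \<sigma>' (time_round N (\<beta> * N)) ?Q"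
        by (rule achieves_peel_round[OF cs x alive]) (use n(2-4) len order.trans[OF bound le] in simp_all)
      fix \<sigma>'' assume Q: "?Q \<sigma>''"
      show "achieves (Cond Changed nonblank Skip (raise_threshold \<beta> a)) \<sigma>''
          (time_raise \<beta> a (\<beta> * N) + 2) (\<lambda>\<sigma>'. \<exists>k'<k. I k' \<sigma>')"
      proof (rule achieves_Cond)
        assume "scanned (\<sigma>'' Changed) \<in> nonblank"
        then have changed: "?new \<noteq> as" using Q by simp
        have sub: "?alive ?new \<subseteq> ?alive as" by (auto simp: peel_def)
        have "?alive ?new \<noteq> ?alive as"
        proof
          assume eq: "?alive ?new = ?alive as"
          then have "?new ! v = as ! v" if "v < n" for v using that by blast
          then show False using changed len by (auto simp: list_eq_iff_nth_eq)
        qed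
        with sub have "card (?alive ?new) < card (?alive as)" by (intro psubset_card_mono) auto
        moreover have "I (card (?alive ?new) + (\<beta> * n - \<beta> ^ i)) \<sigma>''"
          unfolding I_def S_def using Q J_new changed r out bound
          by (intro exI[of _ ?new] exI[of _ i]) (auto intro: exI[of _ r])
        ultimately show "achieves Skip \<sigma>'' (time_raise \<beta> a (\<beta> * N)) (\<lambda>\<sigma>'. \<exists>k'<k. I k' \<sigma>')"
          unfolding k by (intro achieves_Skip exI[of _ "card (?alive ?new) + (\<beta> * n - \<beta> ^ i)"]) auto
      next
        assume "scanned (\<sigma>'' Changed) \<notin> nonblank"
        then have same: "?new = as" using Q by simp
        \<comment> \<open>a stable nonempty set has a vertex of degree at least the threshold, which is therefore at most \<open>n\<close>\<close>
        obtain v where v: "v < n" "as ! v" using ex by blast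
        then have "?new ! v" using same by simp
        then have "\<beta> ^ i \<le> alive_degree mat n as v" using v by (simp add: peel_def)
        also have "\<dots> \<le> card {..<n}" unfolding alive_degree_def by (intro card_mono) auto
        finally have le_n: "\<beta> ^ i \<le> n" by simp
        then have Suc_le: "\<beta> ^ Suc i \<le> \<beta> * n" by simp
        have less: "\<beta> ^ i < \<beta> ^ Suc i" using \<beta> by simp
        let ?\<sigma> = "\<sigma>''(Thr := tape_at (replicate (\<beta> * \<beta> ^ i) True) 0,
          Tmp := tape_at (replicate ((\<beta> - 1) * \<beta> ^ i) True) 0,
          Out := tape_at (replicate (a * i) False @ replicate a False) (length (replicate (a * i) False) + a))"
        have raise: "achieves (raise_threshold \<beta> a) \<sigma>'' (time_raise \<beta> a (\<beta> * N)) (\<lambda>\<sigma>'. \<sigma>' = ?\<sigma>)"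
          by (rule achieves_raise_threshold) (use Q r out \<beta> Suc_le le in \<open>auto simp: core_state_def\<close>)
        have "(\<beta> - 1) * \<beta> ^ i \<le> (\<beta> - 1) * \<beta> ^ Suc i" using less by (intro mult_le_mono2) simp
        then have "I (card (?alive as) + (\<beta> * n - \<beta> ^ Suc i)) ?\<sigma>"
          unfolding I_def S_def using Q J_new same Suc_le len
          by (intro exI[of _ as] exI[of _ "Suc i"])
            (auto simp: core_state_def replicate_add[symmetric] add.commute)
        moreover have "card (?alive as) + (\<beta> * n - \<beta> ^ Suc i) < k"
          unfolding k using less Suc_le by linarith
        ultimately show "achieves (raise_threshold \<beta> a) \<sigma>'' (time_raise \<beta> a (\<beta> * N)) (\<lambda>\<sigma>'. \<exists>k'<k. I k' \<sigma>')"
          by (intro achieves_mono[OF raise order.refl]) blast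
      qed
    qed
  qed
  have loop: "achieves (While Alive nonblank (peel_round l ;; Cond Changed nonblank Skip (raise_threshold \<beta> a))) \<sigma>'
     ((N + \<beta> * N) * ((time_round N (\<beta> * N) + (time_raise \<beta> a (\<beta> * N) + 2)) + 2) + 1)
     (\<lambda>\<sigma>'. (\<exists>k. I k \<sigma>') \<and> scanned (\<sigma>' Alive) \<notin> nonblank)" if "I ?k \<sigma>'" for \<sigma>'
  proof (rule achieves_mono[OF achieves_While_measure[where I = I, OF that step]])
    have "?alive as \<subseteq> {..<n}" by auto
    then have "card (?alive as) \<le> n" using card_mono[of "{..<n}" "?alive as"] by simp
    moreover have "\<beta> * n \<le> \<beta> * N" using n by simp
    ultimately have "?k \<le> N + \<beta> * N" using n(3) by linarith
    then show "?k * ((time_round N (\<beta> * N) + (time_raise \<beta> a (\<beta> * N) + 2)) + 2) + 1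
      \<le> (N + \<beta> * N) * ((time_round N (\<beta> * N) + (time_raise \<beta> a (\<beta> * N) + 2)) + 2) + 1"
      by (intro add_right_mono mult_right_mono) simp_all
  qed auto
  have final: "achieves (Append Out True) \<sigma>' 1 (\<lambda>\<sigma>'. \<exists>as i. J as i \<and> length as = n \<and>
    \<not> (\<exists>v<n. as ! v) \<and> fst (\<sigma>' Out) = word_contents (replicate (a * i) False @ [True]))"
    if end_state: "(\<exists>k. I k \<sigma>') \<and> scanned (\<sigma>' Alive) \<notin> nonblank" for \<sigma>'
  proof -
    obtain as i where S: "S as i \<sigma>'" and alive: "\<sigma>' Alive = flag (\<exists>v<n. as ! v)"
      using end_state unfolding I_def by blast
    have "fst (act (bit True, MoveRight) (\<sigma>' Out)) = word_contents (replicate (a * i) False @ [True])"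
      using S by (simp add: S_def tape_at_def[of "_ @ _"])
    then show ?thesis unfolding achieves_def
      using S alive end_state by (auto simp: S_def simp del: act_append)
  qed
  have "achieves (peeling \<beta> a l) \<sigma> ((1 + ((3 * N + 3) + 1)) + (((N + \<beta> * N) *
     ((time_round N (\<beta> * N) + (time_raise \<beta> a (\<beta> * N) + 2)) + 2) + 1) + 1))
    (\<lambda>\<sigma>'. \<exists>as i. J as i \<and> length as = n \<and>
    \<not> (\<exists>v<n. as ! v) \<and> fst (\<sigma>' Out) = word_contents (replicate (a * i) False @ [True]))"
    unfolding peeling_def
    by (rule achieves_Seq[OF init], erule achieves_Seq[OF loop], erule final)
  then show ?thesis by (rule achieves_mono) (auto simp: time_peeling_def)
qed

section \<open>The complete machine\<close>

definition output_word :: "bool list \<Rightarrow> name com" where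
  "output_word ys = sequence (map (Append Out) ys)"

text \<open>
  The sizes are tried in increasing order. The search for size \<open>k\<close> starts on level \<open>k\<close> and only disturbs
  lower levels, so the full candidate sets on the later levels stay intact.
\<close>

fun cascade :: "nat \<Rightarrow> nat \<Rightarrow> nat \<Rightarrow> nat list \<Rightarrow> name com" where
  "cascade \<beta> a L [] = peeling \<beta> a L"
| "cascade \<beta> a L (k # ks) =
     clique_search k ;;
     Cond Flag nonblank (Erase Flag ;; cascade \<beta> a L ks) (output_word (binary (k - 1)))"

definition approximation_program :: "nat \<Rightarrow> nat \<Rightarrow> nat \<Rightarrow> name com" where
  "approximation_program \<beta> a L = load (Suc L) ;; cascade \<beta> a L [1..<L]"

lemma achieves_output_word:
  assumes "\<sigma> Out = tape_at xs (length xs)"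
  shows "achieves (output_word ys) \<sigma> (length ys) (\<lambda>\<sigma>'. fst (\<sigma>' Out) = word_contents (xs @ ys))"
  using assms
proof (induction ys arbitrary: xs \<sigma>)
  case Nil
  then show ?case by (simp add: output_word_def achieves_def tape_at_def)
next
  case (Cons y ys)
  let ?\<sigma> = "\<sigma>(Out := tape_at (xs @ [y]) (length (xs @ [y])))"
  have "achieves (Append Out y ;; output_word ys) \<sigma> (1 + length ys)
      (\<lambda>\<sigma>'. fst (\<sigma>' Out) = word_contents ((xs @ [y]) @ ys))"
  proof (rule achieves_Seq[where R = "\<lambda>\<sigma>'. \<sigma>' = ?\<sigma>"])
    show "achieves (Append Out y) \<sigma> 1 (\<lambda>\<sigma>'. \<sigma>' = ?\<sigma>)" using Cons.prems by (simp add: achieves_def)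
    show "achieves (output_word ys) \<sigma>' (length ys) (\<lambda>\<sigma>'. fst (\<sigma>' Out) = word_contents ((xs @ [y]) @ ys))"
      if "\<sigma>' = ?\<sigma>" for \<sigma>' using that by (intro Cons.IH) simp
  qed
  then show ?case by (simp add: output_word_def)
qed

definition fresh_from :: "nat \<Rightarrow> bool list \<Rightarrow> nat \<Rightarrow> nat \<Rightarrow> (name \<Rightarrow> tape) \<Rightarrow> bool" where
  "fresh_from n mat L k \<sigma> \<longleftrightarrow> scratch n k \<sigma> \<and>
     (\<forall>j\<in>{k..L}. \<sigma> (Cur j) = tape_at (replicate n True) 0 \<and> \<sigma> (Iter j) = tape_at (replicate n True) 0) \<and>
     (\<forall>j\<le>L. \<sigma> (Mat j) = tape_at mat 0) \<and>
     (\<forall>v\<in>{Out, Thr, Tmp}. \<sigma> v = tape_at [] 0) \<and>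
     (\<forall>v\<in>{Flag, Changed, Alive}. \<sigma> v = flag False)"

fun time_cascade :: "nat \<Rightarrow> nat \<Rightarrow> nat \<Rightarrow> nat list \<Rightarrow> nat" where
  "time_cascade \<beta> a N [] = time_peeling \<beta> a N"
| "time_cascade \<beta> a N (k # ks) =
     time_search N k + ((1 + time_cascade \<beta> a N ks + length (binary (k - 1))) + 2)"

text \<open>
  Either some size \<open>j\<close> is the first one that fails, and the output is \<open>j - 1\<close>, or all sizes succeed and the
  output comes from the peeling phase.
\<close>

definition search_result ::
    "bool list \<Rightarrow> nat \<Rightarrow> nat \<Rightarrow> nat \<Rightarrow> (bool list \<Rightarrow> nat \<Rightarrow> bool) \<Rightarrow> nat \<Rightarrow> bool list \<Rightarrow> bool" where
  "search_result mat n a L J k y \<longleftrightarrow>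
     (\<exists>j\<in>{k..<L}. \<not> has_clique mat n j (replicate n True) \<and>
        (\<forall>i\<in>{k..<j}. has_clique mat n i (replicate n True)) \<and> y = binary (j - 1)) \<or>
     (\<forall>i\<in>{k..<L}. has_clique mat n i (replicate n True)) \<and>
     (\<exists>as i. J as i \<and> length as = n \<and> \<not> (\<exists>v<n. as ! v) \<and> y = replicate (a * i) False @ [True])"

lemma search_result_step:
  assumes "search_result mat n a L J (Suc k) y" "has_clique mat n k (replicate n True)"
  shows "search_result mat n a L J k y"
proof -
  have split: "(\<forall>i\<in>{k..<m}. has_clique mat n i (replicate n True)) \<longleftrightarrow>
      (\<forall>i\<in>{Suc k..<m}. has_clique mat n i (replicate n True))" for m
  proof
    assume *: "\<forall>i\<in>{Suc k..<m}. has_clique mat n i (replicate n True)"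
    show "\<forall>i\<in>{k..<m}. has_clique mat n i (replicate n True)"
    proof
      fix i assume "i \<in> {k..<m}"
      then show "has_clique mat n i (replicate n True)" using * assms(2) by (cases "i = k") auto
    qed
  qed auto
  have "{Suc k..<L} \<subseteq> {k..<L}" by auto
  then show ?thesis using assms(1) unfolding search_result_def split by blast
qed

lemma achieves_cascade:
  assumes "fresh_from n mat L k \<sigma>" "k \<le> L"
    and n: "0 < n" "length mat = n * n" "n \<le> N" "n * n \<le> N"
    and \<beta>: "2 \<le> \<beta>"
    and J: "J (replicate n True) 0"
    and J_peel: "\<And>as i. J as i \<Longrightarrow> length as = n \<Longrightarrow> \<exists>v<n. as ! v \<Longrightarrow>
      J (peel mat n (\<beta> ^ i) as) (if peel mat n (\<beta> ^ i) as = as then Suc i else i)"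
  shows "achieves (cascade \<beta> a L [k..<L]) \<sigma> (time_cascade \<beta> a N [k..<L])
    (\<lambda>\<sigma>'. \<exists>y. fst (\<sigma>' Out) = word_contents y \<and> search_result mat n a L J k y)"
  using assms(1,2)
proof (induction "L - k" arbitrary: k \<sigma>)
  case 0
  then have k: "k = L" by simp
  have "achieves (peeling \<beta> a L) \<sigma> (time_peeling \<beta> a N) (\<lambda>\<sigma>'. \<exists>as i. J as i \<and> length as = n \<and>
    \<not> (\<exists>v<n. as ! v) \<and> fst (\<sigma>' Out) = word_contents (replicate (a * i) False @ [True]))"
    by (rule achieves_peeling[where as = "replicate n True" and mat = mat])
      (use 0 k n \<beta> J J_peel in \<open>auto simp: fresh_from_def\<close>)
  then have "achieves (peeling \<beta> a L) \<sigma> (time_peeling \<beta> a N)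
    (\<lambda>\<sigma>'. \<exists>y. fst (\<sigma>' Out) = word_contents y \<and> search_result mat n a L J k y)"
    by (rule achieves_mono) (auto simp: search_result_def k)
  then show ?case by (simp add: k)
next
  case (Suc m)
  let ?full = "replicate n True"
  have k: "k < L" using Suc.hyps(2) by simp
  have fresh: "scratch n k \<sigma>" "\<And>j. j \<in> {k..L} \<Longrightarrow> \<sigma> (Cur j) = tape_at ?full 0"
    "\<And>j. j \<in> {k..L} \<Longrightarrow> \<sigma> (Iter j) = tape_at ?full 0" "\<And>j. j \<le> L \<Longrightarrow> \<sigma> (Mat j) = tape_at mat 0"
    "\<And>v. v \<in> {Out, Thr, Tmp} \<Longrightarrow> \<sigma> v = tape_at [] 0"
    "\<And>v. v \<in> {Flag, Changed, Alive} \<Longrightarrow> \<sigma> v = flag False"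
    using Suc.prems(1) unfolding fresh_from_def by auto
  let ?P = "\<lambda>\<sigma>'. scratch n k \<sigma>' \<and> \<sigma>' Flag = flag (False \<or> has_clique mat n k ?full) \<and>
    (\<forall>v. v \<noteq> Flag \<and> (\<forall>j<k. v \<noteq> Cur j \<and> v \<noteq> Iter j) \<longrightarrow> \<sigma>' v = \<sigma> v)"
  have search: "achieves (clique_search k) \<sigma> (time_search N k) ?P"
    by (rule achieves_clique_search) (use fresh k n in auto)
  let ?Q = "\<lambda>\<sigma>'. \<exists>y. fst (\<sigma>' Out) = word_contents y \<and> search_result mat n a L J k y"
  have "achieves (cascade \<beta> a L (k # [Suc k..<L])) \<sigma> (time_cascade \<beta> a N (k # [Suc k..<L])) ?Q"
    unfolding cascade.simps time_cascade.simps
  proof (rule achieves_Seq[OF search])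
    fix \<sigma>' assume P: "?P \<sigma>'"
    let ?t = "1 + time_cascade \<beta> a N [Suc k..<L] + length (binary (k - 1))"
    show "achieves (Cond Flag nonblank (Erase Flag ;; cascade \<beta> a L [Suc k..<L])
        (output_word (binary (k - 1)))) \<sigma>' (?t + 2) ?Q"
    proof (rule achieves_Cond)
      assume "scanned (\<sigma>' Flag) \<in> nonblank"
      then have has: "has_clique mat n k ?full" using P by simp
      let ?\<sigma> = "\<sigma>'(Flag := flag False)"
      have "scratch n k ?\<sigma>" using P by (auto simp: scratch_def)
      moreover have "?\<sigma> (Cur k) = tape_at ?full 0" "?\<sigma> (Iter k) = tape_at ?full 0"
        using P fresh(2,3)[of k] k by auto
      ultimately have "scratch n (Suc k) ?\<sigma>" unfolding scratch_Suc
        by (intro conjI exI[of _ ?full]) simp_all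
      moreover have "\<sigma>' v = \<sigma> v" if "v \<noteq> Flag" "\<forall>j<k. v \<noteq> Cur j \<and> v \<noteq> Iter j" for v
        using P that by blast
      ultimately have "fresh_from n mat L (Suc k) ?\<sigma>"
        unfolding fresh_from_def using fresh by auto
      then have "achieves (cascade \<beta> a L [Suc k..<L]) ?\<sigma> (time_cascade \<beta> a N [Suc k..<L])
        (\<lambda>\<sigma>'. \<exists>y. fst (\<sigma>' Out) = word_contents y \<and> search_result mat n a L J (Suc k) y)"
        using Suc.hyps k by (intro Suc.hyps(1)) auto
      then have rest: "achieves (cascade \<beta> a L [Suc k..<L]) ?\<sigma> (time_cascade \<beta> a N [Suc k..<L]) ?Q"
        by (rule achieves_mono) (auto dest: search_result_step[OF _ has])
      have "achieves (Erase Flag ;; cascade \<beta> a L [Suc k..<L]) \<sigma>'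
          (1 + time_cascade \<beta> a N [Suc k..<L]) ?Q"
        by (rule achieves_Seq[where R = "\<lambda>\<sigma>''. \<sigma>'' = ?\<sigma>"])
          (use P rest in \<open>simp_all add: achieves_def\<close>)
      then show "achieves (Erase Flag ;; cascade \<beta> a L [Suc k..<L]) \<sigma>' ?t ?Q"
        by (rule achieves_mono) simp_all
    next
      assume "scanned (\<sigma>' Flag) \<notin> nonblank"
      then have not: "\<not> has_clique mat n k ?full" using P by simp
      have "\<sigma>' Out = tape_at [] (length ([] :: bool list))" using P fresh(5)[of Out] by auto
      from achieves_output_word[where ys = "binary (k - 1)" and xs = "[]" and \<sigma> = \<sigma>', OF this]
      show "achieves (output_word (binary (k - 1))) \<sigma>' ?t ?Q"
      proof (rule achieves_mono)
        fix \<sigma>'' assume "fst (\<sigma>'' Out) = word_contents ([] @ binary (k - 1))"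
        moreover have "search_result mat n a L J k (binary (k - 1))"
          unfolding search_result_def using not k by auto
        ultimately show "?Q \<sigma>''" by auto
      qed simp
    qed
  qed
  then show ?case using k by (simp add: upt_conv_Cons)
qed

definition all_tapes :: "nat \<Rightarrow> name list" where
  "all_tapes L = [In, Out, Flag, Changed, Alive, Thr, Tmp] @ candidate_tapes L @ matrix_tapes L"

lemma distinct_all_tapes: "distinct (all_tapes L)"
  by (auto simp: all_tapes_def candidate_tapes_def matrix_tapes_def distinct_map inj_on_def)

lemma uses_sequence [simp]: "uses (sequence cs) = (\<Union>c\<in>set cs. uses c)"
  by (induction cs) auto

lemma uses_derived [simp]:
  "uses (Rewind v) = {v}" "uses (rewinds vs) = set vs" "uses (appends vs b) = set vs"
  "uses (output_word ys) \<subseteq> {Out}" "uses (repeated j c) \<subseteq> uses c"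
  by (auto simp: Rewind_def rewinds_def appends_def output_word_def repeated_def)

lemma three_symbols_sequence [simp]: "three_symbols (sequence cs) = (\<forall>c\<in>set cs. three_symbols c)"
  by (induction cs) auto

lemma bit_less [simp]: "bit b < 3"
  by (simp add: bit_def)

lemma three_symbols_derived [simp]:
  "three_symbols (Rewind v)" "three_symbols (rewinds vs)" "three_symbols (appends vs b)"
  "three_symbols (output_word ys)" "three_symbols c \<Longrightarrow> three_symbols (repeated j c)"
  by (auto simp: Rewind_def rewinds_def appends_def output_word_def repeated_def)

lemma uses_clique_search: "l \<le> L \<Longrightarrow> uses (clique_search l) \<subseteq> set (all_tapes (Suc L))"
  by (induction l) (auto simp: all_tapes_def restrict_to_row_def)

lemma three_symbols_clique_search: "three_symbols (clique_search l)"
  by (induction l) (auto simp: restrict_to_row_def)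

lemma uses_peeling: "uses (peeling \<beta> a L) \<subseteq> set (all_tapes (Suc L))"
  using uses_derived(5)[of a "Append Out False"] uses_derived(5)[of "\<beta> - 1" "Append Tmp True"]
  by (auto simp: all_tapes_def peeling_def peel_round_def count_neighbours_def raise_threshold_def)

lemma three_symbols_peeling: "three_symbols (peeling \<beta> a L)"
  by (auto simp: peeling_def peel_round_def count_neighbours_def raise_threshold_def)

lemma uses_cascade: "\<forall>k\<in>set ks. k \<le> L \<Longrightarrow> uses (cascade \<beta> a L ks) \<subseteq> set (all_tapes (Suc L))"
proof (induction ks)
  case (Cons k ks)
  then show ?case using uses_clique_search[of k L]
    by (auto simp: all_tapes_def dest!: subsetD[OF uses_derived(4)])
qed (use uses_peeling in auto)

lemma three_symbols_cascade: "three_symbols (cascade \<beta> a L ks)"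
  by (induction ks) (auto simp: three_symbols_clique_search three_symbols_peeling)

lemma uses_approximation_program: "uses (approximation_program \<beta> a L) \<subseteq> set (all_tapes (Suc L))"
  using uses_cascade[of "[1..<L]" L \<beta> a]
  by (auto simp: approximation_program_def load_def all_tapes_def)

lemma three_symbols_approximation_program: "three_symbols (approximation_program \<beta> a L)"
  by (auto simp: approximation_program_def load_def three_symbols_cascade)

section \<open>Polynomial running time\<close>

text \<open>
  Running times are nested sums and products, for which closure properties are more convenient than an
  explicit polynomial.
\<close>

definition poly_bounded :: "(nat \<Rightarrow> nat) \<Rightarrow> bool" where
  "poly_bounded t \<longleftrightarrow> (\<exists>p :: nat poly. \<forall>N. t N \<le> poly p N)"

lemma poly_bounded_intros [intro!, simp]:
  "poly_bounded (\<lambda>N. c)"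
  "poly_bounded (\<lambda>N. N)"
  "poly_bounded s \<Longrightarrow> poly_bounded t \<Longrightarrow> poly_bounded (\<lambda>N. s N + t N)"
  "poly_bounded s \<Longrightarrow> poly_bounded t \<Longrightarrow> poly_bounded (\<lambda>N. s N * t N)"
proof -
  show "poly_bounded (\<lambda>N. c)" unfolding poly_bounded_def by (intro exI[of _ "[:c:]"]) simp
  show "poly_bounded (\<lambda>N. N)" unfolding poly_bounded_def by (intro exI[of _ "[:0, 1:]"]) simp
  assume "poly_bounded s" "poly_bounded t"
  then obtain p q :: "nat poly" where pq: "\<And>N. s N \<le> poly p N" "\<And>N. t N \<le> poly q N"
    by (auto simp: poly_bounded_def)
  then show "poly_bounded (\<lambda>N. s N + t N)" "poly_bounded (\<lambda>N. s N * t N)"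
    unfolding poly_bounded_def
    by (intro exI[of _ "p + q"], simp add: add_mono pq)
      (intro exI[of _ "p * q"], simp add: mult_le_mono pq)
qed

lemma poly_bounded_Suc [intro!, simp]: "poly_bounded t \<Longrightarrow> poly_bounded (\<lambda>N. Suc (t N))"
  using poly_bounded_intros(3)[of t "\<lambda>_. 1"] by simp

lemma poly_bounded_search: "poly_bounded (\<lambda>N. time_search N l)"
  by (induction l) auto

lemma poly_bounded_cascade: "poly_bounded (\<lambda>N. time_cascade \<beta> a N ks)"
  by (induction ks)
    (auto simp: time_peeling_def time_round_def time_raise_def poly_bounded_search)

text \<open>
  The invariant \<open>J\<close> is quantified after the machine: it may depend on the input graph, whereas the machine
  and the polynomial do not.
\<close>

lemma approximation_machine:
  assumes "2 \<le> \<beta>" "1 \<le> L"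
  obtains M and p :: "nat poly" where "valid_machine M"
    and "\<And>n mat J. 0 < n \<Longrightarrow> length mat = n * n \<Longrightarrow> J (replicate n True) 0 \<Longrightarrow>
      (\<And>as i. J as i \<Longrightarrow> length as = n \<Longrightarrow> \<exists>v<n. as ! v \<Longrightarrow>
        J (peel mat n (\<beta> ^ i) as) (if peel mat n (\<beta> ^ i) as = as then Suc i else i)) \<Longrightarrow>
      \<exists>y. computes_within M (replicate n True @ False # mat)
            (poly p (length (replicate n True @ False # mat))) y \<and>
          search_result mat n a L J 1 y"
proof -
  let ?c = "approximation_program \<beta> a L" and ?vs = "all_tapes (Suc L)"
  have "poly_bounded (\<lambda>N. time_load (Suc L) N + time_cascade \<beta> a N [1..<L])"
    unfolding time_load_def by (auto intro: poly_bounded_cascade)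
  then obtain p :: "nat poly" where
    p: "\<And>N. time_load (Suc L) N + time_cascade \<beta> a N [1..<L] \<le> poly p N"
    by (auto simp: poly_bounded_def)
  show ?thesis
  proof (rule that[of "machine ?vs ?c" p])
    show "valid_machine (machine ?vs ?c)"
      by (intro valid_machine_compile three_symbols_approximation_program) (simp add: all_tapes_def)
    fix n :: nat and mat :: "bool list" and J
    assume n: "0 < n" and mat: "length mat = n * n" and J: "J (replicate n True) 0"
      and J_peel: "\<And>as i. J as i \<Longrightarrow> length as = n \<Longrightarrow> \<exists>v<n. as ! v \<Longrightarrow>
        J (peel mat n (\<beta> ^ i) as) (if peel mat n (\<beta> ^ i) as = as then Suc i else i)"
    let ?x = "replicate n True @ False # mat"
    let ?N = "length ?x"
    let ?\<sigma> = "\<lambda>v. if v = In then tape_at ?x 0 else tape_at [] 0"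
    have "achieves ?c ?\<sigma> (time_load (Suc L) ?N + time_cascade \<beta> a ?N [1..<L])
      (\<lambda>\<sigma>'. \<exists>y. fst (\<sigma>' Out) = word_contents y \<and> search_result mat n a L J 1 y)"
      unfolding approximation_program_def
    proof (rule achieves_Seq[OF achieves_load[where n = n and mat = mat]])
      fix \<sigma>' assume \<sigma>': "\<forall>v. v \<noteq> In \<longrightarrow> \<sigma>' v =
        (if v \<in> set (candidate_tapes (Suc L)) then tape_at (replicate n True) 0
         else if v \<in> set (matrix_tapes (Suc L)) then tape_at mat 0 else tape_at [] 0)"
      have cur: "\<sigma>' (Cur j) = tape_at (replicate n True) 0" "\<sigma>' (Iter j) = tape_at (replicate n True) 0"
        if "j \<le> L" for j using \<sigma>' that by auto
      have "scratch n 1 \<sigma>'" using cur[of 0] by (auto simp: scratch_def intro!: exI[of _ "replicate n True"])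
      moreover have "\<sigma>' v = tape_at [] 0" if "v \<in> {Out, Thr, Tmp, Flag, Changed, Alive}" for v
        using that \<sigma>' by auto
      ultimately have "fresh_from n mat L 1 \<sigma>'"
        unfolding fresh_from_def using \<sigma>' cur by (auto simp: flag_def)
      then show "achieves (cascade \<beta> a L [1..<L]) \<sigma>' (time_cascade \<beta> a ?N [1..<L])
        (\<lambda>\<sigma>'. \<exists>y. fst (\<sigma>' Out) = word_contents y \<and> search_result mat n a L J 1 y)"
        by (rule achieves_cascade) (use assms n mat J J_peel in auto)
    qed (use mat in auto)
    then obtain k \<sigma>' y where run: "exec ?c ?\<sigma> k \<sigma>'" "fst (\<sigma>' Out) = word_contents y"
        "search_result mat n a L J 1 y"
      and k: "k \<le> time_load (Suc L) ?N + time_cascade \<beta> a ?N [1..<L]"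
      unfolding achieves_def wp_def by blast
    have "computes_within (machine ?vs ?c) ?x (poly p ?N) y"
      by (rule computes_within_compile[OF run(1) order.trans[OF k p] uses_approximation_program distinct_all_tapes,
            where i = In and out = Out])
        (use run(2) in \<open>auto simp: all_tapes_def tape_at_def\<close>)
    with run(3) show "\<exists>y. computes_within (machine ?vs ?c) ?x (poly p ?N) y \<and>
        search_result mat n a L J 1 y" by blast
  qed
qed

section \<open>Treewidth is at least the minimum degree\<close>

definition linked :: "('b \<times> 'b) set \<Rightarrow> 'b set \<Rightarrow> bool" where
  "linked R S \<longleftrightarrow> (\<forall>a\<in>S. \<forall>b\<in>S. (a, b) \<in> (R \<inter> S \<times> S)\<^sup>*)"

text \<open>
  No path of at least three vertices closes up to a cycle. Walking back and forth along an edge is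
  excluded by distinctness, as is appropriate for a symmetric relation.
\<close>

definition acyclic_on :: "('b \<times> 'b) set \<Rightarrow> bool" where
  "acyclic_on R \<longleftrightarrow> (\<forall>x y zs. distinct (x # y # zs) \<longrightarrow> successively (\<lambda>a b. (a, b) \<in> R) (x # y # zs) \<longrightarrow>
     (\<forall>z\<in>set zs. (z, x) \<notin> R))"

text \<open>
  A path through a vertex with a single neighbour \<open>t'\<close> enters and leaves it via \<open>t'\<close>, so the detour can be
  cut out. In the induction, visits to \<open>t\<close> are accounted for by \<open>t'\<close>.
\<close>

lemma linked_remove_leaf:
  assumes "linked R S" "sym R"
    and leaf: "\<And>x. x \<in> S \<Longrightarrow> (t, x) \<in> R \<Longrightarrow> x = t'" "t' \<noteq> t"
  shows "linked R (S - {t})"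
  unfolding linked_def
proof (intro ballI)
  let ?R' = "(R \<inter> (S - {t}) \<times> (S - {t}))\<^sup>*"
  fix a b assume a: "a \<in> S - {t}" and b: "b \<in> S - {t}"
  \<comment> \<open>when the walk is at the leaf, its neighbour has been reached without the leaf\<close>
  have "(x \<noteq> t \<longrightarrow> (a, x) \<in> ?R') \<and> (x = t \<longrightarrow> (a, t') \<in> ?R')"
    if "(a, x) \<in> (R \<inter> S \<times> S)\<^sup>*" for x
    using that
  proof induction
    case base
    then show ?case using a by auto
  next
    case (step x y)
    then have xy: "(x, y) \<in> R" "x \<in> S" "y \<in> S" by auto
    show ?case
    proof (cases "x = t \<or> y = t")
      case False
      then have "(x, y) \<in> R \<inter> (S - {t}) \<times> (S - {t})" using xy by auto
      then show ?thesis using step.IH False by (auto intro: rtrancl_into_rtrancl)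
    next
      case True
      then show ?thesis
      proof
        assume "x = t"
        then have "y = t'" using leaf xy by auto
        then show ?thesis using step.IH \<open>x = t\<close> leaf(2) by auto
      next
        assume "y = t"
        then have "x = t'" using leaf xy \<open>sym R\<close> by (auto dest: symD)
        then show ?thesis using step.IH \<open>y = t\<close> leaf(2) by auto
      qed
    qed
  qed
  moreover have "(a, b) \<in> (R \<inter> S \<times> S)\<^sup>*" using assms(1) a b by (auto simp: linked_def)
  ultimately show "(a, b) \<in> ?R'" using b by blast
qed

lemma linked_neighbour:
  assumes "linked R S" "t \<in> S" "s \<in> S" "s \<noteq> t"
  shows "\<exists>x\<in>S. (t, x) \<in> R"
proof -
  have "(t, s) \<in> (R \<inter> S \<times> S)\<^sup>*" using assms by (auto simp: linked_def)
  then show ?thesis using \<open>s \<noteq> t\<close> by (cases rule: converse_rtranclE) auto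
qed

text \<open>
  The first vertex of a longest path is a leaf: a further neighbour off the path would prolong it, and
  one on the path would close a cycle.
\<close>

lemma exists_leaf:
  assumes "finite N" "linked R N" "sym R" "irrefl R" "acyclic_on R" "t0 \<in> N" "s0 \<in> N" "t0 \<noteq> s0"
  shows "\<exists>t\<in>N. \<exists>t'\<in>N. (t, t') \<in> R \<and> (\<forall>x\<in>N. (t, x) \<in> R \<longrightarrow> x = t')"
proof -
  let ?path = "\<lambda>xs. distinct xs \<and> set xs \<subseteq> N \<and> successively (\<lambda>a b. (a, b) \<in> R) xs"
  obtain s1 where s1: "s1 \<in> N" "(t0, s1) \<in> R" using linked_neighbour[OF assms(2), of t0 s0] assms by auto
  have "t0 \<noteq> s1" using s1 \<open>irrefl R\<close> by (auto simp: irrefl_def)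
  then have p0: "?path [t0, s1]" using s1 assms by simp
  have bound: "length xs < Suc (card N)" if "?path xs" for xs
    using that assms(1) by (metis card_mono distinct_card less_Suc_eq_le)
  define xs where "xs = (ARG_MAX length xs. ?path xs)"
  have xs: "?path xs" and max: "\<And>ys. ?path ys \<Longrightarrow> length ys \<le> length xs"
    using arg_max_nat_lemma[of ?path "[t0, s1]" length "Suc (card N)"] p0 bound unfolding xs_def by blast+
  have "2 \<le> length xs" using max[OF p0] by simp
  then obtain x y zs where xyz: "xs = x # y # zs"
    by (metis Suc_le_length_iff numeral_2_eq_2)
  have "u = y" if u: "u \<in> N" "(x, u) \<in> R" for u
  proof (rule ccontr)
    assume "u \<noteq> y"
    have ux: "(u, x) \<in> R" using u \<open>sym R\<close> by (auto dest: symD)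
    show False
    proof (cases "u \<in> set xs")
      case True
      moreover have "u \<noteq> x" using u \<open>irrefl R\<close> by (auto simp: irrefl_def)
      ultimately have "u \<in> set zs" using xyz \<open>u \<noteq> y\<close> by auto
      then show False using \<open>acyclic_on R\<close> xs ux unfolding xyz acyclic_on_def by blast
    next
      case False
      then have "?path (u # xs)" using xs u ux xyz by auto
      from max[OF this] show False by simp
    qed
  qed
  moreover have "x \<in> N" "y \<in> N" "(x, y) \<in> R" using xs xyz by auto
  ultimately show ?thesis by blast
qed

text \<open>
  By induction on the tree. Let \<open>t\<close> be a leaf with neighbour \<open>t'\<close>. If the bag of \<open>t\<close> is contained in that of
  \<open>t'\<close>, the leaf can be dropped. Otherwise some vertex \<open>v\<close> occurs in \<open>X t\<close> but not in \<open>X t'\<close>; its bags being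
  connected, it occurs in no other bag at all, so every edge at \<open>v\<close> is covered by \<open>X t\<close>.
\<close>

lemma bag_containing_neighbourhood:
  assumes "finite N" "N \<noteq> {}" "linked R N" "sym R" "irrefl R" "acyclic_on R"
    and "(\<Union>t\<in>N. X t) \<noteq> {}"
    and "\<And>u v. (u, v) \<in> E \<Longrightarrow> \<exists>t\<in>N. u \<in> X t \<and> v \<in> X t"
    and "\<And>v. linked R {t \<in> N. v \<in> X t}"
  shows "\<exists>v. \<exists>t\<in>N. v \<in> X t \<and> E `` {v} \<subseteq> X t"
  using assms(1-3,7-9)
proof (induction "card N" arbitrary: N rule: less_induct)
  case less
  note N = less.prems
  show ?case
  proof (cases "\<exists>t0\<in>N. \<exists>s0\<in>N. t0 \<noteq> s0")
    case False
    then obtain t where t: "N = {t}" using N(2) by blast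
    then obtain v where "v \<in> X t" using N(4) by auto
    moreover have "E `` {v} \<subseteq> X t" using N(5) t by auto
    ultimately show ?thesis using t by auto
  next
    case True
    then obtain t t' where t: "t \<in> N" "t' \<in> N" "(t, t') \<in> R" "\<And>x. x \<in> N \<Longrightarrow> (t, x) \<in> R \<Longrightarrow> x = t'"
      using exists_leaf[OF N(1,3) assms(4-6)] by metis
    have "t' \<noteq> t" using t(3) \<open>irrefl R\<close> unfolding irrefl_def by blast
    show ?thesis
    proof (cases "X t \<subseteq> X t'")
      case True
      have "\<exists>v. \<exists>s\<in>N - {t}. v \<in> X s \<and> E `` {v} \<subseteq> X s"
      proof (rule less.hyps)
        show "card (N - {t}) < card N" using N(1) t(1) by (intro psubset_card_mono) auto
        show "N - {t} \<noteq> {}" using t(2) \<open>t' \<noteq> t\<close> by auto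
        show "linked R (N - {t})"
          by (rule linked_remove_leaf[OF N(3) \<open>sym R\<close> t(4) \<open>t' \<noteq> t\<close>])
        have "(\<Union>s\<in>N - {t}. X s) = (\<Union>s\<in>N. X s)" using True t(1,2) \<open>t' \<noteq> t\<close> by blast
        then show "(\<Union>s\<in>N - {t}. X s) \<noteq> {}" using N(4) by simp
        show "\<exists>s\<in>N - {t}. u \<in> X s \<and> v \<in> X s" if uv: "(u, v) \<in> E" for u v
        proof -
          from N(5)[OF uv] obtain s where s: "s \<in> N" "u \<in> X s" "v \<in> X s" by blast
          then show ?thesis using True t(2) \<open>t' \<noteq> t\<close> by (cases "s = t") auto
        qed
        show "linked R {s \<in> N - {t}. v \<in> X s}" for v
        proof -
          have "{s \<in> N - {t}. v \<in> X s} = {s \<in> N. v \<in> X s} - {t}" by auto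
          moreover have "linked R ({s \<in> N. v \<in> X s} - {t})"
            by (rule linked_remove_leaf[OF N(6) \<open>sym R\<close> t(4) \<open>t' \<noteq> t\<close>]) simp_all
          ultimately show ?thesis by simp
        qed
      qed (use N in auto)
      then show ?thesis by blast
    next
      case False
      then obtain v where v: "v \<in> X t" "v \<notin> X t'" by blast
      have only: "s = t" if s: "s \<in> N" "v \<in> X s" for s
      proof (rule ccontr)
        assume "s \<noteq> t"
        have "\<exists>x\<in>{s \<in> N. v \<in> X s}. (t, x) \<in> R"
          by (rule linked_neighbour[OF N(6), where t = t and s = s]) (use s t(1) v \<open>s \<noteq> t\<close> in simp_all)
        then show False using t(4) v by blast
      qed
      have "E `` {v} \<subseteq> X t"
      proof
        fix u assume "u \<in> E `` {v}"
        then obtain s where "s \<in> N" "v \<in> X s" "u \<in> X s" using N(5) by blast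
        then show "u \<in> X t" using only by auto
      qed
      then show ?thesis using v t(1) by auto
    qed
  qed
qed

section \<open>Undirected trees as relations\<close>

lemma mk_symmetric_of_symmetric:
  assumes "sym (parcs T)"
  shows "mk_symmetric (with_proj T \<restriction> S) = \<lparr> pverts = S, parcs = parcs T \<inter> S \<times> S \<rparr>"
proof -
  have "(\<Union>e\<in>{e \<in> parcs T. fst e \<in> S \<and> snd e \<in> S}. {(fst e, snd e), (snd e, fst e)}) = parcs T \<inter> S \<times> S"
    using assms by (auto dest: symD)
  then show ?thesis by (simp add: mk_symmetric_def induce_subgraph_def)
qed

lemma rtrancl_on_restrict:
  assumes "a \<in> S"
  shows "(a, b) \<in> rtrancl_on S (R \<inter> S \<times> S) \<longleftrightarrow> (a, b) \<in> (R \<inter> S \<times> S)\<^sup>*" (is "?L \<longleftrightarrow> ?R")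
proof
  assume ?R
  then show ?L
  proof induction
    case base
    then show ?case using assms by (simp add: rtrancl_on_refl)
  next
    case (step y z)
    then show ?case by (auto intro: rtrancl_on_into_rtrancl_on)
  qed
qed (rule rtrancl_on_rtranclI)

lemma connected_restrict:
  assumes "sym (parcs T)"
  shows "Digraph_Component.connected (with_proj T \<restriction> S) \<longleftrightarrow> S \<noteq> {} \<and> linked (parcs T) S"
  unfolding Digraph_Component.connected_def strongly_connected_def mk_symmetric_of_symmetric[OF assms]
    linked_def reachable_def
  by (auto simp: rtrancl_on_restrict)

lemma simple_graphD:
  assumes "simple_graph G"
  shows "finite (pverts G)" "pverts G \<noteq> {}" "sym (parcs G)" "irrefl (parcs G)"
    "parcs G \<subseteq> pverts G \<times> pverts G"
proof -
  interpret pair_graph G using assms by (simp add: simple_graph_def)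
  show "finite (pverts G)" by (rule pair_finite_verts)
  show "pverts G \<noteq> {}" using assms by (simp add: simple_graph_def)
  show "sym (parcs G)" using pair_sym_arcs by (simp add: symmetric_def)
  show "irrefl (parcs G)" using pair_no_loops by (fastforce simp: irrefl_def)
  show "parcs G \<subseteq> pverts G \<times> pverts G" by (auto dest: in_arcsD1 in_arcsD2)
qed

lemma simple_graphI:
  assumes "finite (pverts G)" "pverts G \<noteq> {}" "sym (parcs G)" "irrefl (parcs G)"
    "parcs G \<subseteq> pverts G \<times> pverts G"
  shows "simple_graph G"
proof -
  have "finite (parcs G)" using assms finite_subset by blast
  then have "pair_graph G"
    using assms by unfold_locales (auto simp: symmetric_def irrefl_def)
  then show ?thesis using assms by (simp add: simple_graph_def)
qed

text \<open>
  A chord from a later vertex \<open>z\<close> of a path back to its first vertex \<open>x\<close> closes the part of the path up to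
  \<open>z\<close>, which has at least three vertices, to a cycle.
\<close>

lemma undirected_tree_acyclic:
  assumes "undirected_tree T"
  shows "acyclic_on (parcs T)"
  unfolding acyclic_on_def
proof (intro allI impI ballI notI)
  fix x y zs z
  assume dist: "distinct (x # y # zs)" and path: "successively (\<lambda>a b. (a, b) \<in> parcs T) (x # y # zs)"
    and z: "z \<in> set zs" "(z, x) \<in> parcs T"
  interpret pair_graph T using assms by (simp add: undirected_tree_def simple_graph_def)
  have walk: "\<exists>p. awalk u p w \<and> pawalk_verts u p = us @ [w]"
    if "successively (\<lambda>a b. (a, b) \<in> parcs T) (us @ [w])" "u = hd (us @ [w])" "us \<noteq> []" for u us w
    using that
  proof (induction us arbitrary: u)
    case (Cons a us)
    show ?case
    proof (cases us)
      case Nil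
      then have "(u, w) \<in> parcs T" "u = a" using Cons.prems by auto
      then show ?thesis using Nil
        by (intro exI[of _ "[(u, w)]"]) (auto simp: awalk_def dest: in_arcsD1)
    next
      case (Cons b us')
      then have ab: "(a, b) \<in> parcs T" "u = a" using Cons.prems by auto
      have "successively (\<lambda>a b. (a, b) \<in> parcs T) (us @ [w])" "b = hd (us @ [w])" "us \<noteq> []"
        using Cons.prems(1) Cons by simp_all
      from Cons.IH[OF this] obtain p where p: "awalk b p w" "pawalk_verts b p = us @ [w]" by blast
      then show ?thesis using ab
        by (intro exI[of _ "(a, b) # p"]) (auto simp: awalk_def dest: in_arcsD1)
    qed
  qed simp
  from z(1) obtain zs1 zs2 where zs: "zs = zs1 @ z # zs2" by (meson split_list)
  let ?us = "x # y # zs1 @ [z]"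
  have "successively (\<lambda>a b. (a, b) \<in> parcs T) (?us @ zs2)" using path zs by simp
  then have "successively (\<lambda>a b. (a, b) \<in> parcs T) ?us" unfolding successively_append_iff by blast
  then have "successively (\<lambda>a b. (a, b) \<in> parcs T) (?us @ [x])"
    unfolding successively_append_iff[of _ ?us] using z(2) by simp
  from walk[OF this] obtain p where p: "awalk x p x" "pawalk_verts x p = ?us @ [x]" by auto
  have "length (pawalk_verts x p) = Suc (length p)" for x and p :: "('b \<times> 'b) list"
    by (induction p arbitrary: x) auto
  from this[of x p] have "length p \<ge> 3" using p(2) by simp
  moreover have "cycle p" unfolding cycle_def
    using p dist zs \<open>length p \<ge> 3\<close> by (intro exI[of _ x]) auto
  ultimately show False using assms by (auto simp: undirected_tree_def)
qed

text \<open>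
  That some decomposition exists guarantees that the least width in the definition of treewidth is attained.
\<close>

lemma trivial_tree_decomposition:
  assumes "simple_graph G"
  shows "tree_decomposition G \<lparr> pverts = {t}, parcs = {} \<rparr> (\<lambda>_. pverts G)"
proof -
  let ?T = "\<lparr> pverts = {t}, parcs = {} \<rparr>"
  have T: "simple_graph ?T" by (rule simple_graphI) (auto simp: sym_def irrefl_def)
  have conn: "Digraph_Component.connected (with_proj ?T \<restriction> {t})"
    by (subst connected_restrict) (auto simp: sym_def linked_def)
  have "with_proj ?T \<restriction> {t} = with_proj ?T"
    by (simp add: induce_subgraph_def with_proj_def)
  with conn have "Digraph_Component.connected (with_proj ?T)" by (simp only:)
  then have "undirected_tree ?T"
    unfolding undirected_tree_def using T
    by (auto simp: pre_digraph.cycle_def pre_digraph.awalk_def neq_Nil_conv)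
  then show ?thesis
    using conn simple_graphD[OF assms] by (auto simp: tree_decomposition_def)
qed

text \<open>
  In a decomposition of least width, some bag contains a vertex and its at least \<open>d\<close> neighbours, hence
  has more than \<open>d\<close> elements.
\<close>

lemma minimum_degree_le_treewidth:
  fixes H :: "'a pair_pre_digraph"
  assumes H: "simple_graph H" and deg: "\<And>v. v \<in> pverts H \<Longrightarrow> d \<le> card {u. (v, u) \<in> parcs H}"
  shows "d \<le> treewidth H"
proof -
  have "\<exists>w. \<exists>(T :: nat pair_pre_digraph) X. tree_decomposition H T X \<and> decomposition_width T X = w"
    using trivial_tree_decomposition[OF H, of 0] by blast
  then have "\<exists>(T :: nat pair_pre_digraph) X. tree_decomposition H T X \<and> decomposition_width T X = treewidth H"
    unfolding treewidth_def by (rule LeastI_ex)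
  then obtain T :: "nat pair_pre_digraph" and X where
    TX: "tree_decomposition H T X" and width: "decomposition_width T X = treewidth H" by blast
  have tree: "undirected_tree T" and cover: "(\<Union>t\<in>pverts T. X t) = pverts H"
    and edges: "\<And>u v. (u, v) \<in> parcs H \<Longrightarrow> \<exists>t\<in>pverts T. u \<in> X t \<and> v \<in> X t"
    and subtrees: "\<And>v. v \<in> pverts H \<Longrightarrow>
      Digraph_Component.connected (with_proj T \<restriction> {t \<in> pverts T. v \<in> X t})"
    using TX by (auto simp: tree_decomposition_def)
  have T: "simple_graph T" and conn: "Digraph_Component.connected (with_proj T)"
    using tree by (auto simp: undirected_tree_def)
  note T' = simple_graphD[OF T] and H' = simple_graphD[OF H]
  have "with_proj T \<restriction> pverts T = with_proj T"
    using T'(5) by (auto simp: induce_subgraph_def with_proj_def)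
  then have linked_T: "linked (parcs T) (pverts T)"
    using conn connected_restrict[OF T'(3), of "pverts T"] by simp
  have linked_v: "linked (parcs T) {t \<in> pverts T. v \<in> X t}" for v
  proof (cases "v \<in> pverts H")
    case True
    then show ?thesis using subtrees connected_restrict[OF T'(3)] by blast
  next
    case False
    then have empty: "{t \<in> pverts T. v \<in> X t} = {}" using cover by auto
    show ?thesis unfolding empty linked_def by simp
  qed
  have nonempty: "(\<Union>t\<in>pverts T. X t) \<noteq> {}" using cover H'(2) by simp
  obtain v t where vt: "t \<in> pverts T" "v \<in> X t" "parcs H `` {v} \<subseteq> X t"
    using bag_containing_neighbourhood[OF T'(1,2) linked_T T'(3,4) undirected_tree_acyclic[OF tree]
        nonempty edges linked_v] by blast
  have fin: "finite (X t)" using vt(1) cover H'(1) by (metis UN_upper finite_subset)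
  have "v \<notin> parcs H `` {v}" using H'(4) by (auto simp: irrefl_def)
  have "d \<le> card (parcs H `` {v})"
    using deg[of v] vt cover by (auto simp: Image_def)
  also have "card (parcs H `` {v}) < card (insert v (parcs H `` {v}))"
    using \<open>v \<notin> _\<close> finite_subset[OF vt(3) fin] by simp
  also have "\<dots> \<le> card (X t)" using vt fin by (intro card_mono) auto
  also have "\<dots> \<le> Max ((\<lambda>t. card (X t)) ` pverts T)" using vt T'(1) by (intro Max_ge) auto
  finally show ?thesis using width by (simp add: decomposition_width_def)
qed

section \<open>Adjacency matrices and cliques\<close>

lemma nth_concat_rows:
  assumes "\<And>xs. xs \<in> set xss \<Longrightarrow> length xs = n" "v < length xss" "u < n"
  shows "concat xss ! (v * n + u) = xss ! v ! u"
  using assms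
proof (induction xss arbitrary: v)
  case (Cons xs xss)
  then show ?case by (cases v) (auto simp: nth_append add.assoc)
qed simp

definition adjacency_matrix :: "'a pair_pre_digraph \<Rightarrow> 'a list \<Rightarrow> bool list" where
  "adjacency_matrix G vs = concat (map (\<lambda>u. map (\<lambda>v. (u, v) \<in> parcs G) vs) vs)"

lemma length_adjacency_matrix: "length (adjacency_matrix G vs) = length vs * length vs"
proof -
  have "length (concat (map (\<lambda>u. map (\<lambda>v. (u, v) \<in> parcs G) vs) us)) = length us * length vs" for us
    by (induction us) auto
  then show ?thesis by (simp add: adjacency_matrix_def)
qed

lemma adjacency_matrix_nth:
  assumes "v < length vs" "u < length vs"
  shows "adjacency_matrix G vs ! (v * length vs + u) \<longleftrightarrow> (vs ! v, vs ! u) \<in> parcs G"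
  unfolding adjacency_matrix_def using assms by (subst nth_concat_rows) auto

lemma graph_code_eq:
  "graph_code G vs = replicate (length vs) True @ False # adjacency_matrix G vs"
  by (simp add: graph_code_def adjacency_matrix_def)

text \<open>
  Irreflexivity keeps \<open>v\<close> out of the clique found among its neighbours, so that adding \<open>v\<close> increases the
  size; symmetry makes the enlarged set a clique in both directions.
\<close>

lemma has_clique_iff:
  assumes sym: "\<And>u v. u < n \<Longrightarrow> v < n \<Longrightarrow> mat ! (u * n + v) \<Longrightarrow> mat ! (v * n + u)"
    and irrefl: "\<And>v. v < n \<Longrightarrow> \<not> mat ! (v * n + v)"
  shows "has_clique mat n l as \<longleftrightarrow> (\<exists>C. C \<subseteq> {v. v < n \<and> as ! v} \<and> card C = l \<and>
    (\<forall>u\<in>C. \<forall>v\<in>C. u \<noteq> v \<longrightarrow> mat ! (u * n + v)))"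
proof (induction l arbitrary: as)
  case 0
  then show ?case by (auto intro!: exI[of _ "{}"])
next
  case (Suc l)
  let ?new = "\<lambda>v. map (\<lambda>u. as ! u \<and> mat ! (v * n + u)) [0..<n]"
  have new: "{u. u < n \<and> ?new v ! u} = {u. u < n \<and> as ! u \<and> mat ! (v * n + u)}" for v by auto
  show ?case
  proof
    assume "has_clique mat n (Suc l) as"
    then obtain v C where v: "v < n" "as ! v" and C: "C \<subseteq> {u. u < n \<and> as ! u \<and> mat ! (v * n + u)}"
        "card C = l" "\<forall>u\<in>C. \<forall>v\<in>C. u \<noteq> v \<longrightarrow> mat ! (u * n + v)"
      unfolding has_clique.simps Suc.IH new by blast
    have "v \<notin> C" using C(1) irrefl v by blast
    moreover have "finite C" using C(1) finite_subset by fastforce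
    ultimately have "card (insert v C) = Suc l" using C(2) by simp
    moreover have "insert v C \<subseteq> {v. v < n \<and> as ! v}" using C(1) v by auto
    moreover have "\<forall>u\<in>insert v C. \<forall>w\<in>insert v C. u \<noteq> w \<longrightarrow> mat ! (u * n + w)"
      using C(1,3) sym[OF v(1)] by blast
    ultimately show "\<exists>C. C \<subseteq> {v. v < n \<and> as ! v} \<and> card C = Suc l \<and>
      (\<forall>u\<in>C. \<forall>v\<in>C. u \<noteq> v \<longrightarrow> mat ! (u * n + v))" by blast
  next
    assume "\<exists>C. C \<subseteq> {v. v < n \<and> as ! v} \<and> card C = Suc l \<and>
      (\<forall>u\<in>C. \<forall>v\<in>C. u \<noteq> v \<longrightarrow> mat ! (u * n + v))"
    then obtain C where C: "C \<subseteq> {v. v < n \<and> as ! v}" "card C = Suc l"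
        "\<forall>u\<in>C. \<forall>v\<in>C. u \<noteq> v \<longrightarrow> mat ! (u * n + v)" by blast
    then obtain v where v: "v \<in> C" by (metis card.empty ex_in_conv nat.distinct(1))
    have "finite C" using C(2) by (metis card.infinite nat.distinct(1))
    then have "card (C - {v}) = l" using C(2) v by simp
    moreover have "C - {v} \<subseteq> {u. u < n \<and> as ! u \<and> mat ! (v * n + u)}"
    proof
      fix u assume u: "u \<in> C - {v}"
      then have "mat ! (v * n + u)" using C(3) v by (metis DiffE singletonI)
      then show "u \<in> {u. u < n \<and> as ! u \<and> mat ! (v * n + u)}" using C(1) u by auto
    qed
    moreover have "\<forall>u\<in>C - {v}. \<forall>w\<in>C - {v}. u \<noteq> w \<longrightarrow> mat ! (u * n + w)" using C(3) by blast
    ultimately have "has_clique mat n l (?new v)" unfolding Suc.IH new by blast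
    then show "has_clique mat n (Suc l) as" using C(1) v by auto
  qed
qed

lemma clique_number_props:
  assumes "simple_graph G"
  shows "clique G C \<Longrightarrow> card C \<le> clique_number G"
    and "\<exists>C. clique G C \<and> card C = clique_number G"
    and "1 \<le> clique_number G"
proof -
  note G = simple_graphD[OF assms]
  have "{C. clique G C} \<subseteq> Pow (pverts G)" by (auto simp: clique_def)
  then have fin: "finite (card ` {C. clique G C})" using G(1) by (simp add: finite_subset)
  show le: "card C \<le> clique_number G" if "clique G C" for C
    unfolding clique_number_def using fin that by (intro Max_ge) auto
  have "clique G {}" by (simp add: clique_def)
  then have "clique_number G \<in> card ` {C. clique G C}"
    unfolding clique_number_def using fin by (intro Max_in) auto
  then show "\<exists>C. clique G C \<and> card C = clique_number G" by auto
  obtain v where "v \<in> pverts G" using G(2) by blast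
  then have "clique G {v}" by (simp add: clique_def)
  from le[OF this] show "1 \<le> clique_number G" by simp
qed

definition induced :: "'a pair_pre_digraph \<Rightarrow> 'a set \<Rightarrow> 'a pair_pre_digraph" where
  "induced G S = \<lparr> pverts = S, parcs = parcs G \<inter> S \<times> S \<rparr>"

lemma induced_props:
  assumes "simple_graph G" "S \<subseteq> pverts G" "S \<noteq> {}"
  shows "simple_graph (induced G S)"
    and "induced_subgraph (with_proj (induced G S)) (with_proj G)"
proof -
  note G = simple_graphD[OF assms(1)]
  show simple: "simple_graph (induced G S)"
    by (rule simple_graphI)
      (use G assms finite_subset[OF assms(2) G(1)] in \<open>auto simp: induced_def sym_def irrefl_def\<close>)
  then have "wf_digraph (with_proj (induced G S))" "wf_digraph (with_proj G)"
    using assms(1) by (auto simp: wf_digraph_wp_iff simple_graph_def pair_graph_def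
        pair_digraph_def pair_fin_digraph_def)
  then show "induced_subgraph (with_proj (induced G S)) (with_proj G)"
    using assms by (auto simp: induced_subgraph_def subgraph_def compatible_def induced_def)
qed

lemma clique_number_induced:
  assumes "simple_graph G" "S \<subseteq> pverts G" "S \<noteq> {}"
  shows "clique_number (induced G S) \<le> clique_number G"
proof -
  obtain C where C: "clique (induced G S) C" "card C = clique_number (induced G S)"
    using clique_number_props(2)[OF induced_props(1)[OF assms]] by blast
  then have "clique G C" using assms(2) by (auto simp: clique_def induced_def)
  from clique_number_props(1)[OF assms(1) this] C(2) show ?thesis by simp
qed

lemma induced_degree_le_treewidth:
  assumes "simple_graph G" "S \<subseteq> pverts G" "S \<noteq> {}"
    and "\<And>v. v \<in> S \<Longrightarrow> d \<le> card {u \<in> S. (v, u) \<in> parcs G}"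
  shows "d \<le> treewidth (induced G S)"
proof (rule minimum_degree_le_treewidth[OF induced_props(1)[OF assms(1-3)]])
  fix v assume v: "v \<in> pverts (induced G S)"
  then have "{u. (v, u) \<in> parcs (induced G S)} = {u \<in> S. (v, u) \<in> parcs G}"
    by (auto simp: induced_def)
  then show "d \<le> card {u. (v, u) \<in> parcs (induced G S)}" using assms(4) v by (simp add: induced_def)
qed

section \<open>What the machine computes\<close>

lemma inj_on_nth: "distinct vs \<Longrightarrow> I \<subseteq> {..<length vs} \<Longrightarrow> inj_on ((!) vs) I"
  by (rule inj_onI) (simp add: nth_eq_iff_index_eq subset_iff)

lemma has_clique_adjacency_matrix:
  assumes G: "simple_graph G" and vs: "distinct vs" "set vs = pverts G"
  shows "has_clique (adjacency_matrix G vs) (length vs) l (replicate (length vs) True) \<longleftrightarrow>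
    l \<le> clique_number G"
proof -
  let ?n = "length vs" and ?mat = "adjacency_matrix G vs"
  note G' = simple_graphD[OF G]
  have "has_clique ?mat ?n l (replicate ?n True) \<longleftrightarrow>
    (\<exists>C. C \<subseteq> {v. v < ?n \<and> replicate ?n True ! v} \<and> card C = l \<and>
      (\<forall>u\<in>C. \<forall>v\<in>C. u \<noteq> v \<longrightarrow> ?mat ! (u * ?n + v)))"
    by (rule has_clique_iff) (use G'(3,4) in \<open>auto simp: adjacency_matrix_nth irrefl_def dest: symD\<close>)
  also have "\<dots> \<longleftrightarrow> (\<exists>C\<subseteq>{..<?n}. card C = l \<and> (\<forall>u\<in>C. \<forall>v\<in>C. u \<noteq> v \<longrightarrow> (vs ! u, vs ! v) \<in> parcs G))"
    (is "?L \<longleftrightarrow> ?R")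
    by (intro ex_cong1 conj_cong) (auto simp: adjacency_matrix_nth subset_iff)
  also have "?R \<longleftrightarrow> l \<le> clique_number G"
  proof
    assume ?R
    then obtain C where C: "C \<subseteq> {..<?n}" "card C = l"
      "\<forall>u\<in>C. \<forall>v\<in>C. u \<noteq> v \<longrightarrow> (vs ! u, vs ! v) \<in> parcs G" by blast
    have "(!) vs ` C \<subseteq> pverts G" unfolding vs(2)[symmetric] using C(1) by auto
    then have "clique G ((!) vs ` C)" using C by (auto simp: clique_def)
    moreover have "card ((!) vs ` C) = l" using C inj_on_nth[OF vs(1)] by (simp add: card_image)
    ultimately show "l \<le> clique_number G" using clique_number_props(1)[OF G] by metis
  next
    assume l: "l \<le> clique_number G"
    obtain D where D: "clique G D" "card D = clique_number G" using clique_number_props(2)[OF G] by blast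
    obtain D' where D': "D' \<subseteq> D" "card D' = l" using l D(2) obtain_subset_with_card_n by metis
    let ?C = "{v. v < ?n \<and> vs ! v \<in> D'}"
    have "D' \<subseteq> set vs" using D(1) D'(1) vs by (auto simp: clique_def)
    then have "(!) vs ` ?C = D'" by (force simp: in_set_conv_nth image_def)
    moreover have "inj_on ((!) vs) ?C" by (rule inj_on_nth[OF vs(1)]) auto
    ultimately have "card ?C = l" using D'(2) card_image by metis
    moreover have "\<forall>u\<in>?C. \<forall>v\<in>?C. u \<noteq> v \<longrightarrow> (vs ! u, vs ! v) \<in> parcs G"
      using D(1) D'(1) vs by (auto simp: clique_def nth_eq_iff_index_eq subset_iff)
    ultimately show ?R by (intro exI[of _ ?C]) auto
  qed
  finally show ?thesis .
qed

text \<open>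
  The first part yields \<open>\<omega> \<le> \<beta> ^ i\<close> once no vertex remains. The second part records, after the threshold
  has been raised to \<open>\<beta> ^ i\<close>, the subgraph that was stable under the previous threshold \<open>\<beta> ^ (i - 1)\<close>.
\<close>

definition peeling_invariant :: "'a pair_pre_digraph \<Rightarrow> 'a list \<Rightarrow> nat \<Rightarrow> bool list \<Rightarrow> nat \<Rightarrow> bool" where
  "peeling_invariant G vs \<beta> as i \<longleftrightarrow>
     (\<forall>C. clique G C \<and> \<beta> ^ i < card C \<longrightarrow> C \<subseteq> {vs ! v | v. v < length vs \<and> as ! v}) \<and>
     (0 < i \<longrightarrow> (\<exists>S\<subseteq>pverts G. S \<noteq> {} \<and> (\<forall>v\<in>S. \<beta> ^ (i - 1) \<le> card {u \<in> S. (v, u) \<in> parcs G})))"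

lemma alive_degree_eq:
  assumes "distinct vs" "set vs = pverts G" "v < length vs"
  shows "alive_degree (adjacency_matrix G vs) (length vs) as v =
    card {u \<in> {vs ! w | w. w < length vs \<and> as ! w}. (vs ! v, u) \<in> parcs G}"
proof -
  let ?I = "{u. u < length vs \<and> as ! u \<and> (vs ! v, vs ! u) \<in> parcs G}"
  have "alive_degree (adjacency_matrix G vs) (length vs) as v = card ?I"
    unfolding alive_degree_def
    by (rule arg_cong[where f = card]) (use assms in \<open>auto simp: adjacency_matrix_nth\<close>)
  also have "\<dots> = card ((!) vs ` ?I)"
    by (rule card_image[symmetric], rule inj_on_nth[OF assms(1)]) auto
  also have "(!) vs ` ?I = {u \<in> {vs ! w | w. w < length vs \<and> as ! w}. (vs ! v, u) \<in> parcs G}"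
    by auto
  finally show ?thesis .
qed

text \<open>
  A vertex of a clique with more than \<open>\<beta> ^ i\<close> members has at least \<open>\<beta> ^ i\<close> neighbours in the clique, so it
  is kept. If the round changes nothing, every remaining vertex has at least \<open>\<beta> ^ i\<close> remaining
  neighbours, and the remaining vertices witness the second part for \<open>i + 1\<close>.
\<close>

lemma peeling_invariant_peel:
  assumes G: "simple_graph G" and vs: "distinct vs" "set vs = pverts G"
    and \<beta>: "2 \<le> \<beta>"
    and inv: "peeling_invariant G vs \<beta> as i" and alive: "\<exists>v<length vs. as ! v"
  defines "new \<equiv> peel (adjacency_matrix G vs) (length vs) (\<beta> ^ i) as"
  shows "peeling_invariant G vs \<beta> new (if new = as then Suc i else i)"
proof -
  let ?A = "\<lambda>as. {vs ! v | v. v < length vs \<and> as ! v}"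
  let ?N = "\<lambda>v. {u \<in> ?A as. (v, u) \<in> parcs G}"
  have new_alive: "new ! v \<longleftrightarrow> as ! v \<and> \<beta> ^ i \<le> card (?N (vs ! v))" if "v < length vs" for v
    using that vs by (simp add: new_def peel_def alive_degree_eq)
  have cliques: "C \<subseteq> ?A new" if C: "clique G C" "\<beta> ^ i < card C" for C
  proof
    fix x assume x: "x \<in> C"
    have sub: "C \<subseteq> ?A as" using inv C unfolding peeling_invariant_def by blast
    then obtain v where v: "x = vs ! v" "v < length vs" "as ! v" using x by auto
    have "C - {x} \<subseteq> ?N x" using sub C(1) x by (auto simp: clique_def)
    then have "card (C - {x}) \<le> card (?N x)" by (rule card_mono[rotated]) simp
    moreover have "finite C" using C(2) by (metis card.infinite not_less0)
    ultimately have "\<beta> ^ i \<le> card (?N x)" using C(2) x by simp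
    then show "x \<in> ?A new" using v new_alive by auto
  qed
  show ?thesis
  proof (cases "new = as")
    case False
    then show ?thesis using inv cliques unfolding peeling_invariant_def by simp
  next
    case True
    have "\<beta> ^ i \<le> \<beta> ^ Suc i" using \<beta> by simp
    then have 1: "C \<subseteq> ?A new" if "clique G C" "\<beta> ^ Suc i < card C" for C
      using cliques[of C] that by linarith
    have 2: "?A as \<subseteq> pverts G" unfolding vs(2)[symmetric] by auto
    have 3: "?A as \<noteq> {}" using alive by auto
    have 4: "\<forall>v\<in>?A as. \<beta> ^ i \<le> card (?N v)" using new_alive True by auto
    have "peeling_invariant G vs \<beta> new (Suc i)"
      unfolding peeling_invariant_def using 1 2 3 4
      by (intro conjI allI impI exI[of _ "?A as"]) auto
    then show ?thesis using True by simp
  qed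
qed

lemma binary_two_power: "binary (2 ^ j) = replicate j False @ [True]"
proof (induction j)
  case 0
  have "binary 0 = []" by (subst binary.simps) simp
  then show ?case by (subst binary.simps) simp
next
  case (Suc j)
  then show ?case by (subst binary.simps) simp
qed

text \<open>
  The second alternative for \<open>s\<close> is a two-sided estimate of the degeneracy within the constant factor
  \<open>2 ^ b\<close>, raised to the power \<open>a/b\<close>.
\<close>

lemma degeneracy_machine:
  fixes a b k0 :: nat
  assumes "0 < b"
  obtains M and p :: "nat poly" where "valid_machine M"
    and "\<And>(G :: 'a pair_pre_digraph) vs. simple_graph G \<Longrightarrow> distinct vs \<Longrightarrow> set vs = pverts G \<Longrightarrow>
      \<exists>s. computes_within M (graph_code G vs) (poly p (length (graph_code G vs))) (binary s) \<and>
        (s = clique_number G \<or>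
         k0 \<le> clique_number G \<and> (\<exists>i. s = 2 ^ (a * i) \<and> clique_number G \<le> (2 ^ b) ^ i \<and>
           (0 < i \<longrightarrow> (\<exists>S\<subseteq>pverts G. S \<noteq> {} \<and> (2 ^ b) ^ (i - 1) \<le> treewidth (induced G S)))))"
proof -
  let ?\<beta> = "2 ^ b :: nat"
  have \<beta>: "2 \<le> ?\<beta>" using assms by (cases b) auto
  obtain M and p :: "nat poly" where M: "valid_machine M"
    and run: "\<And>n mat J. 0 < n \<Longrightarrow> length mat = n * n \<Longrightarrow> J (replicate n True) 0 \<Longrightarrow>
      (\<And>as i. J as i \<Longrightarrow> length as = n \<Longrightarrow> \<exists>v<n. as ! v \<Longrightarrow>
        J (peel mat n (?\<beta> ^ i) as) (if peel mat n (?\<beta> ^ i) as = as then Suc i else i)) \<Longrightarrow>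
      \<exists>y. computes_within M (replicate n True @ False # mat)
            (poly p (length (replicate n True @ False # mat))) y \<and>
          search_result mat n a (Suc k0) J 1 y"
    by (rule approximation_machine[OF \<beta>, of "Suc k0" a]) auto
  show ?thesis
  proof (rule that[OF M])
    fix G :: "'a pair_pre_digraph" and vs
    assume G: "simple_graph G" and vs: "distinct vs" "set vs = pverts G"
    let ?n = "length vs" and ?mat = "adjacency_matrix G vs" and ?J = "peeling_invariant G vs ?\<beta>"
    note has = has_clique_adjacency_matrix[OF G vs]
    have "pverts G = {vs ! v | v. v < ?n}" unfolding vs(2)[symmetric] by (rule set_conv_nth)
    also have "\<dots> = {vs ! v | v. v < ?n \<and> replicate ?n True ! v}" by auto
    finally have J0: "?J (replicate ?n True) 0" unfolding peeling_invariant_def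
      by (simp add: clique_def)
    have "0 < ?n" using simple_graphD(2)[OF G] vs(2) by auto
    from run[where J = ?J, OF this length_adjacency_matrix J0 peeling_invariant_peel[OF G vs \<beta>]]
    obtain y where y: "computes_within M (graph_code G vs) (poly p (length (graph_code G vs))) y"
      and res: "search_result ?mat ?n a (Suc k0) ?J 1 y"
      unfolding graph_code_eq by blast
    from res consider
        (exact) j where "j \<in> {1..<Suc k0}" "\<not> j \<le> clique_number G"
          "\<forall>i\<in>{1..<j}. i \<le> clique_number G" "y = binary (j - 1)"
      | (peeled) as i where "\<forall>i\<in>{1..<Suc k0}. i \<le> clique_number G" "?J as i"
          "\<not> (\<exists>v<?n. as ! v)" "y = replicate (a * i) False @ [True]"
      unfolding search_result_def has by blast
    then show "\<exists>s. computes_within M (graph_code G vs) (poly p (length (graph_code G vs))) (binary s) \<and>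
        (s = clique_number G \<or>
         k0 \<le> clique_number G \<and> (\<exists>i. s = 2 ^ (a * i) \<and> clique_number G \<le> ?\<beta> ^ i \<and>
           (0 < i \<longrightarrow> (\<exists>S\<subseteq>pverts G. S \<noteq> {} \<and> ?\<beta> ^ (i - 1) \<le> treewidth (induced G S)))))"
    proof cases
      case exact
      have "j - 1 \<le> clique_number G" using exact(1,3) by (cases "j = 1") auto
      then have "clique_number G = j - 1" using exact(2) by simp
      then show ?thesis using y exact(4) by (intro exI[of _ "clique_number G"]) simp
    next
      case peeled
      have k0: "k0 \<le> clique_number G" using peeled(1) by (cases k0) auto
      obtain C where C: "clique G C" "card C = clique_number G" using clique_number_props(2)[OF G] by blast
      have "clique_number G \<le> ?\<beta> ^ i"
      proof (rule ccontr)
        assume big: "\<not> clique_number G \<le> ?\<beta> ^ i"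
        then have "C \<subseteq> {vs ! v | v. v < ?n \<and> as ! v}"
          using peeled(2) C unfolding peeling_invariant_def by (simp add: not_le)
        then have "C = {}" using peeled(3) by auto
        then show False using C(2) big by simp
      qed
      moreover have "\<exists>S\<subseteq>pverts G. S \<noteq> {} \<and> ?\<beta> ^ (i - 1) \<le> treewidth (induced G S)" if i: "0 < i"
      proof -
        obtain S where S: "S \<subseteq> pverts G" "S \<noteq> {}"
          "\<And>v. v \<in> S \<Longrightarrow> ?\<beta> ^ (i - 1) \<le> card {u \<in> S. (v, u) \<in> parcs G}"
          using peeled(2) i unfolding peeling_invariant_def by blast
        from induced_degree_le_treewidth[OF G this] S(1,2) show ?thesis by blast
      qed
      moreover have "y = binary (2 ^ (a * i))" using peeled(4) by (simp add: binary_two_power)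
      ultimately show ?thesis using y k0 by (intro exI[of _ "2 ^ (a * i)"]) auto
    qed
  qed
qed

section \<open>The approximation factor\<close>

text \<open>
  Apply the binding function to the subgraph induced by a maximum clique: its clique number is that of
  \<open>G\<close>, and its minimum degree is one less.
\<close>

lemma clique_number_le_binding:
  assumes G: "simple_graph G" "G \<in> \<G>" and bind: "tw_omega_binding f \<G>"
  shows "clique_number G \<le> f (clique_number G) + 1"
proof -
  obtain C where C: "clique G C" "card C = clique_number G" using clique_number_props(2)[OF G(1)] by blast
  have ne: "C \<noteq> {}" using C(2) clique_number_props(3)[OF G(1)] by auto
  have sub: "C \<subseteq> pverts G" using C(1) by (simp add: clique_def)
  have fin: "finite C" using sub simple_graphD(1)[OF G(1)] finite_subset by blast
  let ?H = "induced G C"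
  have "clique ?H C" using C(1) by (auto simp: clique_def induced_def)
  then have "clique_number ?H = clique_number G"
    using clique_number_props(1)[OF induced_props(1)[OF G(1) sub ne]] C(2)
      clique_number_induced[OF G(1) sub ne] by (metis le_antisym)
  moreover have "clique_number G - 1 \<le> treewidth ?H"
  proof (rule induced_degree_le_treewidth[OF G(1) sub ne])
    fix v assume v: "v \<in> C"
    then have "C - {v} \<subseteq> {u \<in> C. (v, u) \<in> parcs G}" using C(1) by (auto simp: clique_def)
    then have "card (C - {v}) \<le> card {u \<in> C. (v, u) \<in> parcs G}" using fin by (intro card_mono) auto
    then show "clique_number G - 1 \<le> card {u \<in> C. (v, u) \<in> parcs G}" using v fin C(2) by simp
  qed
  moreover have "treewidth ?H \<le> f (clique_number ?H)"
    using bind G(2) induced_props(2)[OF G(1) sub ne] ne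
    unfolding tw_omega_binding_def by (simp add: induced_def)
  ultimately show ?thesis by simp
qed

text \<open>
  The finitely many values before the asymptotic estimate sets in are absorbed by adding all their
  quotients to the constant. The estimate is needed for all \<open>k\<close> because it is applied to subgraphs,
  whose clique number may be small.
\<close>

lemma bigo_powr_bound:
  fixes f :: "nat \<Rightarrow> nat"
  assumes "(\<lambda>k. real (f k)) \<in> O(\<lambda>k. real k powr c)"
  obtains K where "1 \<le> K" "\<And>k. 1 \<le> k \<Longrightarrow> real (f k) \<le> K * real k powr c"
proof -
  from landau_o.bigE[OF assms] obtain C where
    C: "0 < C" "eventually (\<lambda>k. norm (real (f k)) \<le> C * norm (real k powr c)) at_top" by blast
  then obtain m where m: "\<And>k. m \<le> k \<Longrightarrow> real (f k) \<le> C * real k powr c"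
    by (auto simp: eventually_at_top_linorder)
  let ?g = "\<lambda>k. real (f k) / real k powr c"
  \<comment> \<open>the summand \<open>1\<close> makes the constant at least \<open>1\<close>\<close>
  let ?K = "1 + C + (\<Sum>k<m. ?g k)"
  have nonneg: "0 \<le> (\<Sum>k<m. ?g k)" by (intro sum_nonneg) simp
  show ?thesis
  proof (rule that[of ?K])
    show "1 \<le> ?K" using C(1) nonneg by linarith
    fix k :: nat assume k: "1 \<le> k"
    then have pos: "0 < real k powr c" by simp
    have "?g k \<le> ?K"
    proof (cases "k < m")
      case True
      then have "?g k \<le> (\<Sum>k<m. ?g k)" by (intro member_le_sum) auto
      then show ?thesis using C(1) by linarith
    next
      case False
      then have "?g k \<le> C" using m[of k] pos by (simp add: divide_le_eq)
      then show ?thesis using nonneg by linarith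
    qed
    then show "real (f k) \<le> ?K * real k powr c" using pos by (simp add: divide_le_eq)
  qed
qed

lemma sublinear_powr:
  assumes "q < (1 :: real)"
  shows "eventually (\<lambda>k :: nat. D * real k powr q < real k - 1) at_top"
  using assms by real_asymp

lemma rational_between:
  fixes x y :: real
  assumes "0 \<le> x" "x < y"
  obtains a b :: nat where "0 < b" "x < a / b" "a / b < y"
proof -
  obtain r where r: "r \<in> \<rat>" "x < r" "r < y" using Rats_dense_in_real[OF assms(2)] by blast
  obtain a b :: nat where "b \<noteq> 0" "\<bar>r\<bar> = real a / real b" using Rats_abs_nat_div_natE[OF r(1)] by metis
  with r assms(1) show ?thesis by (intro that[of b a]) auto
qed

text \<open>
  Since \<open>2 ^ (a * i)\<close> is the threshold \<open>(2 ^ b) ^ i\<close> to the power \<open>a/b\<close>, the two bounds on the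
  threshold turn into bounds on the output. In the upper one the step from \<open>i - 1\<close> to \<open>i\<close> costs the factor
  \<open>2 ^ b\<close>, which the premise \<open>large\<close> absorbs.
\<close>

lemma approximation_guarantee:
  fixes \<epsilon> c K :: real
  assumes \<epsilon>: "0 < \<epsilon>" and c: "1 \<le> c"
    and r: "1 / (c + \<epsilon>) < a / b" "0 < b"
    and large: "(2 ^ b * K) powr (a / b) * real \<omega> powr (c * (a / b)) < real \<omega> - 1"
    and \<omega>: "1 \<le> \<omega>" "\<omega> \<le> (2 ^ b) ^ i"
    and upper: "0 < i \<Longrightarrow> real ((2 ^ b) ^ (i - 1)) \<le> K * real \<omega> powr c"
    and K: "1 \<le> K"
  shows "real \<omega> / max 1 (real \<omega> powr (1 - 1 / (c + \<epsilon>))) \<le> real (2 ^ (a * i))"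
    and "2 ^ (a * i) \<le> \<omega>"
proof -
  let ?r = "real a / real b"
  have s: "real (2 ^ (a * i)) = real ((2 ^ b) ^ i) powr ?r"
    using r(2) by (simp add: powr_realpow[symmetric] powr_powr power_mult[symmetric] mult.commute)
  have "real \<omega> / max 1 (real \<omega> powr (1 - 1 / (c + \<epsilon>))) \<le> real \<omega> / real \<omega> powr (1 - 1 / (c + \<epsilon>))"
    using \<omega>(1) by (intro divide_left_mono) auto
  also have "\<dots> = real \<omega> powr (1 / (c + \<epsilon>))"
    using \<omega>(1) by (simp add: powr_diff powr_one)
  also have "\<dots> \<le> real \<omega> powr ?r" using \<omega>(1) r(1) by (intro powr_mono) auto
  also have "\<dots> \<le> real ((2 ^ b) ^ i) powr ?r" using \<omega>(2) by (intro powr_mono2) (auto simp flip: of_nat_power)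
  finally show "real \<omega> / max 1 (real \<omega> powr (1 - 1 / (c + \<epsilon>))) \<le> real (2 ^ (a * i))" using s by simp
  show "2 ^ (a * i) \<le> \<omega>"
  proof (cases "i = 0")
    case True
    then show ?thesis using \<omega>(1) by simp
  next
    case False
    then have "(2 ^ b :: real) ^ i = 2 ^ b * (2 ^ b) ^ (i - 1)" by (simp add: power_eq_if)
    also have "\<dots> \<le> 2 ^ b * (K * real \<omega> powr c)"
      using upper False by (intro mult_left_mono) auto
    finally have le: "(2 ^ b :: real) ^ i \<le> 2 ^ b * K * real \<omega> powr c" by (simp add: mult.assoc)
    have "real (2 ^ (a * i)) = ((2 ^ b :: real) ^ i) powr ?r" using s by simp
    also have "\<dots> \<le> (2 ^ b * K * real \<omega> powr c) powr ?r" using le by (intro powr_mono2) auto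
    also have "\<dots> = (2 ^ b * K) powr ?r * real \<omega> powr (c * ?r)"
      using K by (simp add: powr_mult powr_powr)
    also have "\<dots> < real \<omega> - 1" by (fact large)
    finally have "real (2 ^ (a * i)) \<le> real \<omega>" by linarith
    then show ?thesis by (simp only: of_nat_le_iff)
  qed
qed

theorem theorem6p4:
  fixes \<G> :: "'a pair_pre_digraph set" and f :: "nat \<Rightarrow> nat" and c :: real
  assumes "\<forall>G\<in>\<G>. simple_graph G"
    and "computable f"
    and "tw_omega_binding f \<G>"
    and "(\<lambda>k. real (f k)) \<in> O(\<lambda>k. real k powr c)"
  shows "\<forall>\<epsilon>>0. clique_number_poly_time_approximable \<G>
           (\<lambda>opt. real opt powr (1 - 1 / (c + \<epsilon>)))"
proof (intro allI impI)
  fix \<epsilon> :: real assume \<epsilon>: "0 < \<epsilon>"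
  let ?\<rho> = "\<lambda>opt. real opt powr (1 - 1 / (c + \<epsilon>))"
  obtain K where K: "1 \<le> K" and f_le: "\<And>k. 1 \<le> k \<Longrightarrow> real (f k) \<le> K * real k powr c"
    using bigo_powr_bound[OF assms(4)] by blast
  have exact: "real \<omega> / max 1 (?\<rho> \<omega>) \<le> real \<omega>" for \<omega> :: nat
    by (simp add: divide_le_eq mult_le_cancel_left1)
  have approximable: "clique_number_poly_time_approximable \<G> ?\<rho>"
    if b: "0 < b" and good: "\<And>G i. G \<in> \<G> \<Longrightarrow> k0 \<le> clique_number G \<Longrightarrow> clique_number G \<le> (2 ^ b) ^ i \<Longrightarrow>
      (0 < i \<Longrightarrow> \<exists>S\<subseteq>pverts G. S \<noteq> {} \<and> (2 ^ b) ^ (i - 1) \<le> treewidth (induced G S)) \<Longrightarrow>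
      real (clique_number G) / max 1 (?\<rho> (clique_number G)) \<le> real (2 ^ (a * i)) \<and>
      2 ^ (a * i) \<le> clique_number G" for a b k0 :: nat
  proof -
    obtain M and p :: "nat poly" where M: "valid_machine M"
      and run: "\<And>(G :: 'a pair_pre_digraph) vs. simple_graph G \<Longrightarrow> distinct vs \<Longrightarrow> set vs = pverts G \<Longrightarrow>
      \<exists>s. computes_within M (graph_code G vs) (poly p (length (graph_code G vs))) (binary s) \<and>
        (s = clique_number G \<or>
         k0 \<le> clique_number G \<and> (\<exists>i. s = 2 ^ (a * i) \<and> clique_number G \<le> (2 ^ b) ^ i \<and>
           (0 < i \<longrightarrow> (\<exists>S\<subseteq>pverts G. S \<noteq> {} \<and> (2 ^ b) ^ (i - 1) \<le> treewidth (induced G S)))))"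
      by (rule degeneracy_machine[OF b, where a = a and ?k0.0 = k0 and 'a = 'a]) auto
    have "\<exists>s. computes_within M (graph_code G vs) (poly p (length (graph_code G vs))) (binary s) \<and>
        real (clique_number G) / max 1 (?\<rho> (clique_number G)) \<le> real s \<and> s \<le> clique_number G"
      if G: "G \<in> \<G>" and vs: "distinct vs" "set vs = pverts G" for G vs
    proof -
      have "simple_graph G" using assms(1) G by blast
      from run[OF this vs] obtain s where
        s: "computes_within M (graph_code G vs) (poly p (length (graph_code G vs))) (binary s)"
        and cases: "s = clique_number G \<or>
         k0 \<le> clique_number G \<and> (\<exists>i. s = 2 ^ (a * i) \<and> clique_number G \<le> (2 ^ b) ^ i \<and>
           (0 < i \<longrightarrow> (\<exists>S\<subseteq>pverts G. S \<noteq> {} \<and> (2 ^ b) ^ (i - 1) \<le> treewidth (induced G S))))"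
        by blast
      from cases have "real (clique_number G) / max 1 (?\<rho> (clique_number G)) \<le> real s \<and> s \<le> clique_number G"
      proof
        assume "s = clique_number G"
        then show ?thesis using exact by simp
      next
        assume "k0 \<le> clique_number G \<and> (\<exists>i. s = 2 ^ (a * i) \<and> clique_number G \<le> (2 ^ b) ^ i \<and>
           (0 < i \<longrightarrow> (\<exists>S\<subseteq>pverts G. S \<noteq> {} \<and> (2 ^ b) ^ (i - 1) \<le> treewidth (induced G S))))"
        then show ?thesis using good[OF G] by blast
      qed
      then show ?thesis using s by blast
    qed
    then show ?thesis unfolding clique_number_poly_time_approximable_def using M by blast
  qed
  show "clique_number_poly_time_approximable \<G> ?\<rho>"
  proof (cases "c < 1")
    case True
    obtain k0 where k0: "\<And>k. k0 \<le> k \<Longrightarrow> K * real k powr c < real k - 1"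
      using sublinear_powr[OF True, of K] by (auto simp: eventually_at_top_linorder)
    show ?thesis
    \<comment> \<open>the peeling phase is never reached, so the exponents \<open>b = 1\<close> and \<open>a = 0\<close> are arbitrary\<close>
    proof (rule approximable[of 1 k0 0])
      fix G i assume G: "G \<in> \<G>" and large: "k0 \<le> clique_number G"
      then have simple: "simple_graph G" using assms(1) by blast
      have "clique_number G \<le> f (clique_number G) + 1"
        by (rule clique_number_le_binding[OF simple G assms(3)])
      then have "real (clique_number G) - 1 \<le> K * real (clique_number G) powr c"
        using f_le[OF clique_number_props(3)[OF simple]] by linarith
      with k0[OF large] have False by linarith
      then show "real (clique_number G) / max 1 (?\<rho> (clique_number G)) \<le> real (2 ^ (0 * i)) \<and>
        2 ^ (0 * i) \<le> clique_number G" ..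
    qed simp
  next
    case False
    then have c: "1 \<le> c" by simp
    have "0 \<le> 1 / (c + \<epsilon>)" using c \<epsilon> by simp
    moreover have "1 / (c + \<epsilon>) < 1 / c" using c \<epsilon> by (intro divide_strict_left_mono) auto
    ultimately obtain a b :: nat where b: "0 < b" and r: "1 / (c + \<epsilon>) < a / b" "a / b < 1 / c"
      by (rule rational_between)
    have "c * (a / b) < 1" using r(2) c by (simp add: field_simps)
    then obtain k0 where k0: "\<And>k. k0 \<le> k \<Longrightarrow>
        (2 ^ b * K) powr (a / b) * real k powr (c * (a / b)) < real k - 1"
      using sublinear_powr[of "c * (a / b)" "(2 ^ b * K) powr (a / b)"]
      by (auto simp: eventually_at_top_linorder)
    show ?thesis
    proof (rule approximable[OF b, of k0 a])
      fix G i assume G: "G \<in> \<G>" and large: "k0 \<le> clique_number G"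
        and le: "clique_number G \<le> (2 ^ b) ^ i"
        and dense: "0 < i \<Longrightarrow> \<exists>S\<subseteq>pverts G. S \<noteq> {} \<and> (2 ^ b) ^ (i - 1) \<le> treewidth (induced G S)"
      have simple: "simple_graph G" using assms(1) G by blast
      have upper: "real ((2 ^ b) ^ (i - 1)) \<le> K * real (clique_number G) powr c" if i: "0 < i"
      proof -
        from dense[OF i] obtain S where S: "S \<subseteq> pverts G" "S \<noteq> {}"
          "(2 ^ b) ^ (i - 1) \<le> treewidth (induced G S)" by blast
        have "treewidth (induced G S) \<le> f (clique_number (induced G S))"
          using assms(3) G induced_props(2)[OF simple S(1,2)] S(2)
          unfolding tw_omega_binding_def by (simp add: induced_def)
        with S(3) have "(2 ^ b) ^ (i - 1) \<le> f (clique_number (induced G S))" by linarith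
        then have "real ((2 ^ b) ^ (i - 1)) \<le> real (f (clique_number (induced G S)))"
          by (rule of_nat_mono)
        also have "\<dots> \<le> K * real (clique_number (induced G S)) powr c"
          by (rule f_le[OF clique_number_props(3)[OF induced_props(1)[OF simple S(1,2)]]])
        also have "\<dots> \<le> K * real (clique_number G) powr c"
          using K c clique_number_induced[OF simple S(1,2)] by (intro mult_left_mono powr_mono2) auto
        finally show ?thesis .
      qed
      show "real (clique_number G) / max 1 (?\<rho> (clique_number G)) \<le> real (2 ^ (a * i)) \<and>
        2 ^ (a * i) \<le> clique_number G"
        using approximation_guarantee[OF \<epsilon> c r(1) b k0[OF large] clique_number_props(3)[OF simple] le upper K]
        by blast
    qed
  qed
qed

end
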